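(* Let $n\to\infty$ with $\frac{n}{m}\to\bar c\in(0,1)$. Then $$n\left(W_0-\bar\mu\right)\ \overset{d}{\to}\ \mathcal{N}\left(0,\bar\sigma^2\right),$$ where $$\bar\mu=e\,(1-\bar c)^{\frac{1-\bar c}{\bar c}},\qquad \bar\sigma^2=e^2\,(1-\bar c)^{\frac{2(1-\bar c)}{\bar c}}\left(\ln\left(\frac{1}{1-\bar c}\right)-\bar c\right).$$
   Context: For positive integers $n,m$, $W_0=\frac{\frac1n\operatorname{Tr}(\mathbf{X}\mathbf{X}^\dagger)}{\det(\mathbf{X}\mathbf{X}^\dagger)^{1/n}}$, where $\mathbf{X}$ is an $n\times m$ random matrix whose columns are independent circularly symmetric complex Gaussian vectors in $\mathbb{C}^n$ with mean zero and covariance matrix $N_0\mathbf{I}_n$, $N_0>0$. Here $\overset{d}{\to}$ denotes convergence in distribution, and $\mathcal{N}(0,\sigma^2)$ is the real Gaussian distribution with mean $0$ and variance $\sigma^2$.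
   Formalization: As stated the limit fails (m=2n+1, c̄=1/2 gives a nonzero mean); the formal theorem proves it under n/m→c̄ with μ̄ evaluated at n/m in place of c̄, and with μ̄ at c̄ under the added (necessary) condition n(n/m−c̄)→0. *)

theory Defs
  imports
    "HOL-Probability.Probability"
    "Jordan_Normal_Form.Gauss_Jordan_Elimination"
    "Jordan_Normal_Form.Determinant"
    "Jordan_Normal_Form.Schur_Decomposition"
begin

text \<open>
  Type \<open>complex mat\<close> carries no sigma-algebra, so a random vector in \<open>\<complex>\<^sup>d\<close> is treated through its
  coordinates, as a random element of the product space \<open>\<Pi>\<^sub>M i\<in>{..<d}. borel\<close>.
\<close>

definition vec_coords :: "nat \<Rightarrow> complex Matrix.vec \<Rightarrow> nat \<Rightarrow> complex" where
  "vec_coords d z = (\<lambda>i\<in>{..<d}. vec_index z i)"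

text \<open>
  For a positive definite covariance matrix \<open>\<Sigma> = E[z z\<^sup>\<dagger>]\<close>, the circularly symmetric complex Gaussian law
  on \<open>\<complex>\<^sup>d\<close> (which has mean zero) is the one with density
  \<open>exp (- z\<^sup>\<dagger> \<Sigma>\<^sup>-\<^sup>1 z) / (\<pi>\<^sup>d det \<Sigma>)\<close> with respect to Lebesgue measure on \<open>\<complex>\<^sup>d = \<real>\<^sup>2\<^sup>d\<close>.
  The quadratic form and the determinant are real, so \<open>Re\<close> is only a type conversion.
  The library's \<open>\<bullet>c\<close> conjugates its second argument.
\<close>

definition complex_normal_density :: "nat \<Rightarrow> complex mat \<Rightarrow> complex Matrix.vec \<Rightarrow> real" where
  "complex_normal_density d S z =
     exp (- Re ((the (mat_inverse S) *\<^sub>v z) \<bullet>c z)) / (pi ^ d * Re (Determinant.det S))"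

definition circ_sym_complex_gaussian ::
    "'a measure \<Rightarrow> nat \<Rightarrow> ('a \<Rightarrow> complex Matrix.vec) \<Rightarrow> complex mat \<Rightarrow> bool" where
  "circ_sym_complex_gaussian M d Z S \<longleftrightarrow>
     distributed M (\<Pi>\<^sub>M i\<in>{..<d}. (lborel :: complex measure)) (\<lambda>\<omega>. vec_coords d (Z \<omega>))
       (\<lambda>x. ennreal (complex_normal_density d S (Matrix.vec d x)))"

definition gaussian_column_matrix ::
    "'a measure \<Rightarrow> nat \<Rightarrow> nat \<Rightarrow> real \<Rightarrow> ('a \<Rightarrow> complex mat) \<Rightarrow> bool" where
  "gaussian_column_matrix M n m N0 X \<longleftrightarrow>
     (\<forall>\<omega>\<in>space M. X \<omega> \<in> carrier_mat n m) \<and>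
     prob_space.indep_vars M (\<lambda>_. \<Pi>\<^sub>M i\<in>{..<n}. (borel :: complex measure))
       (\<lambda>j \<omega>. vec_coords n (Matrix.col (X \<omega>) j)) {..<m} \<and>
     (\<forall>j<m. circ_sym_complex_gaussian M n (\<lambda>\<omega>. Matrix.col (X \<omega>) j)
              (complex_of_real N0 \<cdot>\<^sub>m 1\<^sub>m n))"

definition mat_trace :: "complex mat \<Rightarrow> complex" where
  "mat_trace A = (\<Sum>i<dim_row A. A $$ (i, i))"

text \<open>
  Trace and determinant of \<open>X X\<^sup>\<dagger>\<close> are real and nonnegative. If the determinant vanishes (surely
  when \<open>n > m\<close>, with probability zero when \<open>n \<le> m\<close>), the value is \<open>0\<close> by division by zero.
\<close>

definition W0 :: "complex mat \<Rightarrow> real" where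
  "W0 X = (let n = real (dim_row X); G = X * mat_adjoint X in
     (1 / n * Re (mat_trace G)) / (Re (Determinant.det G) powr (1 / n)))"

text \<open>
  Centring pitfall: \<open>n (mu_bar (n/m) - mu_bar c)\<close> behaves like \<open>mu_bar' c * n (n/m - c)\<close> with
  \<open>mu_bar' c > 0\<close>, and \<open>n/m \<rightarrow> c\<close> alone does not make this vanish (it has a nonzero limit for
  \<open>m = 2 * n + 1\<close>, \<open>c = 1/2\<close>). So centring at \<open>mu_bar (n/m)\<close> is valid whenever \<open>n/m \<rightarrow> c\<close>, whereas
  centring at the limit \<open>mu_bar c\<close> needs \<open>n (n/m - c) \<rightarrow> 0\<close>.
\<close>

definition mu_bar :: "real \<Rightarrow> real" where
  "mu_bar c = exp 1 * (1 - c) powr ((1 - c) / c)"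

definition sigma2_bar :: "real \<Rightarrow> real" where
  "sigma2_bar c = (exp 1)\<^sup>2 * (1 - c) powr (2 * (1 - c) / c) * (ln (1 / (1 - c)) - c)"

definition real_gaussian :: "real \<Rightarrow> real \<Rightarrow> real measure" where
  "real_gaussian \<mu> v = density lborel (\<lambda>x. ennreal (normal_density \<mu> (sqrt v) x))"

text \<open>
  Convergence in distribution depends on the laws only, so the \<open>k\<close>-th random variable may live on its
  own probability space \<open>P k\<close>.
\<close>

definition converges_in_distribution ::
    "(nat \<Rightarrow> 'a measure) \<Rightarrow> (nat \<Rightarrow> 'a \<Rightarrow> real) \<Rightarrow> real measure \<Rightarrow> bool" where
  "converges_in_distribution P Y L \<longleftrightarrow> weak_conv_m (\<lambda>k. distr (P k) borel (Y k)) L"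

end

theory Submission
  imports Defs
begin

text \<open>
  Write \<open>T\<close> for the trace and \<open>D\<close> for the determinant of \<open>X X\<^sup>\<dagger>\<close>, so that \<open>W0 = (T / n) / D powr (1 / n)\<close>.

  The law of a Gaussian row is invariant under unitary maps. Rotating the row with index \<open>i\<close> so that
  the span of the earlier rows becomes the span of the first \<open>i\<close> coordinate vectors turns its squared distance
  from that span into the sum of its squared moduli over the columns \<open>j \<ge> i\<close>, and keeps its norm. Since \<open>D\<close> is the
  product of these squared distances, the pair \<open>(T, D)\<close> has the law of the sum over all \<open>i, j\<close> of \<open>N0 * e i j\<close>
  together with the product over \<open>i\<close> of the row sums over \<open>j \<ge> i\<close>, where the \<open>e i j\<close> are independent standard
  exponential variables (\<open>gram_det_bartlett\<close>). The parameter \<open>N0\<close> cancels in the ratio, and all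
  that remains is a statement about these exponentials (\<open>W0_law\<close>, \<open>mean_ratio_energy\<close>).

  Put \<open>T = n m (1 + \<tau>)\<close> and let \<open>(m - i) (1 + \<delta> i)\<close> be the row sums, after division by \<open>N0\<close>. Then
  \<open>n ln W0 = n ln (1 + \<tau>) - (\<Sum>i<n. ln (1 + \<delta> i)) + n ln m - (\<Sum>i<n. ln (m - i))\<close>, and the logarithms are
  expanded to second order. The first-order part \<open>n \<tau> - (\<Sum>i<n. \<delta> i)\<close> is a linear form in centred exponentials
  with small coefficients and with variance \<open>(\<Sum>i<n. 1 / (m - i)) - n / m\<close>, which tends to
  \<open>ln (1 / (1 - c)) - c\<close>; hence it is asymptotically normal (\<open>char_exponential_linear_form\<close>). The second-order part
  concentrates around half of \<open>\<Sum>i<n. 1 / (m - i)\<close>, which is close to half of \<open>ln (m / (m - n))\<close>. Stirling's formula for the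
  deterministic part produces the same quantity with the opposite sign, next to \<open>n ln (mu_bar (n / m))\<close>. The two
  cancel (\<open>log_det_centring\<close>), and this is why \<open>mu_bar (n / m)\<close> is the correct centring without a bias term of order \<open>1 / n\<close>.

  Exponentiating gives \<open>n (W0 - mu_bar (n / m))\<close> up to a vanishing error as \<open>mu_bar c\<close> times the linear form
  (\<open>exp_delta_bound\<close>). All errors are controlled for fixed \<open>n\<close> and \<open>m\<close> as distances between
  characteristic functions (\<open>char_ratio\<close>), so the limit follows from Levy's continuity theorem.
  Centring at \<open>mu_bar c\<close> instead differs by \<open>n (mu_bar (n / m) - mu_bar c)\<close>, which vanishes
  together with \<open>n (n / m - c)\<close> because \<open>mu_bar\<close> is differentiable.
\<close>

section \<open>Isometries preserving Lebesgue and Gaussian measure\<close>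

abbreviation lebesgue_PiM :: "'i set \<Rightarrow> ('i \<Rightarrow> complex) measure" where
  "lebesgue_PiM J \<equiv> PiM J (\<lambda>_. lborel)"

lemma product_sigma_finite_lborel: "product_sigma_finite (\<lambda>_. lborel :: complex measure)"
  by (simp add: product_sigma_finite_def lborel.sigma_finite_measure_axioms)

definition shear :: "'i \<Rightarrow> 'i \<Rightarrow> complex \<Rightarrow> ('i \<Rightarrow> complex) \<Rightarrow> 'i \<Rightarrow> complex" where
  "shear i j p x = x(i := x i + p * x j)"

lemma measurable_shear:
  assumes "i \<in> J" "j \<in> J"
  shows "shear i j p \<in> measurable (lebesgue_PiM J) (lebesgue_PiM J)"
proof -
  have J: "J = insert i J" using assms by auto
  have "(\<lambda>x. x(i := x i + p * x j)) \<in> measurable (lebesgue_PiM J) (lebesgue_PiM (insert i J))"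
    using assms by (intro measurable_fun_upd[where J = J]) auto
  then show ?thesis unfolding shear_def[abs_def] using J by simp
qed

lemma nn_integral_translation:
  fixes f :: "complex \<Rightarrow> ennreal"
  assumes [measurable]: "f \<in> borel_measurable borel"
  shows "(\<integral>\<^sup>+y. f (y + a) \<partial>lborel) = (\<integral>\<^sup>+y. f y \<partial>lborel)"
proof -
  have "(\<integral>\<^sup>+y. f y \<partial>lborel) = (\<integral>\<^sup>+y. f y \<partial>distr lborel borel ((+) a))"
    by (simp add: lborel_distr_plus)
  also have "\<dots> = (\<integral>\<^sup>+y. f (a + y) \<partial>lborel)"
    by (subst nn_integral_distr) auto
  finally show ?thesis by (simp add: add.commute)
qed

text \<open>
  Integrating over coordinate \<open>i\<close> first, a shear is a translation by an amount that depends only on the other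
  coordinates. Invariance under unitary maps is derived from shears below, in any number of coordinates.
\<close>

lemma distr_shear:
  assumes J: "finite J" "i \<in> J" "j \<in> J" "i \<noteq> j"
  shows "distr (lebesgue_PiM J) (lebesgue_PiM J) (shear i j p) = lebesgue_PiM J"
proof (rule measure_eqI)
  interpret product_sigma_finite "\<lambda>_. lborel :: complex measure" by (rule product_sigma_finite_lborel)
  note [measurable] = measurable_shear[OF J(2,3), of p]
  fix A assume "A \<in> sets (distr (lebesgue_PiM J) (lebesgue_PiM J) (shear i j p))"
  then have A[measurable]: "A \<in> sets (lebesgue_PiM J)" by simp
  let ?I = "J - {i}" and ?f = "indicator A :: _ \<Rightarrow> ennreal"
  have ins: "insert i ?I = J" and fin: "finite ?I" and ni: "i \<notin> ?I" using J by auto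
  have upd: "(\<lambda>y. x(i := y)) \<in> measurable lborel (lebesgue_PiM J)" if "x \<in> space (lebesgue_PiM ?I)" for x
    using measurable_component_update[OF that ni] ins by simp
  have "emeasure (distr (lebesgue_PiM J) (lebesgue_PiM J) (shear i j p)) A
      = (\<integral>\<^sup>+x. ?f (shear i j p x) \<partial>lebesgue_PiM J)"
    by (simp add: nn_integral_indicator[symmetric] nn_integral_distr del: nn_integral_indicator)
  also have "\<dots> = (\<integral>\<^sup>+x. (\<integral>\<^sup>+y. ?f (shear i j p (x(i := y))) \<partial>lborel) \<partial>lebesgue_PiM ?I)"
    using product_nn_integral_insert[OF fin ni, of "\<lambda>x. ?f (shear i j p x)"] ins by simp
  also have "\<dots> = (\<integral>\<^sup>+x. (\<integral>\<^sup>+y. ?f (x(i := y)) \<partial>lborel) \<partial>lebesgue_PiM ?I)"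
  proof (rule nn_integral_cong)
    fix x assume x: "x \<in> space (lebesgue_PiM ?I)"
    have [measurable]: "(\<lambda>y. ?f (x(i := y))) \<in> borel_measurable borel"
      using measurable_compose[OF upd[OF x], of ?f] by simp
    have "(\<integral>\<^sup>+y. ?f (shear i j p (x(i := y))) \<partial>lborel) = (\<integral>\<^sup>+y. ?f (x(i := y + p * x j)) \<partial>lborel)"
      using J by (simp add: shear_def)
    also have "\<dots> = (\<integral>\<^sup>+y. ?f (x(i := y)) \<partial>lborel)"
      by (rule nn_integral_translation[where f="\<lambda>y. ?f (x(i := y))"]) measurable
    finally show "(\<integral>\<^sup>+y. ?f (shear i j p (x(i := y))) \<partial>lborel) = \<dots>" .
  qed
  also have "\<dots> = (\<integral>\<^sup>+x. ?f x \<partial>lebesgue_PiM J)"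
    using product_nn_integral_insert[OF fin ni, of ?f] ins by simp
  also have "\<dots> = emeasure (lebesgue_PiM J) A" by simp
  finally show "emeasure (distr (lebesgue_PiM J) (lebesgue_PiM J) (shear i j p)) A
    = emeasure (lebesgue_PiM J) A" .
qed simp

definition cinner_on :: "'i set \<Rightarrow> ('i \<Rightarrow> complex) \<Rightarrow> ('i \<Rightarrow> complex) \<Rightarrow> complex" where
  "cinner_on J x y = (\<Sum>j\<in>J. x j * cnj (y j))"

text \<open>
  A Gram determinant sees vectors only through their inner products, and the Gaussian density sees them only through their
  norms, so such maps are symmetries of both.
\<close>

definition lebesgue_isometry :: "'i set \<Rightarrow> (('i \<Rightarrow> complex) \<Rightarrow> 'i \<Rightarrow> complex) \<Rightarrow> bool" where
  "lebesgue_isometry J R \<longleftrightarrow>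
     R \<in> measurable (lebesgue_PiM J) (lebesgue_PiM J) \<and>
     distr (lebesgue_PiM J) (lebesgue_PiM J) R = lebesgue_PiM J \<and>
     (\<forall>x y. cinner_on J (R x) (R y) = cinner_on J x y)"

lemma lebesgue_isometry_id: "lebesgue_isometry J (\<lambda>x. x)"
  by (auto simp: lebesgue_isometry_def distr_id)

lemma lebesgue_isometry_comp:
  assumes "lebesgue_isometry J R" "lebesgue_isometry J S"
  shows "lebesgue_isometry J (\<lambda>x. S (R x))"
  using assms unfolding lebesgue_isometry_def
  by (auto simp: distr_distr[symmetric, unfolded comp_def] intro: measurable_compose)

text \<open>
  The unitary matrix with rows \<open>(a, b)\<close> and \<open>(- cnj b, a)\<close>, acting on the coordinates
  \<open>i\<close> and \<open>j\<close>.
\<close>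

definition givens :: "'i \<Rightarrow> 'i \<Rightarrow> real \<Rightarrow> complex \<Rightarrow> ('i \<Rightarrow> complex) \<Rightarrow> 'i \<Rightarrow> complex" where
  "givens i j a b x = x(i := of_real a * x i + b * x j, j := - cnj b * x i + of_real a * x j)"

text \<open>
  A two by two matrix of determinant one whose lower left entry is nonzero is a product of an upper, a lower and an upper
  unipotent matrix. The entry \<open>p\<close> solves \<open>1 - p * cnj b = a\<close>, and the norm condition yields
  \<open>p * (1 + a) = b\<close>.
\<close>

lemma givens_eq_shears:
  assumes "i \<noteq> j" "b \<noteq> 0" "a\<^sup>2 + (cmod b)\<^sup>2 = 1"
  defines "p \<equiv> (1 - of_real a) / cnj b"
  shows "givens i j a b x = shear i j p (shear j i (- cnj b) (shear i j p x))"
proof -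
  have nz: "cnj b \<noteq> 0" using assms by simp
  have "b * cnj b = of_real (1 - a\<^sup>2)"
    using assms(3) by (simp add: complex_norm_square[symmetric] flip: of_real_power) (metis add_diff_cancel_left' of_real_1 of_real_diff)
  then have b: "b * cnj b = (1 - of_real a) * (1 + of_real a)"
    by (simp add: algebra_simps power2_eq_square)
  have 1: "1 + p * (- cnj b) = of_real a" using nz by (simp add: p_def)
  have "p * (1 + of_real a) = b" using b nz by (simp add: p_def field_simps)
  then have 2: "p + p * of_real a = b" by (simp add: algebra_simps)
  show ?thesis
  proof
    fix l
    have "x i + p * x j + p * (x j - cnj b * (x i + p * x j)) = (1 + p * (- cnj b)) * (x i + p * x j) + p * x j"
      by (simp add: algebra_simps)
    also have "\<dots> = of_real a * x i + (p + p * of_real a) * x j"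
      unfolding 1 by (simp add: algebra_simps)
    finally have A: "x i + p * x j + p * (x j - cnj b * (x i + p * x j)) = of_real a * x i + b * x j"
      unfolding 2 .
    have B: "x j - cnj b * (x i + p * x j) = - cnj b * x i + of_real a * x j"
      unfolding 1[symmetric] by (simp add: algebra_simps)
    show "givens i j a b x l = shear i j p (shear j i (- cnj b) (shear i j p x)) l"
      using assms(1) A B by (auto simp: givens_def shear_def)
  qed
qed

lemma cinner_givens:
  assumes "finite J" "i \<in> J" "j \<in> J" "i \<noteq> j" "a\<^sup>2 + (cmod b)\<^sup>2 = 1"
  shows "cinner_on J (givens i j a b x) (givens i j a b y) = cinner_on J x y"
proof -
  have split: "cinner_on J u v = u i * cnj (v i) + u j * cnj (v j) + cinner_on (J - {i, j}) u v" for u v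
  proof -
    have "J = insert i (insert j (J - {i,j}))" using assms by auto
    then show ?thesis unfolding cinner_on_def using assms
      by (metis (no_types, lifting) Diff_iff add.assoc finite_Diff finite_insert insert_iff sum.insert)
  qed
  have rest: "cinner_on (J - {i, j}) (givens i j a b x) (givens i j a b y) = cinner_on (J - {i, j}) x y"
    unfolding cinner_on_def by (intro sum.cong) (auto simp: givens_def)
  have bb: "b * cnj b = 1 - of_real a * of_real a"
    using assms(5) by (simp add: complex_norm_square[symmetric] power2_eq_square flip: of_real_power of_real_mult)
      (metis add_diff_cancel_left' of_real_1 of_real_diff)
  have "(of_real a * x i + b * x j) * cnj (of_real a * y i + b * y j)
      + (- cnj b * x i + of_real a * x j) * cnj (- cnj b * y i + of_real a * y j)
     = (of_real a * of_real a + b * cnj b) * (x i * cnj (y i) + x j * cnj (y j))"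
    by (simp add: algebra_simps)
  also have "\<dots> = x i * cnj (y i) + x j * cnj (y j)" by (simp add: bb)
  finally show ?thesis
    using assms(4) rest by (subst (1 2) split) (simp add: givens_def)
qed

lemma lebesgue_isometry_givens:
  assumes J: "finite J" "i \<in> J" "j \<in> J" "i \<noteq> j" "b \<noteq> 0" "a\<^sup>2 + (cmod b)\<^sup>2 = 1"
  shows "lebesgue_isometry J (givens i j a b)"
proof -
  define p where "p = (1 - of_real a) / cnj b"
  let ?L = "lebesgue_PiM J"
  have eq: "givens i j a b = (\<lambda>x. shear i j p (shear j i (- cnj b) (shear i j p x)))"
    using givens_eq_shears[OF J(4-6)] by (auto simp: p_def)
  note m[measurable] = measurable_shear[OF J(2,3)] measurable_shear[OF J(3,2)]
  have "distr ?L ?L (givens i j a b) = distr (distr (distr ?L ?L (shear i j p)) ?L (shear j i (- cnj b))) ?L (shear i j p)"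
    unfolding eq by (simp add: distr_distr comp_def)
  also have "\<dots> = ?L" using J by (simp add: distr_shear)
  finally show ?thesis
    unfolding lebesgue_isometry_def using cinner_givens[OF J(1-4,6)] by (auto simp: eq)
qed

lemma exists_givens_annihilator:
  fixes u v :: complex
  assumes "v \<noteq> 0"
  obtains a b where "b \<noteq> 0" "a\<^sup>2 + (cmod b)\<^sup>2 = 1" "- cnj b * u + of_real a * v = 0"
proof (cases "u = 0")
  case True
  then show ?thesis using that[of 1 0] by simp
next
  case False
  define r where "r = sqrt ((cmod u)\<^sup>2 + (cmod v)\<^sup>2)"
  have r: "r > 0" "r\<^sup>2 = (cmod u)\<^sup>2 + (cmod v)\<^sup>2" using False by (auto simp: r_def sum_power2_gt_zero_iff)
  \<comment> \<open>\<open>(a, b)\<close> is the unit vector proportional to \<open>(cnj u, cnj v)\<close> whose first entry is positive.\<close>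
  define a where "a = cmod u / r"
  define b where "b = cnj (of_real a * v / u)"
  have "a > 0" using False r by (simp add: a_def)
  have "cmod b = cmod v / r" using False r by (simp add: b_def a_def norm_mult norm_divide)
  then have "a\<^sup>2 + (cmod b)\<^sup>2 = ((cmod u)\<^sup>2 + (cmod v)\<^sup>2) / r\<^sup>2"
    by (simp add: a_def power_divide add_divide_distrib)
  then have "a\<^sup>2 + (cmod b)\<^sup>2 = 1" using r(1) by (simp add: r(2)[symmetric])
  moreover have "b \<noteq> 0" using assms False \<open>a > 0\<close> by (simp add: b_def)
  moreover have "- cnj b * u + of_real a * v = 0" using False by (simp add: b_def)
  ultimately show ?thesis using that by blast
qed

text \<open>
  Coordinates beyond \<open>k\<close> are cleared one at a time by rotations against coordinate \<open>k\<close>. These act on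
  coordinates at or beyond \<open>k\<close> only, so that vectors supported on the first \<open>k\<close> coordinates stay
  there; this lets the construction be repeated for the next vector.
\<close>

lemma exists_isometry_annihilating:
  fixes z :: "nat \<Rightarrow> complex"
  assumes "k < m" "l \<le> m"
  shows "\<exists>R. lebesgue_isometry {..<m} R \<and> (\<forall>j. k < j \<and> j < l \<longrightarrow> R z j = 0) \<and>
             (\<forall>x. (\<forall>j\<in>{k..<m}. x j = 0) \<longrightarrow> (\<forall>j\<in>{k..<m}. R x j = 0))"
  using assms(2)
proof (induction l)
  case 0
  then show ?case using lebesgue_isometry_id by (intro exI[of _ "\<lambda>x. x"]) auto
next
  case (Suc l)
  then obtain R where R: "lebesgue_isometry {..<m} R" "\<And>j. k < j \<Longrightarrow> j < l \<Longrightarrow> R z j = 0"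
    "\<And>x. (\<forall>j\<in>{k..<m}. x j = 0) \<Longrightarrow> (\<forall>j\<in>{k..<m}. R x j = 0)" by auto
  show ?case
  proof (cases "k < l \<and> R z l \<noteq> 0")
    case False
    then show ?thesis using R by (intro exI[of _ R]) (auto simp: less_Suc_eq)
  next
    case True
    then obtain a b where ab: "b \<noteq> 0" "a\<^sup>2 + (cmod b)\<^sup>2 = 1" "- cnj b * R z k + of_real a * R z l = 0"
      using exists_givens_annihilator[of "R z l" "R z k"] by metis
    have iso: "lebesgue_isometry {..<m} (givens k l a b)"
      using True Suc.prems assms ab by (intro lebesgue_isometry_givens) auto
    show ?thesis
    proof (intro exI[of _ "\<lambda>x. givens k l a b (R x)"] conjI allI impI)
      show "lebesgue_isometry {..<m} (\<lambda>x. givens k l a b (R x))"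
        using lebesgue_isometry_comp[OF R(1) iso] .
      show "givens k l a b (R z) j = 0" if "k < j \<and> j < Suc l" for j
        using that ab(3) R(2) True by (auto simp: givens_def less_Suc_eq)
      show "\<forall>j\<in>{k..<m}. givens k l a b (R x) j = 0" if "\<forall>j\<in>{k..<m}. x j = 0" for x
        using R(3)[OF that] True Suc.prems assms by (auto simp: givens_def)
    qed
  qed
qed

text \<open>
  This is the QR decomposition, as a symmetry of Lebesgue measure.
\<close>

lemma exists_isometry_to_leading_coordinates:
  fixes v :: "nat \<Rightarrow> nat \<Rightarrow> complex"
  assumes "k \<le> m"
  shows "\<exists>R. lebesgue_isometry {..<m} R \<and> (\<forall>i<k. \<forall>j\<in>{k..<m}. R (v i) j = 0)"
  using assms
proof (induction k)
  case 0
  then show ?case using lebesgue_isometry_id by auto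
next
  case (Suc k)
  then obtain R where R: "lebesgue_isometry {..<m} R" "\<And>i. i < k \<Longrightarrow> \<forall>j\<in>{k..<m}. R (v i) j = 0" by auto
  obtain S where S: "lebesgue_isometry {..<m} S" "\<And>j. k < j \<Longrightarrow> j < m \<Longrightarrow> S (R (v k)) j = 0"
    "\<And>x. (\<forall>j\<in>{k..<m}. x j = 0) \<Longrightarrow> (\<forall>j\<in>{k..<m}. S x j = 0)"
    using exists_isometry_annihilating[of k m m "R (v k)"] Suc.prems by auto
  have "S (R (v i)) j = 0" if "i < Suc k" "j \<in> {Suc k..<m}" for i j
    using that S R(2) by (cases "i = k") auto
  then show ?case
    using lebesgue_isometry_comp[OF R(1) S(1)] by (intro exI[of _ "\<lambda>x. S (R x)"]) auto
qed

text \<open>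
  The parameter \<open>s\<close> is the expectation of the squared modulus; the real and imaginary parts have variance
  \<open>s / 2\<close>.
\<close>

definition complex_gaussian :: "real \<Rightarrow> complex measure" where
  "complex_gaussian s = density lborel (\<lambda>z. ennreal (exp (- (cmod z)\<^sup>2 / s) / (pi * s)))"

lemma PiM_density:
  fixes f :: "'a \<Rightarrow> ennreal"
  assumes I: "finite I" and M: "sigma_finite_measure M" and D: "sigma_finite_measure (density M f)"
    and f[measurable]: "f \<in> borel_measurable M"
  shows "PiM I (\<lambda>_. density M f) = density (PiM I (\<lambda>_. M)) (\<lambda>x. \<Prod>i\<in>I. f (x i))"
proof (rule sym, rule product_sigma_finite.PiM_eqI)
  interpret M: product_sigma_finite "\<lambda>_. M" using M by (simp add: product_sigma_finite_def)
  show "product_sigma_finite (\<lambda>_. density M f)" using D by (simp add: product_sigma_finite_def)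
  show "finite I" by fact
  show "sets (density (PiM I (\<lambda>_. M)) (\<lambda>x. \<Prod>i\<in>I. f (x i))) = sets (PiM I (\<lambda>_. density M f))"
    by (simp cong: sets_PiM_cong)
  fix A assume "\<And>i. i \<in> I \<Longrightarrow> A i \<in> sets (density M f)"
  then have A: "\<And>i. i \<in> I \<Longrightarrow> A i \<in> sets M" by simp
  have "emeasure (density (PiM I (\<lambda>_. M)) (\<lambda>x. \<Prod>i\<in>I. f (x i))) (Pi\<^sub>E I A)
     = (\<integral>\<^sup>+x. (\<Prod>i\<in>I. f (x i)) * indicator (Pi\<^sub>E I A) x \<partial>PiM I (\<lambda>_. M))"
    using A I by (intro emeasure_density) (auto intro!: sets_PiM_I_finite)
  also have "\<dots> = (\<integral>\<^sup>+x. (\<Prod>i\<in>I. f (x i) * indicator (A i) (x i)) \<partial>PiM I (\<lambda>_. M))"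
  proof (rule nn_integral_cong)
    fix x assume x: "x \<in> space (PiM I (\<lambda>_. M))"
    have "indicator (Pi\<^sub>E I A) x = (\<Prod>i\<in>I. indicator (A i) (x i) :: ennreal)"
      using x I by (auto simp: indicator_def space_PiM PiE_def Pi_iff prod_zero_iff)
    then show "(\<Prod>i\<in>I. f (x i)) * indicator (Pi\<^sub>E I A) x = (\<Prod>i\<in>I. f (x i) * indicator (A i) (x i))"
      by (simp add: prod.distrib)
  qed
  also have "\<dots> = (\<Prod>i\<in>I. \<integral>\<^sup>+z. f z * indicator (A i) z \<partial>M)"
    using A I by (intro M.product_nn_integral_prod) auto
  also have "\<dots> = (\<Prod>i\<in>I. emeasure (density M f) (A i))"
    using A by (intro prod.cong) (auto simp: emeasure_density)
  finally show "emeasure (density (PiM I (\<lambda>_. M)) (\<lambda>x. \<Prod>i\<in>I. f (x i))) (Pi\<^sub>E I A) = \<dots>" .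
qed

text \<open>
  The disc of squared radius \<open>t\<close> has area \<open>pi * t\<close>, so the squared modulus carries Lebesgue measure
  on the plane to \<open>pi\<close> times Lebesgue measure on the half-line.
\<close>

lemma nn_integral_radial:
  fixes f :: "real \<Rightarrow> ennreal"
  assumes [measurable]: "f \<in> borel_measurable borel"
  shows "(\<integral>\<^sup>+z. f ((cmod z)\<^sup>2) \<partial>lborel) = (\<integral>\<^sup>+t. ennreal pi * indicator {0..} t * f t \<partial>lborel)"
proof -
  have eq: "distr lborel borel (\<lambda>z. (cmod z)\<^sup>2) = density lborel (\<lambda>t. ennreal pi * indicator {0..} t)" (is "?D = ?E")
  proof (rule measure_eqI_generator_eq[where E="range (\<lambda>a::real. {..a})" and \<Omega>=UNIV and A="\<lambda>n::nat. {..real n}"])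
    have em: "emeasure ?D {..a} = ennreal (pi * max 0 a)" "emeasure ?E {..a} = ennreal (pi * max 0 a)" for a
    proof -
      have "emeasure ?D {..a} = emeasure lborel {z::complex. (cmod z)\<^sup>2 \<le> a}"
        by (subst emeasure_distr) (auto intro!: arg_cong[where f="emeasure lborel"])
      also have "\<dots> = ennreal (pi * max 0 a)"
      proof (cases "a \<ge> 0")
        case True
        then have "{z::complex. (cmod z)\<^sup>2 \<le> a} = cball 0 (sqrt a)"
          by (auto simp: real_le_rsqrt real_sqrt_le_iff' intro: real_le_rsqrt)
             (metis norm_ge_zero real_sqrt_pow2 power_mono)
        then show ?thesis using True by (simp add: emeasure_cball unit_ball_vol_numeral(1)[of Num.One, simplified] unit_ball_vol_2 max_def)
      next
        case False
        then have "{z::complex. (cmod z)\<^sup>2 \<le> a} = {}"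
          by (auto dest: order_trans[OF zero_le_power2])
        then show ?thesis using False by (simp add: max_def)
      qed
      finally show "emeasure ?D {..a} = ennreal (pi * max 0 a)" .
      have "emeasure ?E {..a} = (\<integral>\<^sup>+t. ennreal pi * indicator {0..a} t \<partial>lborel)"
        by (subst emeasure_density) (auto intro!: nn_integral_cong simp: indicator_def)
      also have "\<dots> = ennreal pi * emeasure lborel {0..a}" by (subst nn_integral_cmult_indicator) auto
      also have "\<dots> = ennreal (pi * max 0 a)"
        by (cases "a \<ge> 0") (auto simp: max_def ennreal_mult)
      finally show "emeasure ?E {..a} = ennreal (pi * max 0 a)" .
    qed
    show "Int_stable (range (\<lambda>a::real. {..a}))"
      by (auto simp: Int_stable_def)
    show "range (\<lambda>a::real. {..a}) \<subseteq> Pow UNIV" by auto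
    show "emeasure ?D X = emeasure ?E X" if "X \<in> range (\<lambda>a::real. {..a})" for X
      using that em by auto
    show "sets ?D = sigma_sets UNIV (range (\<lambda>a::real. {..a}))"
      by (simp add: borel_eq_atMost)
    show "sets ?E = sigma_sets UNIV (range (\<lambda>a::real. {..a}))"
      by (simp add: borel_eq_atMost)
    show "range (\<lambda>n::nat. {..real n}) \<subseteq> range (\<lambda>a::real. {..a})" by auto
    show "(\<Union>n::nat. {..real n}) = UNIV" by (auto intro: real_arch_simple)
    show "emeasure ?D {..real i} \<noteq> \<infinity>" for i by (simp add: em)
  qed
  have "(\<integral>\<^sup>+z. f ((cmod z)\<^sup>2) \<partial>lborel) = (\<integral>\<^sup>+t. f t \<partial>?D)" by (subst nn_integral_distr) auto
  also have "\<dots> = (\<integral>\<^sup>+t. ennreal pi * indicator {0..} t * f t \<partial>lborel)"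
    unfolding eq by (subst nn_integral_density) auto
  finally show ?thesis .
qed

lemma complex_gaussian_radial:
  assumes s: "s > 0"
  shows "distributed (complex_gaussian s) lborel (\<lambda>z. (cmod z)\<^sup>2 / s) (exponential_density 1)"
  unfolding distributed_def
proof (intro conjI measure_eqI)
  fix A assume "A \<in> sets (distr (complex_gaussian s) lborel (\<lambda>z. (cmod z)\<^sup>2 / s))"
  then have A[measurable]: "A \<in> sets borel" by simp
  have "emeasure (distr (complex_gaussian s) lborel (\<lambda>z. (cmod z)\<^sup>2 / s)) A
     = (\<integral>\<^sup>+z. indicator A ((cmod z)\<^sup>2 / s) \<partial>complex_gaussian s)"
    by (subst nn_integral_indicator[symmetric], simp)
       (subst nn_integral_distr, auto simp: complex_gaussian_def)
  also have "\<dots> = (\<integral>\<^sup>+z. ennreal (exp (- (cmod z)\<^sup>2 / s) / (pi * s)) * indicator A ((cmod z)\<^sup>2 / s) \<partial>lborel)"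
    unfolding complex_gaussian_def by (subst nn_integral_density) auto
  also have "\<dots> = (\<integral>\<^sup>+t. ennreal pi * indicator {0..} t * (ennreal (exp (- t / s) / (pi * s)) * indicator A (t / s)) \<partial>lborel)"
    by (rule nn_integral_radial[where f="\<lambda>t. ennreal (exp (- t / s) / (pi * s)) * indicator A (t / s)"]) measurable
  also have "\<dots> = ennreal s * (\<integral>\<^sup>+t. ennreal pi * indicator {0..} (s * t) * (ennreal (exp (- t) / (pi * s)) * indicator A t) \<partial>lborel)"
    using s by (subst nn_integral_real_affine[where c=s and t=0]) auto
  also have "\<dots> = (\<integral>\<^sup>+t. ennreal s * (ennreal pi * indicator {0..} (s * t) * (ennreal (exp (- t) / (pi * s)) * indicator A t)) \<partial>lborel)"
    by (rule nn_integral_cmult[symmetric]) measurable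
  also have "\<dots> = (\<integral>\<^sup>+t. ennreal (exponential_density 1 t) * indicator A t \<partial>lborel)"
    using s by (intro nn_integral_cong)
      (auto simp: exponential_density_def indicator_def zero_le_mult_iff simp flip: ennreal_mult' split: if_splits)
  also have "\<dots> = emeasure (density lborel (exponential_density 1)) A"
    by (subst emeasure_density) auto
  finally show "emeasure (distr (complex_gaussian s) lborel (\<lambda>z. (cmod z)\<^sup>2 / s)) A
     = emeasure (density lborel (exponential_density 1)) A" .
qed (auto simp: complex_gaussian_def)

lemma prob_space_complex_gaussian:
  assumes s: "s > 0"
  shows "prob_space (complex_gaussian s)"
proof
  have "emeasure (complex_gaussian s) (space (complex_gaussian s))
     = emeasure (distr (complex_gaussian s) lborel (\<lambda>z. (cmod z)\<^sup>2 / s)) UNIV"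
    by (subst emeasure_distr) (auto simp: complex_gaussian_def)
  also have "\<dots> = emeasure (density lborel (exponential_density 1)) UNIV"
    using complex_gaussian_radial[OF s] by (simp add: distributed_def)
  also have "\<dots> = 1"
    using prob_space.emeasure_space_1[OF prob_space_exponential_density[of 1]] by simp
  finally show "emeasure (complex_gaussian s) (space (complex_gaussian s)) = 1" .
qed

section \<open>Gram determinants\<close>

text \<open>
  The determinant of a Gram matrix is real, so \<open>Re\<close> only converts the type. The vectors are indexed by numbers and
  not stored as the rows of a matrix because the induction below adds one vector at a time.
\<close>

definition gram_det :: "nat \<Rightarrow> nat \<Rightarrow> (nat \<Rightarrow> nat \<Rightarrow> complex) \<Rightarrow> real" where
  "gram_det m k v =
     Re (Determinant.det (Matrix.mat k k (\<lambda>(i, i'). cinner_on {..<m} (v i) (v i'))))"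

lemma mat_adjoint_dim [simp]: "dim_row (mat_adjoint A) = dim_col A" "dim_col (mat_adjoint A) = dim_row A"
  unfolding mat_adjoint_def by auto

lemma mat_adjoint_index:
  assumes "i < dim_col A" "j < dim_row A"
  shows "mat_adjoint A $$ (i, j) = conjugate (A $$ (j, i))"
  using assms unfolding mat_adjoint_def by (simp add: mat_of_rows_index)

lemma times_adjoint_index:
  fixes A :: "complex mat"
  assumes "i < dim_row A" "i' < dim_row A"
  shows "(A * mat_adjoint A) $$ (i, i') = (\<Sum>j<dim_col A. A $$ (i, j) * cnj (A $$ (i', j)))"
  using assms by (simp add: scalar_prod_def mat_adjoint_index lessThan_atLeast0)

lemma det_mat_adjoint:
  fixes A :: "complex mat"
  assumes "A \<in> carrier_mat n n"
  shows "Determinant.det (mat_adjoint A) = cnj (Determinant.det A)"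
proof -
  interpret cnj: comm_ring_hom cnj by unfold_locales auto
  have "mat_adjoint A = Matrix.transpose_mat (map_mat cnj A)"
    using assms by (intro eq_matI) (auto simp: mat_adjoint_index)
  then show ?thesis using assms Determinant.det_transpose[of "map_mat cnj A" n] by simp
qed

lemma of_real_cmod_square: "(complex_of_real (cmod z))\<^sup>2 = z * cnj z"
  using complex_norm_square[of z] by simp

lemma det_times_adjoint:
  fixes A :: "complex mat"
  assumes "A \<in> carrier_mat n n"
  shows "Determinant.det (A * mat_adjoint A) = of_real ((cmod (Determinant.det A))\<^sup>2)"
proof -
  have "mat_adjoint A \<in> carrier_mat n n" using assms by auto
  then show ?thesis
    using assms by (simp add: Determinant.det_mult[of _ n] det_mat_adjoint[OF assms] of_real_cmod_square)
qed

lemma gram_det_cong: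
  assumes "\<And>i i'. i < k \<Longrightarrow> i' < k \<Longrightarrow> cinner_on {..<m} (v i) (v i') = cinner_on {..<m} (w i) (w i')"
  shows "gram_det m k v = gram_det m k w"
  unfolding gram_det_def using assms by (intro arg_cong[where f="\<lambda>A. Re (Determinant.det A)"] cong_mat) auto

lemma cinner_on_self: "cinner_on J x x = of_real (\<Sum>j\<in>J. (cmod (x j))\<^sup>2)"
  unfolding cinner_on_def by (simp add: of_real_cmod_square)

text \<open>
  The Gram matrix is \<open>L L\<^sup>\<dagger>\<close> for the square matrix \<open>L\<close> of the coordinates that matter.
\<close>

lemma gram_det_leading_coordinates:
  assumes "k \<le> m" "\<And>i j. i < k \<Longrightarrow> j \<in> {k..<m} \<Longrightarrow> w i j = 0"
  shows "gram_det m k w = (cmod (Determinant.det (Matrix.mat k k (\<lambda>(i, j). w i j))))\<^sup>2"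
proof -
  let ?L = "Matrix.mat k k (\<lambda>(i, j). w i j)"
  have "Matrix.mat k k (\<lambda>(i, i'). cinner_on {..<m} (w i) (w i')) = ?L * mat_adjoint ?L"
  proof (rule eq_matI)
    fix i i' assume "i < dim_row (?L * mat_adjoint ?L)" "i' < dim_col (?L * mat_adjoint ?L)"
    then have i: "i < k" "i' < k" by auto
    have "cinner_on {..<m} (w i) (w i') = (\<Sum>j<k. w i j * cnj (w i' j))"
      unfolding cinner_on_def using assms i by (intro sum.mono_neutral_right) auto
    then show "Matrix.mat k k (\<lambda>(i, i'). cinner_on {..<m} (w i) (w i')) $$ (i, i') = (?L * mat_adjoint ?L) $$ (i, i')"
      using i by (subst times_adjoint_index) auto
  qed auto
  then show ?thesis unfolding gram_det_def by (simp add: det_times_adjoint[of _ k])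
qed

text \<open>
  Replacing the tail of the last vector by its length, in the single coordinate \<open>k\<close>, changes no inner product.
  Afterwards the vectors form a square block triangular matrix with that length in the corner.
\<close>

lemma gram_det_Suc:
  assumes k: "k < m" and w: "\<And>i j. i < k \<Longrightarrow> j \<in> {k..<m} \<Longrightarrow> w i j = 0"
  shows "gram_det m (Suc k) w = gram_det m k w * (\<Sum>j\<in>{k..<m}. (cmod (w k j))\<^sup>2)"
proof -
  define r where "r = sqrt (\<Sum>j\<in>{k..<m}. (cmod (w k j))\<^sup>2)"
  have r2: "r\<^sup>2 = (\<Sum>j\<in>{k..<m}. (cmod (w k j))\<^sup>2)" unfolding r_def by (simp add: sum_nonneg)
  \<comment> \<open>The tail of vector \<open>k\<close> is concentrated in coordinate \<open>k\<close>; the other vectors are unchanged below \<open>m\<close>.\<close>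
  define u where "u i j = (if j < k then w i j else if i = k \<and> j = k then of_real r else 0)" for i j
  let ?L = "Matrix.mat k k (\<lambda>(i, j). w i j)"
  let ?U = "Matrix.mat (Suc k) (Suc k) (\<lambda>(i, j). u i j)"
  have split: "cinner_on {..<m} x y = (\<Sum>j<k. x j * cnj (y j)) + (\<Sum>j\<in>{k..<m}. x j * cnj (y j))" for x y
  proof -
    have "{..<m} = {..<k} \<union> {k..<m}" using k by auto
    then show ?thesis unfolding cinner_on_def by (simp add: sum.union_disjoint ivl_disj_int)
  qed
  have inner: "cinner_on {..<m} (u i) (u i') = cinner_on {..<m} (w i) (w i')" if "i < Suc k" "i' < Suc k" for i i'
  proof -
    have 1: "(\<Sum>j<k. u i j * cnj (u i' j)) = (\<Sum>j<k. w i j * cnj (w i' j))"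
      by (intro sum.cong) (auto simp: u_def)
    have "(\<Sum>j\<in>{k..<m}. u i j * cnj (u i' j)) = (\<Sum>j\<in>{k..<m}. w i j * cnj (w i' j))"
    proof (cases "i = k \<and> i' = k")
      case True
      have "(\<Sum>j\<in>{k..<m}. u i j * cnj (u i' j)) = (\<Sum>j\<in>{k}. u i j * cnj (u i' j))"
        using k by (intro sum.mono_neutral_right) (auto simp: u_def)
      also have "\<dots> = of_real (r\<^sup>2)" using True by (simp add: u_def power2_eq_square)
      also have "\<dots> = (\<Sum>j\<in>{k..<m}. w i j * cnj (w i' j))"
        unfolding r2 using True by (simp add: of_real_cmod_square)
      finally show ?thesis .
    next
      case False
      then have "\<forall>j\<in>{k..<m}. u i j * cnj (u i' j) = 0" "\<forall>j\<in>{k..<m}. w i j * cnj (w i' j) = 0"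
        using that w[of i] w[of i'] by (auto simp: u_def less_Suc_eq)
      then show ?thesis by (metis (no_types, lifting) sum.neutral)
    qed
    with 1 show ?thesis by (simp add: split)
  qed
  have "gram_det m (Suc k) w = gram_det m (Suc k) u"
    using inner by (intro gram_det_cong) auto
  also have "\<dots> = (cmod (Determinant.det ?U))\<^sup>2"
    using k by (intro gram_det_leading_coordinates) (auto simp: u_def)
  also have "?U = four_block_mat ?L (0\<^sub>m k 1) (Matrix.mat 1 k (\<lambda>(i, j). w k j)) (Matrix.mat 1 1 (\<lambda>_. of_real r))"
    by (rule eq_matI) (auto simp: u_def less_Suc_eq)
  also have "Determinant.det \<dots> = Determinant.det ?L * Determinant.det (Matrix.mat 1 1 (\<lambda>_. complex_of_real r))"
    by (rule det_four_block_mat_upper_right_zero_col) auto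
  also have "Determinant.det (Matrix.mat 1 1 (\<lambda>_. complex_of_real r)) = of_real r"
    by (subst det_single) auto
  also have "(cmod (Determinant.det ?L * of_real r))\<^sup>2 = (cmod (Determinant.det ?L))\<^sup>2 * r\<^sup>2"
    by (simp add: norm_mult power_mult_distrib)
  also have "(cmod (Determinant.det ?L))\<^sup>2 = gram_det m k w"
    using k w by (intro gram_det_leading_coordinates[symmetric]) auto
  finally show ?thesis unfolding r2 .
qed

lemma gram_det_Suc_rotated:
  assumes k: "k < m" and R: "lebesgue_isometry {..<m} R"
    and v: "\<And>i j. i < k \<Longrightarrow> j \<in> {k..<m} \<Longrightarrow> R (v i) j = 0"
  shows "gram_det m (Suc k) v = gram_det m k v * (\<Sum>j\<in>{k..<m}. (cmod (R (v k) j))\<^sup>2)"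
proof -
  have inner: "cinner_on {..<m} (R x) (R y) = cinner_on {..<m} x y" for x y
    using R by (simp add: lebesgue_isometry_def)
  have g: "gram_det m l (\<lambda>i. R (v i)) = gram_det m l v" for l
    by (rule gram_det_cong) (simp add: inner)
  show ?thesis using gram_det_Suc[OF k, of "\<lambda>i. R (v i)"] v by (simp add: g)
qed

lemma measurable_cnj: "cnj \<in> borel_measurable borel"
  by (intro borel_measurable_continuous_onI continuous_intros)

lemma measurable_gram_det:
  assumes "\<And>i j. i < k \<Longrightarrow> j < m \<Longrightarrow> (\<lambda>x. v x i j) \<in> borel_measurable M"
  shows "(\<lambda>x. gram_det m k (v x)) \<in> borel_measurable M"
proof -
  have perm: "p i < k" if "p permutes {0..<k}" "i < k" for p i
    using permutes_in_image[OF that(1), of i] that(2) by simp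
  have "gram_det m k (v x) = Re (\<Sum>p\<in>{p. p permutes {0..<k}}. signof p *
          (\<Prod>i = 0..<k. \<Sum>j<m. v x i j * cnj (v x (p i) j)))" for x
    unfolding gram_det_def
    by (subst det_def'[of _ k]) (auto intro!: arg_cong[where f=Re] sum.cong prod.cong
        simp: cinner_on_def perm)
  moreover have "(\<lambda>x. Re (\<Sum>p\<in>{p. p permutes {0..<k}}. signof p *
          (\<Prod>i = 0..<k. \<Sum>j<m. v x i j * cnj (v x (p i) j)))) \<in> borel_measurable M"
  proof (intro measurable_compose[OF _ borel_measurable_Re] borel_measurable_sum borel_measurable_times
      borel_measurable_prod borel_measurable_const)
    fix p i j assume "p \<in> {p. p permutes {0..<k}}" "i \<in> {0..<k}" "j \<in> {..<m}"
    then show "(\<lambda>x. v x i j) \<in> borel_measurable M" "(\<lambda>x. cnj (v x (p i) j)) \<in> borel_measurable M"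
      using perm[of p i] by (auto intro!: assms measurable_compose[OF _ measurable_cnj])
  qed
  ultimately show ?thesis by simp
qed

text \<open>
  The Gaussian density is a function of the norm, which the isometry preserves together with Lebesgue measure.
\<close>

lemma nn_integral_gaussian_isometry:
  assumes s: "s > 0" and R: "lebesgue_isometry {..<m::nat} R"
    and f[measurable]: "f \<in> borel_measurable (lebesgue_PiM {..<m})"
  shows "(\<integral>\<^sup>+x. f (R x) \<partial>PiM {..<m} (\<lambda>_. complex_gaussian s)) = (\<integral>\<^sup>+x. f x \<partial>PiM {..<m} (\<lambda>_. complex_gaussian s))"
proof -
  let ?L = "lebesgue_PiM {..<m}"
  define g where "g x = (\<Prod>i<m. ennreal (exp (- (cmod (x i))\<^sup>2 / s) / (pi * s)))" for x :: "nat \<Rightarrow> complex"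
  have [measurable]: "g \<in> borel_measurable ?L" unfolding g_def[abs_def] by measurable
  have [measurable]: "R \<in> measurable ?L ?L" and dR: "distr ?L ?L R = ?L"
    using R by (auto simp: lebesgue_isometry_def)
  have gR: "g (R x) = g x" for x
  proof -
    have *: "g x = ennreal (exp (- Re (cinner_on {..<m} x x) / s) / (pi * s) ^ m)" for x
      unfolding g_def using s
      by (subst prod_ennreal) (auto simp: cinner_on_self exp_sum prod_dividef sum_negf sum_divide_distrib simp flip: exp_sum)
    have "cinner_on {..<m} (R x) (R x) = cinner_on {..<m} x x" using R by (simp add: lebesgue_isometry_def)
    then show ?thesis unfolding * by simp
  qed
  interpret G: prob_space "complex_gaussian s" by (rule prob_space_complex_gaussian[OF s])
  have G: "PiM {..<m} (\<lambda>_. complex_gaussian s) = density ?L g"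
    unfolding complex_gaussian_def g_def[abs_def]
    by (rule PiM_density) (use lborel.sigma_finite_measure_axioms G.sigma_finite_measure_axioms in \<open>auto simp: complex_gaussian_def\<close>)
  have "(\<integral>\<^sup>+x. f (R x) \<partial>density ?L g) = (\<integral>\<^sup>+x. g (R x) * f (R x) \<partial>?L)"
    by (subst nn_integral_density) (auto simp: gR)
  also have "\<dots> = (\<integral>\<^sup>+x. g x * f x \<partial>distr ?L ?L R)"
    by (subst nn_integral_distr) auto
  also have "\<dots> = (\<integral>\<^sup>+x. f x \<partial>density ?L g)" unfolding dR by (subst nn_integral_density) auto
  finally show ?thesis unfolding G .
qed

section \<open>Row-by-row reduction of a Gaussian array\<close>

abbreviation gaussian_array :: "real \<Rightarrow> nat \<Rightarrow> nat \<Rightarrow> (nat \<times> nat \<Rightarrow> complex) measure" where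
  "gaussian_array s k m \<equiv> PiM ({..<k} \<times> {..<m}) (\<lambda>_. complex_gaussian s)"

abbreviation gaussian_row :: "real \<Rightarrow> nat \<Rightarrow> (nat \<Rightarrow> complex) measure" where
  "gaussian_row s m \<equiv> PiM {..<m} (\<lambda>_. complex_gaussian s)"

lemma sets_complex_gaussian [measurable_cong, simp]: "sets (complex_gaussian s) = sets borel"
  by (simp add: complex_gaussian_def)

lemma space_complex_gaussian [simp]: "space (complex_gaussian s) = UNIV"
  by (simp add: complex_gaussian_def)

text \<open>
  The restriction makes the result a point of the product space, whose elements are \<open>undefined\<close> outside the index
  set.
\<close>

definition append_row :: "nat \<Rightarrow> nat \<Rightarrow> (nat \<times> nat \<Rightarrow> complex) \<Rightarrow> (nat \<Rightarrow> complex) \<Rightarrow> nat \<times> nat \<Rightarrow> complex" where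
  "append_row k m x w = (\<lambda>q\<in>{..<Suc k} \<times> {..<m}. if fst q < k then x q else w (snd q))"

lemma measurable_append_row:
  "(\<lambda>p. append_row k m (fst p) (snd p)) \<in> measurable (gaussian_array s k m \<Otimes>\<^sub>M gaussian_row s m) (gaussian_array s (Suc k) m)"
  unfolding append_row_def
proof (rule measurable_restrict)
  fix q assume q: "q \<in> {..<Suc k} \<times> {..<m}"
  show "(\<lambda>p. if fst q < k then fst p q else snd p (snd q)) \<in> measurable (gaussian_array s k m \<Otimes>\<^sub>M gaussian_row s m) (complex_gaussian s)"
  proof (cases "fst q < k")
    case True
    then have "q \<in> {..<k} \<times> {..<m}" using q by auto
    from measurable_compose[OF measurable_fst measurable_component_singleton[OF this]]
    show ?thesis using True by simp
  next
    case False
    have "snd q \<in> {..<m}" using q by auto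
    from measurable_compose[OF measurable_snd measurable_component_singleton[OF this]]
    show ?thesis using False by simp
  qed
qed

lemma nn_integral_append_row:
  assumes s: "s > 0" and f[measurable]: "f \<in> borel_measurable (gaussian_array s (Suc k) m)"
  shows "(\<integral>\<^sup>+x. f x \<partial>gaussian_array s (Suc k) m)
       = (\<integral>\<^sup>+x. \<integral>\<^sup>+w. f (append_row k m x w) \<partial>gaussian_row s m \<partial>gaussian_array s k m)"
proof -
  interpret G: prob_space "complex_gaussian s" by (rule prob_space_complex_gaussian[OF s])
  interpret product_sigma_finite "\<lambda>_. complex_gaussian s"
    by (simp add: product_sigma_finite_def G.sigma_finite_measure_axioms)
  let ?I = "{..<k} \<times> {..<m}" and ?K = "{k} \<times> {..<m}"
  have U: "{..<Suc k} \<times> {..<m} = ?I \<union> ?K" by (auto simp: less_Suc_eq)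
  have re: "distr (PiM ?K (\<lambda>_. complex_gaussian s)) (gaussian_row s m) (\<lambda>y. \<lambda>j\<in>{..<m}. y (k, j)) = gaussian_row s m"
    by (rule distr_PiM_reindex[where M="\<lambda>_. complex_gaussian s"]) (auto simp: inj_on_def G.prob_space_axioms)
  have mr[measurable]: "(\<lambda>y. \<lambda>j\<in>{..<m}. y (k, j)) \<in> measurable (PiM ?K (\<lambda>_. complex_gaussian s)) (gaussian_row s m)"
    by (rule measurable_restrict) (rule measurable_component_singleton, auto)
  have "(\<integral>\<^sup>+x. f x \<partial>gaussian_array s (Suc k) m)
     = (\<integral>\<^sup>+x. \<integral>\<^sup>+y. f (merge ?I ?K (x, y)) \<partial>PiM ?K (\<lambda>_. complex_gaussian s) \<partial>gaussian_array s k m)"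
    using f unfolding U by (intro product_nn_integral_fold) auto
  also have "\<dots> = (\<integral>\<^sup>+x. \<integral>\<^sup>+w. f (append_row k m x w) \<partial>gaussian_row s m \<partial>gaussian_array s k m)"
  proof (rule nn_integral_cong)
    fix x assume x: "x \<in> space (gaussian_array s k m)"
    have "append_row k m x \<in> measurable (gaussian_row s m) (gaussian_array s (Suc k) m)"
      using measurable_compose[OF measurable_Pair1'[OF x] measurable_append_row[of k m s]] by simp
    then have [measurable]: "(\<lambda>w. f (append_row k m x w)) \<in> borel_measurable (gaussian_row s m)"
      by measurable
    have "(\<integral>\<^sup>+w. f (append_row k m x w) \<partial>gaussian_row s m)
       = (\<integral>\<^sup>+y. f (append_row k m x (\<lambda>j\<in>{..<m}. y (k, j))) \<partial>PiM ?K (\<lambda>_. complex_gaussian s))"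
      by (subst re[symmetric], subst nn_integral_distr) auto
    also have "\<dots> = (\<integral>\<^sup>+y. f (merge ?I ?K (x, y)) \<partial>PiM ?K (\<lambda>_. complex_gaussian s))"
      by (intro nn_integral_cong arg_cong[where f=f])
         (auto simp: append_row_def merge_def fun_eq_iff less_Suc_eq)
    finally show "(\<integral>\<^sup>+y. f (merge ?I ?K (x, y)) \<partial>PiM ?K (\<lambda>_. complex_gaussian s))
      = (\<integral>\<^sup>+w. f (append_row k m x w) \<partial>gaussian_row s m)" by simp
  qed
  finally show ?thesis .
qed

definition total_energy :: "nat \<Rightarrow> nat \<Rightarrow> (nat \<times> nat \<Rightarrow> complex) \<Rightarrow> real" where
  "total_energy k m x = (\<Sum>i<k. \<Sum>j<m. (cmod (x (i, j)))\<^sup>2)"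

text \<open>
  In the Bartlett decomposition of a complex Wishart matrix, these factors are the squared diagonal entries of the triangular
  factor.
\<close>

definition tail_energy_prod :: "nat \<Rightarrow> nat \<Rightarrow> (nat \<times> nat \<Rightarrow> complex) \<Rightarrow> real" where
  "tail_energy_prod k m x = (\<Prod>i<k. \<Sum>j\<in>{i..<m}. (cmod (x (i, j)))\<^sup>2)"

lemma array_component_measurable:
  assumes "i < k" "j < m"
  shows "(\<lambda>x. x (i, j)) \<in> borel_measurable (gaussian_array s k m)"
proof -
  have "(\<lambda>x. x (i, j)) \<in> measurable (gaussian_array s k m) (complex_gaussian s)"
    using assms by (intro measurable_component_singleton) auto
  then show ?thesis by (simp add: measurable_cong_sets[OF refl sets_complex_gaussian])
qed

lemma measurable_total_energy [measurable]: "total_energy k m \<in> borel_measurable (gaussian_array s k m)"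
  unfolding total_energy_def[abs_def]
  by (intro borel_measurable_sum borel_measurable_power borel_measurable_norm[THEN measurable_compose[rotated]] array_component_measurable) auto

lemma measurable_tail_energy_prod [measurable]:
  assumes "k \<le> m"
  shows "tail_energy_prod k m \<in> borel_measurable (gaussian_array s k m)"
  unfolding tail_energy_prod_def[abs_def]
  by (intro borel_measurable_prod borel_measurable_sum borel_measurable_power borel_measurable_norm[THEN measurable_compose[rotated]] array_component_measurable) auto

lemma measurable_gram_det_array [measurable]:
  "(\<lambda>x. gram_det m k (\<lambda>i j. x (i, j))) \<in> borel_measurable (gaussian_array s k m)"
  by (rule measurable_gram_det) (rule array_component_measurable)

text \<open>
  For fixed earlier rows, there is an isometry that depends on them and moves their span into the first \<open>k\<close>
  coordinates. Applying it to the last row does not change the law of this row, and turns the new factor of the Gram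
  determinant into the energy of the row in the columns from \<open>k\<close> on, a quantity in which the earlier rows no
  longer occur. Exchanging the integrals, the induction hypothesis applies for each fixed value of the last row; it has to hold
  for all \<open>f\<close>, so that the contribution of this row can be absorbed into \<open>f\<close>.
\<close>

theorem gram_det_bartlett:
  fixes f :: "real \<times> real \<Rightarrow> ennreal"
  assumes s: "s > 0" and "k \<le> m" and "f \<in> borel_measurable borel"
  shows "(\<integral>\<^sup>+x. f (total_energy k m x, gram_det m k (\<lambda>i j. x (i, j))) \<partial>gaussian_array s k m)
       = (\<integral>\<^sup>+x. f (total_energy k m x, tail_energy_prod k m x) \<partial>gaussian_array s k m)"
  using assms(2,3)
proof (induction k arbitrary: f)
  case 0
  then show ?case by (simp add: gram_det_def tail_energy_prod_def)
next
  case (Suc k)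
  then have k: "k < m" by simp
  note f[measurable] = Suc.prems(2)
  interpret G: prob_space "complex_gaussian s" by (rule prob_space_complex_gaussian[OF s])
  interpret A: prob_space "gaussian_array s k m" by (intro prob_space_PiM G.prob_space_axioms)
  interpret W: prob_space "gaussian_row s m" by (intro prob_space_PiM G.prob_space_axioms)
  interpret P: pair_sigma_finite "gaussian_array s k m" "gaussian_row s m"
    by unfold_locales
  define q where "q w = (\<Sum>j<m. (cmod (w j))\<^sup>2)" for w :: "nat \<Rightarrow> complex"
  define h where "h w = (\<Sum>j\<in>{k..<m}. (cmod (w j))\<^sup>2)" for w :: "nat \<Rightarrow> complex"
  let ?G = "\<lambda>x :: nat \<times> nat \<Rightarrow> complex. gram_det m k (\<lambda>i j. x (i, j))"
  have comp: "(\<lambda>w. w j) \<in> borel_measurable (gaussian_row s m)" if "j < m" for j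
    using measurable_component_singleton[of j "{..<m}" "\<lambda>_. complex_gaussian s"] that by (simp add: measurable_cong_sets[OF refl sets_complex_gaussian])
  have [measurable]: "q \<in> borel_measurable (gaussian_row s m)" "h \<in> borel_measurable (gaussian_row s m)"
    unfolding q_def[abs_def] h_def[abs_def]
    by (auto intro!: borel_measurable_sum borel_measurable_power borel_measurable_norm[THEN measurable_compose[rotated]] comp)
  have te: "total_energy (Suc k) m (append_row k m x w) = total_energy k m x + q w" for x w
    by (simp add: total_energy_def append_row_def q_def)
  have tp: "tail_energy_prod (Suc k) m (append_row k m x w) = tail_energy_prod k m x * h w" for x w
    using k by (simp add: tail_energy_prod_def append_row_def h_def)
  have rotate: "(\<integral>\<^sup>+w. f (total_energy k m x + q w, gram_det m (Suc k) (\<lambda>i j. append_row k m x w (i, j))) \<partial>gaussian_row s m)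
      = (\<integral>\<^sup>+w. f (total_energy k m x + q w, ?G x * h w) \<partial>gaussian_row s m)" for x
  proof -
    obtain R where R: "lebesgue_isometry {..<m} R" "\<And>i j. i < k \<Longrightarrow> j \<in> {k..<m} \<Longrightarrow> R (\<lambda>j. x (i, j)) j = 0"
      using exists_isometry_to_leading_coordinates[of k m "\<lambda>i j. x (i, j)"] k by auto
    have inner: "cinner_on {..<m} (R y) (R z) = cinner_on {..<m} y z" for y z
      using R(1) by (simp add: lebesgue_isometry_def)
    have "gram_det m (Suc k) (\<lambda>i j. append_row k m x w (i, j)) = ?G x * h (R w)" for w
    proof -
      let ?v = "\<lambda>i j. if i < k then x (i, j) else w j"
      have "gram_det m (Suc k) (\<lambda>i j. append_row k m x w (i, j)) = gram_det m (Suc k) ?v"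
        by (intro gram_det_cong) (auto simp: cinner_on_def append_row_def intro!: sum.cong)
      also have "\<dots> = gram_det m k ?v * h (R w)"
        using gram_det_Suc_rotated[OF k R(1), of ?v] R(2) by (simp add: h_def)
      also have "gram_det m k ?v = ?G x" by (intro gram_det_cong) auto
      finally show ?thesis .
    qed
    moreover have "q w = q (R w)" for w
      using inner[of w w] unfolding cinner_on_self q_def by (simp only: of_real_eq_iff)
    ultimately have "(\<integral>\<^sup>+w. f (total_energy k m x + q w, gram_det m (Suc k) (\<lambda>i j. append_row k m x w (i, j))) \<partial>gaussian_row s m)
      = (\<integral>\<^sup>+w. (\<lambda>w. f (total_energy k m x + q w, ?G x * h w)) (R w) \<partial>gaussian_row s m)" by simp
    also have "\<dots> = (\<integral>\<^sup>+w. f (total_energy k m x + q w, ?G x * h w) \<partial>gaussian_row s m)"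
    proof (rule nn_integral_gaussian_isometry[OF s R(1)])
      have "(\<lambda>w. f (total_energy k m x + q w, ?G x * h w)) \<in> borel_measurable (gaussian_row s m)" by measurable
      moreover have "sets (gaussian_row s m) = sets (lebesgue_PiM {..<m})" by (intro sets_PiM_cong) auto
      ultimately show "(\<lambda>w. f (total_energy k m x + q w, ?G x * h w)) \<in> borel_measurable (lebesgue_PiM {..<m})"
        using measurable_cong_sets by blast
    qed
    finally show ?thesis .
  qed
  \<comment> \<open>Both sides become integrals over the last row and the earlier rows, equal by the induction hypothesis.\<close>
  have mG: "(\<lambda>x. f (total_energy (Suc k) m x, gram_det m (Suc k) (\<lambda>i j. x (i, j)))) \<in> borel_measurable (gaussian_array s (Suc k) m)"
    by measurable
  have mT: "(\<lambda>x. f (total_energy (Suc k) m x, tail_energy_prod (Suc k) m x)) \<in> borel_measurable (gaussian_array s (Suc k) m)"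
    using Suc.prems(1) by measurable
  have km: "k \<le> m" using k by simp
  note [measurable] = measurable_tail_energy_prod[OF km]
  have "(\<integral>\<^sup>+x. f (total_energy (Suc k) m x, gram_det m (Suc k) (\<lambda>i j. x (i, j))) \<partial>gaussian_array s (Suc k) m)
     = (\<integral>\<^sup>+x. \<integral>\<^sup>+w. f (total_energy k m x + q w, ?G x * h w) \<partial>gaussian_row s m \<partial>gaussian_array s k m)"
    unfolding nn_integral_append_row[OF s mG] te rotate ..
  also have "\<dots> = (\<integral>\<^sup>+w. \<integral>\<^sup>+x. f (total_energy k m x + q w, ?G x * h w) \<partial>gaussian_array s k m \<partial>gaussian_row s m)"
    by (rule P.Fubini'[symmetric]) measurable
  also have "\<dots> = (\<integral>\<^sup>+w. \<integral>\<^sup>+x. f (total_energy k m x + q w, tail_energy_prod k m x * h w) \<partial>gaussian_array s k m \<partial>gaussian_row s m)"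
  proof (rule nn_integral_cong)
    fix w
    have "(\<lambda>p. f (fst p + q w, snd p * h w)) \<in> borel_measurable borel" unfolding borel_prod[symmetric] using f unfolding borel_prod[symmetric] by measurable
    from Suc.IH[OF km this]
    show "(\<integral>\<^sup>+x. f (total_energy k m x + q w, ?G x * h w) \<partial>gaussian_array s k m)
        = (\<integral>\<^sup>+x. f (total_energy k m x + q w, tail_energy_prod k m x * h w) \<partial>gaussian_array s k m)" by simp
  qed
  also have "\<dots> = (\<integral>\<^sup>+x. \<integral>\<^sup>+w. f (total_energy k m x + q w, tail_energy_prod k m x * h w) \<partial>gaussian_row s m \<partial>gaussian_array s k m)"
    by (rule P.Fubini') measurable
  also have "\<dots> = (\<integral>\<^sup>+x. f (total_energy (Suc k) m x, tail_energy_prod (Suc k) m x) \<partial>gaussian_array s (Suc k) m)"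
    unfolding nn_integral_append_row[OF s mT] te tp ..
  finally show ?case .
qed

lemma mat_inverse_smult_one:
  fixes c :: complex
  assumes "c \<noteq> 0"
  shows "the (mat_inverse (c \<cdot>\<^sub>m 1\<^sub>m n)) = (1 / c) \<cdot>\<^sub>m 1\<^sub>m n"
proof -
  let ?A = "c \<cdot>\<^sub>m 1\<^sub>m n" and ?B = "(1 / c) \<cdot>\<^sub>m (1\<^sub>m n :: complex mat)"
  have A: "?A \<in> carrier_mat n n" and B: "?B \<in> carrier_mat n n" by auto
  have AB: "?A * ?B = 1\<^sub>m n" "?B * ?A = 1\<^sub>m n" using assms
    by (auto simp: mult_smult_distrib[of _ n n _ n] mult_smult_assoc_mat[of _ n n _ n] intro!: eq_matI)
  obtain C where C: "mat_inverse ?A = Some C"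
    using mat_inverse(1)[OF A, where b="()"] A B AB
    by (cases "mat_inverse ?A") (auto simp: Units_def ring_mat_def)
  have "?A * C = 1\<^sub>m n" "C \<in> carrier_mat n n" using mat_inverse(2)[OF A C] by auto
  then have "C = ?B"
    using assoc_mult_mat[OF B A, of C n] AB(2) by (simp add: right_mult_one_mat[OF B])
  then show ?thesis using C by simp
qed

lemma complex_normal_density_scalar:
  assumes s: "s > 0"
  shows "ennreal (complex_normal_density n (complex_of_real s \<cdot>\<^sub>m 1\<^sub>m n) (Matrix.vec n x))
       = (\<Prod>i<n. ennreal (exp (- (cmod (x i))\<^sup>2 / s) / (pi * s)))"
proof -
  let ?v = "Matrix.vec n x"
  have "(1 / complex_of_real s) \<cdot>\<^sub>m 1\<^sub>m n *\<^sub>v ?v = (1 / complex_of_real s) \<cdot>\<^sub>v ?v"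
    by (rule eq_vecI) (auto simp: row_smult smult_scalar_prod_distrib[of _ n])
  then have "(the (mat_inverse (complex_of_real s \<cdot>\<^sub>m 1\<^sub>m n)) *\<^sub>v ?v) \<bullet>c ?v = (\<Sum>i<n. of_real ((cmod (x i))\<^sup>2 / s))"
    using s by (simp add: mat_inverse_smult_one scalar_prod_def lessThan_atLeast0 of_real_cmod_square)
  then have "Re ((the (mat_inverse (complex_of_real s \<cdot>\<^sub>m 1\<^sub>m n)) *\<^sub>v ?v) \<bullet>c ?v) = (\<Sum>i<n. (cmod (x i))\<^sup>2 / s)"
    by simp
  moreover have "Re (Determinant.det (complex_of_real s \<cdot>\<^sub>m 1\<^sub>m n)) = s ^ n"
    by (simp flip: of_real_power)
  ultimately have "complex_normal_density n (complex_of_real s \<cdot>\<^sub>m 1\<^sub>m n) ?v = (\<Prod>i<n. exp (- (cmod (x i))\<^sup>2 / s) / (pi * s))"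
    unfolding complex_normal_density_def
    by (simp add: prod_dividef power_mult_distrib sum_negf[symmetric] exp_sum)
  then show ?thesis using s by (subst prod_ennreal) auto
qed

lemma circ_sym_complex_gaussian_iid:
  assumes s: "s > 0" and Z: "circ_sym_complex_gaussian M n Z (complex_of_real s \<cdot>\<^sub>m 1\<^sub>m n)"
  shows "distr M (lebesgue_PiM {..<n}) (\<lambda>\<omega>. vec_coords n (Z \<omega>)) = PiM {..<n} (\<lambda>_. complex_gaussian s)"
proof -
  interpret G: prob_space "complex_gaussian s" by (rule prob_space_complex_gaussian[OF s])
  have "distr M (lebesgue_PiM {..<n}) (\<lambda>\<omega>. vec_coords n (Z \<omega>))
     = density (lebesgue_PiM {..<n}) (\<lambda>x. \<Prod>i<n. ennreal (exp (- (cmod (x i))\<^sup>2 / s) / (pi * s)))"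
    using Z unfolding circ_sym_complex_gaussian_def distributed_def complex_normal_density_scalar[OF s] by simp
  also have "\<dots> = PiM {..<n} (\<lambda>_. complex_gaussian s)"
    unfolding complex_gaussian_def
    by (rule PiM_density[symmetric]) (use lborel.sigma_finite_measure_axioms G.sigma_finite_measure_axioms in \<open>auto simp: complex_gaussian_def\<close>)
  finally show ?thesis .
qed

section \<open>The law of the ratio for a Gaussian matrix\<close>

lemma measurable_coords_if_distributed:
  assumes "circ_sym_complex_gaussian M n Z S" "i < n"
  shows "(\<lambda>\<omega>. vec_index (Z \<omega>) i) \<in> borel_measurable M"
proof -
  have "(\<lambda>\<omega>. vec_coords n (Z \<omega>)) \<in> measurable M (lebesgue_PiM {..<n})"
    using assms(1) by (simp add: circ_sym_complex_gaussian_def distributed_def)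
  from measurable_compose[OF this measurable_component_singleton[of i]]
  show ?thesis using assms(2) by (simp add: vec_coords_def)
qed

text \<open>
  The columns are independent, and the density of each column is a product over its coordinates, so the probability of a
  rectangle factorises completely. This exchanges the columns of the hypothesis for the rows of the induction.
\<close>

lemma gaussian_column_matrix_entries:
  assumes M: "prob_space M" and s: "s > 0" and n: "n > 0" and m: "m > 0"
    and X: "gaussian_column_matrix M n m s X"
  shows "(\<lambda>\<omega>. \<lambda>q\<in>{..<n} \<times> {..<m}. X \<omega> $$ q) \<in> measurable M (gaussian_array s n m)"
    and "distr M (gaussian_array s n m) (\<lambda>\<omega>. \<lambda>q\<in>{..<n} \<times> {..<m}. X \<omega> $$ q) = gaussian_array s n m"
proof -
  interpret prob_space M by fact
  interpret G: prob_space "complex_gaussian s" by (rule prob_space_complex_gaussian[OF s])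
  interpret P: product_sigma_finite "\<lambda>_. complex_gaussian s"
    by (simp add: product_sigma_finite_def G.sigma_finite_measure_axioms)
  let ?V = "\<lambda>j \<omega>. vec_coords n (Matrix.col (X \<omega>) j)"
  have carr: "X \<omega> \<in> carrier_mat n m" if "\<omega> \<in> space M" for \<omega>
    using X that by (simp add: gaussian_column_matrix_def)
  have indep: "indep_vars (\<lambda>_. \<Pi>\<^sub>M i\<in>{..<n}. (borel :: complex measure)) ?V {..<m}"
    and col: "\<And>j. j < m \<Longrightarrow> circ_sym_complex_gaussian M n (\<lambda>\<omega>. Matrix.col (X \<omega>) j) (complex_of_real s \<cdot>\<^sub>m 1\<^sub>m n)"
    using X by (auto simp: gaussian_column_matrix_def)
  have V: "?V j \<in> measurable M (lebesgue_PiM {..<n})" if "j < m" for j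
    using col[OF that] by (simp add: circ_sym_complex_gaussian_def distributed_def)
  have entry: "(\<lambda>\<omega>. X \<omega> $$ q) \<in> measurable M (complex_gaussian s)" if q: "q \<in> {..<n} \<times> {..<m}" for q
  proof -
    have "(\<lambda>\<omega>. vec_index (Matrix.col (X \<omega>) (snd q)) (fst q)) \<in> borel_measurable M"
      using measurable_coords_if_distributed[OF col] q by auto
    then have "(\<lambda>\<omega>. X \<omega> $$ q) \<in> borel_measurable M"
      by (rule measurable_cong[THEN iffD1, rotated]) (use carrier_matD[OF carr] q in auto)
    then show ?thesis by (simp add: measurable_cong_sets[OF refl sets_complex_gaussian])
  qed
  show meas: "(\<lambda>\<omega>. \<lambda>q\<in>{..<n} \<times> {..<m}. X \<omega> $$ q) \<in> measurable M (gaussian_array s n m)"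
    by (rule measurable_restrict) (rule entry)
  show "distr M (gaussian_array s n m) (\<lambda>\<omega>. \<lambda>q\<in>{..<n} \<times> {..<m}. X \<omega> $$ q) = gaussian_array s n m"
  proof (rule P.PiM_eqI)
    fix A :: "nat \<times> nat \<Rightarrow> complex set"
    assume A: "\<And>q. q \<in> {..<n} \<times> {..<m} \<Longrightarrow> A q \<in> sets (complex_gaussian s)"
    define B where "B j = (\<Pi>\<^sub>E i\<in>{..<n}. A (i, j))" for j
    have B: "B j \<in> sets (lebesgue_PiM {..<n})" if "j < m" for j
      unfolding B_def using A that by (intro sets_PiM_I_finite) auto
    have "emeasure (distr M (gaussian_array s n m) (\<lambda>\<omega>. \<lambda>q\<in>{..<n} \<times> {..<m}. X \<omega> $$ q)) (Pi\<^sub>E ({..<n} \<times> {..<m}) A)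
      = emeasure M ((\<lambda>\<omega>. \<lambda>q\<in>{..<n} \<times> {..<m}. X \<omega> $$ q) -` Pi\<^sub>E ({..<n} \<times> {..<m}) A \<inter> space M)"
      by (rule emeasure_distr[OF meas]) (auto intro!: sets_PiM_I_finite A)
    also have "(\<lambda>\<omega>. \<lambda>q\<in>{..<n} \<times> {..<m}. X \<omega> $$ q) -` Pi\<^sub>E ({..<n} \<times> {..<m}) A \<inter> space M
       = (\<Inter>j\<in>{..<m}. ?V j -` B j \<inter> space M)"
    proof (rule Set.set_eqI)
      fix \<omega>
      have 1: "?V j \<omega> \<in> B j \<longleftrightarrow> (\<forall>i<n. X \<omega> $$ (i, j) \<in> A (i, j))" if "\<omega> \<in> space M" "j < m" for j
        using that carrier_matD[OF carr[OF that(1)]] by (auto simp: B_def vec_coords_def PiE_iff)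
      have 2: "(\<lambda>q\<in>{..<n} \<times> {..<m}. X \<omega> $$ q) \<in> Pi\<^sub>E ({..<n} \<times> {..<m}) A
          \<longleftrightarrow> (\<forall>j<m. \<forall>i<n. X \<omega> $$ (i, j) \<in> A (i, j))"
        by (auto simp: PiE_iff)
      have "\<omega> \<in> (\<Inter>j\<in>{..<m}. ?V j -` B j \<inter> space M) \<longleftrightarrow> \<omega> \<in> space M \<and> (\<forall>j<m. ?V j \<omega> \<in> B j)"
        using m by auto
      then show "\<omega> \<in> (\<lambda>\<omega>. \<lambda>q\<in>{..<n} \<times> {..<m}. X \<omega> $$ q) -` Pi\<^sub>E ({..<n} \<times> {..<m}) A \<inter> space M
          \<longleftrightarrow> \<omega> \<in> (\<Inter>j\<in>{..<m}. ?V j -` B j \<inter> space M)"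
        using 1 2 by (simp only: vimage_eq Int_iff) metis
    qed
    also have "emeasure M \<dots> = ennreal (\<Prod>j<m. prob (?V j -` B j \<inter> space M))"
      unfolding emeasure_eq_measure
      by (subst indep_varsD_finite[OF indep]) (use m B in \<open>auto cong: sets_PiM_cong\<close>)
    also have "\<dots> = (\<Prod>j<m. emeasure M (?V j -` B j \<inter> space M))"
      by (simp add: prod_ennreal emeasure_eq_measure)
    also have "\<dots> = (\<Prod>j<m. \<Prod>i<n. emeasure (complex_gaussian s) (A (i, j)))"
    proof (rule prod.cong[OF refl])
      fix j assume "j \<in> {..<m}"
      then have j: "j < m" by simp
      have "emeasure M (?V j -` B j \<inter> space M) = emeasure (distr M (lebesgue_PiM {..<n}) (?V j)) (B j)"
        using V[OF j] B[OF j] by (simp add: emeasure_distr)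
      also have "\<dots> = emeasure (gaussian_row s n) (B j)"
        by (simp add: circ_sym_complex_gaussian_iid[OF s col[OF j]])
      also have "\<dots> = (\<Prod>i<n. emeasure (complex_gaussian s) (A (i, j)))"
        unfolding B_def using A j by (intro P.emeasure_PiM) auto
      finally show "emeasure M (?V j -` B j \<inter> space M) = (\<Prod>i<n. emeasure (complex_gaussian s) (A (i, j)))" .
    qed
    also have "\<dots> = (\<Prod>i<n. \<Prod>j<m. emeasure (complex_gaussian s) (A (i, j)))"
      by (rule prod.swap)
    also have "\<dots> = (\<Prod>q\<in>{..<n} \<times> {..<m}. emeasure (complex_gaussian s) (A q))"
      by (simp add: prod.cartesian_product)
    finally show "emeasure (distr M (gaussian_array s n m) (\<lambda>\<omega>. \<lambda>q\<in>{..<n} \<times> {..<m}. X \<omega> $$ q)) (Pi\<^sub>E ({..<n} \<times> {..<m}) A) = \<dots>" .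
  qed auto
qed

definition mean_ratio :: "nat \<Rightarrow> real \<Rightarrow> real \<Rightarrow> real" where
  "mean_ratio n t d = (t / real n) / (d powr (1 / real n))"

lemma W0_eq_mean_ratio:
  assumes "A \<in> carrier_mat n m"
  shows "W0 A = mean_ratio n (total_energy n m (\<lambda>q. A $$ q)) (gram_det m n (\<lambda>i j. A $$ (i, j)))"
proof -
  let ?G = "A * mat_adjoint A"
  have entry: "?G $$ (i, i') = cinner_on {..<m} (\<lambda>j. A $$ (i, j)) (\<lambda>j. A $$ (i', j))" if "i < n" "i' < n" for i i'
    using that assms by (subst times_adjoint_index) (auto simp: cinner_on_def)
  have G: "?G = Matrix.mat n n (\<lambda>(i, i'). cinner_on {..<m} (\<lambda>j. A $$ (i, j)) (\<lambda>j. A $$ (i', j)))"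
    by (rule eq_matI) (use assms entry in auto)
  have "Re (mat_trace ?G) = total_energy n m (\<lambda>q. A $$ q)"
  proof -
    have "Re (mat_trace ?G) = (\<Sum>i<n. Re (?G $$ (i, i)))"
      using assms by (simp add: mat_trace_def del: index_mult_mat(1))
    also have "\<dots> = total_energy n m (\<lambda>q. A $$ q)"
      unfolding total_energy_def by (intro sum.cong) (auto simp: entry cinner_on_self simp del: index_mult_mat(1))
    finally show ?thesis .
  qed
  moreover have "Re (Determinant.det ?G) = gram_det m n (\<lambda>i j. A $$ (i, j))"
    unfolding gram_det_def G ..
  ultimately show ?thesis using assms by (simp add: W0_def Let_def mean_ratio_def)
qed

lemma W0_eq_entries:
  assumes "A \<in> carrier_mat n m"
  defines "x \<equiv> \<lambda>q\<in>{..<n} \<times> {..<m}. A $$ q"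
  shows "W0 A = mean_ratio n (total_energy n m x) (gram_det m n (\<lambda>i j. x (i, j)))"
proof -
  have "total_energy n m x = total_energy n m (\<lambda>q. A $$ q)"
    by (simp add: total_energy_def x_def)
  moreover have "gram_det m n (\<lambda>i j. x (i, j)) = gram_det m n (\<lambda>i j. A $$ (i, j))"
    by (intro gram_det_cong) (simp add: cinner_on_def x_def)
  ultimately show ?thesis by (simp add: W0_eq_mean_ratio[OF assms(1)])
qed

lemma measurable_mean_ratio:
  "(\<lambda>x. mean_ratio n (total_energy n m x) (gram_det m n (\<lambda>i j. x (i, j)))) \<in> borel_measurable (gaussian_array s n m)"
  unfolding mean_ratio_def by measurable

lemma W0_measurable:
  assumes M: "prob_space M" and s: "s > 0" and n: "n > 0" and m: "m > 0"
    and X: "gaussian_column_matrix M n m s X"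
  shows "(\<lambda>\<omega>. W0 (X \<omega>)) \<in> borel_measurable M"
proof -
  let ?E = "\<lambda>\<omega>. \<lambda>q\<in>{..<n} \<times> {..<m}. X \<omega> $$ q"
  have "(\<lambda>\<omega>. (\<lambda>x. mean_ratio n (total_energy n m x) (gram_det m n (\<lambda>i j. x (i, j)))) (?E \<omega>)) \<in> borel_measurable M"
    by (rule measurable_compose[OF gaussian_column_matrix_entries(1)[OF M s n m X] measurable_mean_ratio])
  moreover have "W0 (X \<omega>) = mean_ratio n (total_energy n m (?E \<omega>)) (gram_det m n (\<lambda>i j. ?E \<omega> (i, j)))"
    if "\<omega> \<in> space M" for \<omega>
    using X that by (intro W0_eq_entries) (simp add: gaussian_column_matrix_def)
  ultimately show ?thesis by (simp cong: measurable_cong)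
qed

text \<open>
  Through the joint law of its entries the matrix is replaced by a Gaussian array; then \<open>gram_det_bartlett\<close>,
  applied to indicator functions, replaces the determinant by the product of the tail energies.
\<close>

lemma W0_law:
  assumes M: "prob_space M" and s: "s > 0" and n: "n > 0" and nm: "n \<le> m"
    and X: "gaussian_column_matrix M n m s X"
  shows "distr M borel (\<lambda>\<omega>. a * (W0 (X \<omega>) - b))
       = distr (gaussian_array s n m) borel (\<lambda>x. a * (mean_ratio n (total_energy n m x) (tail_energy_prod n m x) - b))"
proof -
  have m: "m > 0" using n nm by simp
  let ?N = "gaussian_array s n m"
  let ?E = "\<lambda>\<omega>. \<lambda>q\<in>{..<n} \<times> {..<m}. X \<omega> $$ q"
  let ?F = "\<lambda>x. a * (mean_ratio n (total_energy n m x) (gram_det m n (\<lambda>i j. x (i, j))) - b)"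
  let ?H = "\<lambda>x. a * (mean_ratio n (total_energy n m x) (tail_energy_prod n m x) - b)"
  note E = gaussian_column_matrix_entries[OF M s n m X]
  note [measurable] = E(1) measurable_mean_ratio measurable_tail_energy_prod[OF nm]
  have mH[measurable]: "?H \<in> borel_measurable ?N" unfolding mean_ratio_def by measurable
  have mF[measurable]: "?F \<in> borel_measurable ?N" by measurable
  have W: "a * (W0 (X \<omega>) - b) = ?F (?E \<omega>)" if "\<omega> \<in> space M" for \<omega>
    using X that by (subst W0_eq_entries[of _ n m]) (auto simp: gaussian_column_matrix_def)
  have "distr M borel (\<lambda>\<omega>. a * (W0 (X \<omega>) - b)) = distr M borel (\<lambda>\<omega>. ?F (?E \<omega>))"
    by (rule distr_cong) (auto simp: W)
  also have "\<dots> = distr (distr M ?N ?E) borel ?F"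
    by (subst distr_distr) (auto simp: comp_def)
  also have "\<dots> = distr ?N borel ?F" unfolding E(2) ..
  also have "\<dots> = distr ?N borel ?H"
  proof (rule measure_eqI)
    fix A assume "A \<in> sets (distr ?N borel ?F)"
    then have A[measurable]: "A \<in> sets borel" by simp
    have "(\<lambda>p. indicator A (a * (mean_ratio n (fst p) (snd p) - b)) :: ennreal) \<in> borel_measurable (borel \<Otimes>\<^sub>M borel)"
      unfolding mean_ratio_def by measurable
    then have f: "(\<lambda>p. indicator A (a * (mean_ratio n (fst p) (snd p) - b)) :: ennreal) \<in> borel_measurable borel"
      unfolding borel_prod .
    have "emeasure (distr ?N borel ?F) A = (\<integral>\<^sup>+x. indicator A (?F x) \<partial>?N)"
      by (simp add: nn_integral_indicator[symmetric] nn_integral_distr del: nn_integral_indicator)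
    also have "\<dots> = (\<integral>\<^sup>+x. indicator A (?H x) \<partial>?N)"
      using gram_det_bartlett[OF s nm f] by simp
    also have "\<dots> = emeasure (distr ?N borel ?H) A"
      by (simp add: nn_integral_indicator[symmetric] nn_integral_distr del: nn_integral_indicator)
    finally show "emeasure (distr ?N borel ?F) A = emeasure (distr ?N borel ?H) A" .
  qed simp
  finally show ?thesis .
qed

definition energy :: "real \<Rightarrow> nat \<times> nat \<Rightarrow> (nat \<times> nat \<Rightarrow> complex) \<Rightarrow> real" where
  "energy s q x = (cmod (x q))\<^sup>2 / s"

lemma gaussian_array_energies:
  assumes s: "s > 0" and n: "n > 0" and m: "m > 0"
  shows "prob_space (gaussian_array s n m)"
    and "prob_space.indep_vars (gaussian_array s n m) (\<lambda>_. borel) (energy s) ({..<n} \<times> {..<m})"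
    and "q \<in> {..<n} \<times> {..<m} \<Longrightarrow> distributed (gaussian_array s n m) lborel (energy s q) (exponential_density 1)"
proof -
  let ?I = "{..<n} \<times> {..<m}"
  interpret G: prob_space "complex_gaussian s" by (rule prob_space_complex_gaussian[OF s])
  interpret N: prob_space "gaussian_array s n m" by (intro prob_space_PiM G.prob_space_axioms)
  interpret product_prob_space "\<lambda>_. complex_gaussian s" ?I by unfold_locales
  show "prob_space (gaussian_array s n m)" by (rule N.prob_space_axioms)
  have comp: "distr (gaussian_array s n m) (complex_gaussian s) (\<lambda>x. x q) = complex_gaussian s" if "q \<in> ?I" for q
    using PiM_component[OF that] .
  have "N.indep_vars (\<lambda>_. complex_gaussian s) (\<lambda>q x. x q) ?I"
  proof (subst N.indep_vars_iff_distr_eq_PiM')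
    have "distr (gaussian_array s n m) (gaussian_array s n m) (\<lambda>x. \<lambda>q\<in>?I. x q)
        = distr (gaussian_array s n m) (gaussian_array s n m) (\<lambda>x. x)"
      by (rule distr_cong) (auto simp: space_PiM PiE_def extensional_restrict)
    also have "\<dots> = gaussian_array s n m" by (simp add: distr_id)
    also have "\<dots> = PiM ?I (\<lambda>q. distr (gaussian_array s n m) (complex_gaussian s) (\<lambda>x. x q))"
      by (intro PiM_cong) (auto simp: comp)
    finally show "distr (gaussian_array s n m) (gaussian_array s n m) (\<lambda>x. \<lambda>q\<in>?I. x q)
       = PiM ?I (\<lambda>q. distr (gaussian_array s n m) (complex_gaussian s) (\<lambda>x. x q))" .
  qed (use n m in auto)
  from N.indep_vars_compose2[OF this, of "\<lambda>_ z. (cmod z)\<^sup>2 / s" "\<lambda>_. borel"]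
  show "N.indep_vars (\<lambda>_. borel) (energy s) ?I"
    by (simp add: energy_def[abs_def])
  assume q: "q \<in> ?I"
  have rv: "(\<lambda>x. x q) \<in> measurable (gaussian_array s n m) (complex_gaussian s)"
    using q by (rule measurable_component_singleton)
  have "distr (gaussian_array s n m) lborel (energy s q)
      = distr (distr (gaussian_array s n m) (complex_gaussian s) (\<lambda>x. x q)) lborel (\<lambda>z. (cmod z)\<^sup>2 / s)"
    by (subst distr_distr[OF _ rv]) (auto simp: comp_def energy_def[abs_def])
  also have "\<dots> = density lborel (exponential_density 1)"
    unfolding comp[OF q] using complex_gaussian_radial[OF s] by (simp add: distributed_def)
  finally show "distributed (gaussian_array s n m) lborel (energy s q) (exponential_density 1)"
    using measurable_compose[OF rv, of "\<lambda>z. (cmod z)\<^sup>2 / s" lborel]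
    by (auto simp: distributed_def energy_def[abs_def])
qed

text \<open>
  The variance \<open>s\<close> occurs to the power \<open>n\<close> in the determinant and to the power one in the trace,
  hence it cancels.
\<close>

lemma mean_ratio_energy:
  assumes s: "s > 0" and n: "n > 0"
  shows "mean_ratio n (total_energy n m x) (tail_energy_prod n m x)
       = mean_ratio n (\<Sum>i<n. \<Sum>j<m. energy s (i, j) x) (\<Prod>i<n. \<Sum>j\<in>{i..<m}. energy s (i, j) x)"
proof -
  let ?D = "\<Prod>i<n. \<Sum>j\<in>{i..<m}. energy s (i, j) x"
  have sq: "(cmod (x q))\<^sup>2 = s * energy s q x" for q using s by (simp add: energy_def)
  have T: "total_energy n m x = s * (\<Sum>i<n. \<Sum>j<m. energy s (i, j) x)"
    unfolding total_energy_def sq by (simp add: sum_distrib_left)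
  have "tail_energy_prod n m x = s ^ n * ?D"
    unfolding tail_energy_prod_def sq by (simp add: sum_distrib_left[symmetric] prod.distrib)
  moreover have "?D \<ge> 0" using s by (intro prod_nonneg sum_nonneg) (auto simp: energy_def)
  moreover have "(s ^ n) powr (1 / n) = s"
    using s n by (simp add: powr_realpow[symmetric] powr_powr)
  ultimately have "tail_energy_prod n m x powr (1 / n) = s * ?D powr (1 / n)"
    using s by (simp add: powr_mult)
  then show ?thesis using s by (simp add: mean_ratio_def T)
qed

section \<open>Exponential variables: moments and characteristic functions\<close>

text \<open>
  The moments of a Gamma variable of shape \<open>k\<close> are rising factorials. The central ones of order two and four are
  \<open>k\<close> and \<open>3 k\<^sup>2 + 6 k\<close>, and the latter is at most \<open>9 k\<^sup>2\<close>.
\<close>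

lemma (in prob_space) erlang_relative_deviation:
  fixes k :: nat
  assumes Y: "distributed M lborel Y (erlang_density (k - 1) 1)" and k: "k > 0"
  defines "D \<equiv> \<lambda>\<omega>. Y \<omega> / k - 1"
  shows "integrable M D" "integrable M (\<lambda>\<omega>. (D \<omega>)\<^sup>2)" "integrable M (\<lambda>\<omega>. (D \<omega>) ^ 4)"
    and "expectation D = 0" "expectation (\<lambda>\<omega>. (D \<omega>)\<^sup>2) = 1 / k" "expectation (\<lambda>\<omega>. (D \<omega>) ^ 4) \<le> 9 / k\<^sup>2"
proof -
  obtain l where l: "k = Suc l" using k by (cases k) auto
  have one: "(0::real) < 1" by simp
  note int [simp] = erlang_ith_moment_integrable[OF one Y]
  have mom: "expectation (\<lambda>\<omega>. Y \<omega> ^ i) = fact (l + i) / fact l" for i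
    using erlang_ith_moment[OF one Y, of i] l by simp
  have fl: "(fact l :: real) \<noteq> 0" by simp
  have m1: "expectation Y = k" using mom[of 1] fl by (simp add: l)
  have m2: "expectation (\<lambda>\<omega>. Y \<omega> ^ 2) = real k * (k + 1)"
  proof -
    have f: "fact (l + 2) = (real l + 1) * (real l + 2) * fact l"
      by (simp add: eval_nat_numeral algebra_simps)
    show ?thesis
      using mom[of 2] unfolding f nonzero_mult_div_cancel_right[OF fl] by (simp add: l algebra_simps)
  qed
  have m3: "expectation (\<lambda>\<omega>. Y \<omega> ^ 3) = real k * (k + 1) * (k + 2)"
  proof -
    have f: "fact (l + 3) = (real l + 1) * (real l + 2) * (real l + 3) * fact l"
      by (simp add: eval_nat_numeral algebra_simps)
    show ?thesis
      using mom[of 3] unfolding f nonzero_mult_div_cancel_right[OF fl] by (simp add: l algebra_simps)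
  qed
  have m4: "expectation (\<lambda>\<omega>. Y \<omega> ^ 4) = real k * (k + 1) * (k + 2) * (k + 3)"
  proof -
    have f: "fact (l + 4) = (real l + 1) * (real l + 2) * (real l + 3) * (real l + 4) * fact l"
      by (simp add: eval_nat_numeral algebra_simps)
    show ?thesis
      using mom[of 4] unfolding f nonzero_mult_div_cancel_right[OF fl] by (simp add: l algebra_simps)
  qed
  have Y1 [simp]: "integrable M Y" using int[of 1] by simp
  have kk: "real k > 0" using k by simp
  show "integrable M D" unfolding D_def by auto
  have d2: "(D \<omega>)\<^sup>2 = (Y \<omega> ^ 2 - 2 * real k * Y \<omega> + real k ^ 2) / real k ^ 2" for \<omega>
    using kk by (simp add: D_def power2_eq_square field_simps)
  have d4: "(D \<omega>) ^ 4 = (Y \<omega> ^ 4 - 4 * real k * Y \<omega> ^ 3 + 6 * real k ^ 2 * Y \<omega> ^ 2 - 4 * real k ^ 3 * Y \<omega> + real k ^ 4) / real k ^ 4" for \<omega>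
  proof -
    have "D \<omega> = (Y \<omega> - real k) / real k" using kk by (simp add: D_def field_simps)
    then have "(D \<omega>) ^ 4 = (Y \<omega> - real k) ^ 4 / real k ^ 4" by (simp add: power_divide)
    also have "(Y \<omega> - real k) ^ 4 = Y \<omega> ^ 4 - 4 * real k * Y \<omega> ^ 3 + 6 * real k ^ 2 * Y \<omega> ^ 2 - 4 * real k ^ 3 * Y \<omega> + real k ^ 4"
      by (simp add: algebra_simps power2_eq_square power3_eq_cube power4_eq_xxxx)
    finally show ?thesis .
  qed
  show "integrable M (\<lambda>\<omega>. (D \<omega>)\<^sup>2)" unfolding d2 by auto
  show "integrable M (\<lambda>\<omega>. (D \<omega>) ^ 4)" unfolding d4 by auto
  show "expectation D = 0" unfolding D_def using kk by (simp add: m1 prob_space)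
  show "expectation (\<lambda>\<omega>. (D \<omega>)\<^sup>2) = 1 / k"
  proof -
    have "expectation (\<lambda>\<omega>. (D \<omega>)\<^sup>2) = (real k * (k + 1) - 2 * real k * k + real k ^ 2) / real k ^ 2"
      unfolding d2 by (simp add: m1 m2 prob_space)
    also have "\<dots> = 1 / k" using kk by (simp add: power2_eq_square field_simps)
    finally show ?thesis .
  qed
  have "expectation (\<lambda>\<omega>. (D \<omega>) ^ 4) = (real k * (k + 1) * (k + 2) * (k + 3)
     - 4 * real k * (real k * (k + 1) * (k + 2)) + 6 * real k ^ 2 * (real k * (k + 1)) - 4 * real k ^ 3 * k + real k ^ 4) / real k ^ 4"
    unfolding d4 by (simp add: m1 m2 m3 m4 prob_space)
  also have "\<dots> = (3 * real k ^ 2 + 6 * k) / real k ^ 4"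
    by (rule arg_cong2[where f="(/)"]) (simp_all add: algebra_simps power2_eq_square power3_eq_cube power4_eq_xxxx)
  also have "\<dots> \<le> (9 * real k ^ 2) / real k ^ 4"
  proof (rule divide_right_mono)
    have "real k * 1 \<le> real k * real k" using k by (intro mult_left_mono) auto
    then show "3 * real k ^ 2 + 6 * k \<le> 9 * real k ^ 2" by (simp add: power2_eq_square)
  qed simp
  also have "\<dots> = 9 / k\<^sup>2" using kk by (simp add: power2_eq_square power4_eq_xxxx field_simps)
  finally show "expectation (\<lambda>\<omega>. (D \<omega>) ^ 4) \<le> 9 / k\<^sup>2" .
qed

lemma (in prob_space) indep_sum_second_moment:
  fixes X :: "'i \<Rightarrow> 'a \<Rightarrow> real"
  assumes I: "finite I" and ind: "indep_vars (\<lambda>_. borel) X I"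
    and X0: "\<And>i. i \<in> I \<Longrightarrow> expectation (X i) = 0"
    and X2: "\<And>i. i \<in> I \<Longrightarrow> integrable M (\<lambda>\<omega>. (X i \<omega>)\<^sup>2)"
  shows "integrable M (\<lambda>\<omega>. (\<Sum>i\<in>I. X i \<omega>)\<^sup>2)"
    and "expectation (\<lambda>\<omega>. (\<Sum>i\<in>I. X i \<omega>)\<^sup>2) = (\<Sum>i\<in>I. expectation (\<lambda>\<omega>. (X i \<omega>)\<^sup>2))"
proof -
  have rv: "random_variable borel (X i)" if "i \<in> I" for i using ind that by (auto simp: indep_vars_def)
  have X1: "integrable M (X i)" if "i \<in> I" for i
    using square_integrable_imp_integrable[OF rv[OF that] X2[OF that]] .
  have sq: "(\<Sum>i\<in>I. X i \<omega>)\<^sup>2 = (\<Sum>i\<in>I. \<Sum>j\<in>I. X i \<omega> * X j \<omega>)" for \<omega>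
    by (simp add: power2_eq_square sum_product)
  have pair: "integrable M (\<lambda>\<omega>. X i \<omega> * X j \<omega>) \<and>
      expectation (\<lambda>\<omega>. X i \<omega> * X j \<omega>) = (if i = j then expectation (\<lambda>\<omega>. (X i \<omega>)\<^sup>2) else 0)"
    if ij: "i \<in> I" "j \<in> I" for i j
  proof (cases "i = j")
    case True
    then show ?thesis using X2[OF ij(1)] by (simp add: power2_eq_square)
  next
    case False
    have "indep_vars (\<lambda>_. borel) X {i, j}" using indep_vars_subset[OF ind] ij by auto
    then have "integrable M (\<lambda>\<omega>. \<Prod>l\<in>{i, j}. X l \<omega>)"
      and "expectation (\<lambda>\<omega>. \<Prod>l\<in>{i, j}. X l \<omega>) = (\<Prod>l\<in>{i, j}. expectation (X l))"
      using X1 ij by (auto intro!: indep_vars_integrable indep_vars_lebesgue_integral)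
    then show ?thesis using False X0 ij by simp
  qed
  show "integrable M (\<lambda>\<omega>. (\<Sum>i\<in>I. X i \<omega>)\<^sup>2)"
    unfolding sq using pair by (intro Bochner_Integration.integrable_sum) auto
  have "expectation (\<lambda>\<omega>. (\<Sum>i\<in>I. X i \<omega>)\<^sup>2) = (\<Sum>i\<in>I. \<Sum>j\<in>I. expectation (\<lambda>\<omega>. X i \<omega> * X j \<omega>))"
    unfolding sq using pair by (simp add: Bochner_Integration.integral_sum)
  also have "\<dots> = (\<Sum>i\<in>I. \<Sum>j\<in>I. if i = j then expectation (\<lambda>\<omega>. (X i \<omega>)\<^sup>2) else 0)"
    using pair by (intro sum.cong) auto
  also have "\<dots> = (\<Sum>i\<in>I. expectation (\<lambda>\<omega>. (X i \<omega>)\<^sup>2))" using I by simp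
  finally show "expectation (\<lambda>\<omega>. (\<Sum>i\<in>I. X i \<omega>)\<^sup>2) = \<dots>" .
qed

lemma exp_neg_quadratic_bound:
  fixes x :: real
  assumes "x \<ge> 0"
  shows "\<bar>exp (- x) - (1 - x)\<bar> \<le> x\<^sup>2"
proof (cases "x \<le> 1")
  case True
  have "1 - x \<le> exp (- x)" using exp_ge_add_one_self[of "- x"] by simp
  moreover have "exp (- x) \<le> 1 - x + x\<^sup>2"
  proof -
    have "1 + x \<le> exp x" by (rule exp_ge_add_one_self)
    then have "exp (- x) \<le> 1 / (1 + x)" using assms by (simp add: exp_minus field_simps)
    also have "\<dots> \<le> 1 - x + x\<^sup>2"
    proof -
      have "1 \<le> (1 - x + x\<^sup>2) * (1 + x)" using assms by (simp add: algebra_simps power2_eq_square)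
      then show ?thesis using assms by (simp add: divide_le_eq)
    qed
    finally show ?thesis .
  qed
  ultimately show ?thesis by simp
next
  case False
  then have "x \<le> x\<^sup>2" using assms by (simp add: power2_eq_square)
  moreover have "exp (- x) \<le> 1" "exp (- x) > 0" using assms by auto
  ultimately show ?thesis using False zero_le_power2[of x] unfolding abs_le_iff by (intro conjI) linarith+
qed

text \<open>
  For \<open>\<bar>u\<bar> \<le> 1\<close> both functions agree with \<open>1 - u\<^sup>2 / 2\<close> up to a cubic
  error; for larger \<open>u\<close> the right-hand side exceeds the trivial bound \<open>2\<close>.
\<close>

lemma (in prob_space) char_centred_exponential:
  assumes E: "distributed M lborel E (exponential_density 1)"
  shows "cmod (char (distr M borel (\<lambda>\<omega>. E \<omega> - 1)) u - complex_of_real (exp (- (u\<^sup>2 / 2)))) \<le> 2 * \<bar>u\<bar> ^ 3"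
proof -
  let ?D = "\<lambda>\<omega>. E \<omega> - 1" and ?\<phi> = "char (distr M borel (\<lambda>\<omega>. E \<omega> - 1)) u"
  have E': "distributed M lborel E (erlang_density (1 - 1) 1)" using E by simp
  note mom = erlang_relative_deviation[OF E', simplified]
  have rv[measurable]: "random_variable borel ?D"
    using distributed_measurable[OF E] by simp
  interpret D: real_distribution "distr M borel ?D" by (rule real_distribution_distr) fact
  show ?thesis
  proof (cases "\<bar>u\<bar> \<le> 1")
    case False
    then have "1 \<le> \<bar>u\<bar> ^ 3" by (simp add: one_le_power)
    moreover have "cmod (?\<phi> - complex_of_real (exp (- (u\<^sup>2 / 2)))) \<le> cmod ?\<phi> + cmod (complex_of_real (exp (- (u\<^sup>2 / 2))))"
      by (rule norm_triangle_ineq4)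
    moreover have "cmod ?\<phi> \<le> 1" by (rule D.cmod_char_le_1)
    moreover have "cmod (complex_of_real (exp (- (u\<^sup>2 / 2)))) \<le> 1" unfolding norm_of_real by simp
    ultimately show ?thesis by linarith
  next
    case True
    have cube: "\<bar>x\<bar> ^ 3 \<le> (x\<^sup>2 + x ^ 4) / 2" for x :: real
    proof -
      have "0 \<le> (\<bar>x\<bar> * (\<bar>x\<bar> - 1))\<^sup>2" by simp
      also have "\<dots> = \<bar>x\<bar> ^ 4 - 2 * \<bar>x\<bar> ^ 3 + \<bar>x\<bar>\<^sup>2" by (simp add: algebra_simps power2_eq_square power3_eq_cube power4_eq_xxxx)
      finally show ?thesis by simp
    qed
    have var: "variance ?D = 1" using mom by (simp add: power2_eq_square)
    have "cmod (?\<phi> - (1 - u\<^sup>2 * 1 / 2)) \<le> (u\<^sup>2 / 6) * expectation (\<lambda>\<omega>. min (6 * (?D \<omega>)\<^sup>2) (\<bar>u\<bar> * \<bar>?D \<omega>\<bar> ^ 3))"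
      by (rule char_approx3'[OF rv _ _ _ var refl]) (use mom in auto)
    also have "\<dots> \<le> (u\<^sup>2 / 6) * expectation (\<lambda>\<omega>. \<bar>u\<bar> * (((?D \<omega>)\<^sup>2 + (?D \<omega>) ^ 4) / 2))"
    proof (intro mult_left_mono integral_mono)
      show "integrable M (\<lambda>\<omega>. min (6 * (?D \<omega>)\<^sup>2) (\<bar>u\<bar> * \<bar>?D \<omega>\<bar> ^ 3))"
        by (rule Bochner_Integration.integrable_bound[where f="\<lambda>\<omega>. 6 * (?D \<omega>)\<^sup>2"]) (use mom in auto)
      show "integrable M (\<lambda>\<omega>. \<bar>u\<bar> * (((?D \<omega>)\<^sup>2 + (?D \<omega>) ^ 4) / 2))" using mom by auto
      fix \<omega>
      have "\<bar>u\<bar> * \<bar>?D \<omega>\<bar> ^ 3 \<le> \<bar>u\<bar> * (((?D \<omega>)\<^sup>2 + (?D \<omega>) ^ 4) / 2)"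
        by (intro mult_left_mono cube) simp
      then show "min (6 * (?D \<omega>)\<^sup>2) (\<bar>u\<bar> * \<bar>?D \<omega>\<bar> ^ 3) \<le> \<bar>u\<bar> * (((?D \<omega>)\<^sup>2 + (?D \<omega>) ^ 4) / 2)" by simp
    qed simp
    also have "\<dots> \<le> (u\<^sup>2 / 6) * (\<bar>u\<bar> * ((1 + 9) / 2))"
      proof (rule mult_left_mono)
      have "expectation (\<lambda>\<omega>. \<bar>u\<bar> * (((?D \<omega>)\<^sup>2 + (?D \<omega>) ^ 4) / 2))
          = \<bar>u\<bar> * ((1 + expectation (\<lambda>\<omega>. (?D \<omega>) ^ 4)) / 2)"
        using mom by simp
      also have "\<dots> \<le> \<bar>u\<bar> * ((1 + 9) / 2)" using mom by (intro mult_left_mono) auto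
      finally show "expectation (\<lambda>\<omega>. \<bar>u\<bar> * (((?D \<omega>)\<^sup>2 + (?D \<omega>) ^ 4) / 2)) \<le> \<bar>u\<bar> * ((1 + 9) / 2)" .
    qed simp
    also have "\<dots> = 5 / 6 * \<bar>u\<bar> ^ 3" 
    proof -
      have "\<bar>u\<bar> ^ 3 = \<bar>u\<bar> * \<bar>u\<bar>\<^sup>2" by (simp only: power3_eq_cube power2_eq_square mult.assoc)
      then show ?thesis by simp
    qed
    finally have 1: "cmod (?\<phi> - complex_of_real (1 - u\<^sup>2 / 2)) \<le> 5 / 6 * \<bar>u\<bar> ^ 3" by simp
    have "cmod (complex_of_real (1 - u\<^sup>2 / 2) - complex_of_real (exp (- (u\<^sup>2 / 2)))) = \<bar>exp (- (u\<^sup>2 / 2)) - (1 - u\<^sup>2 / 2)\<bar>"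
      unfolding of_real_diff[symmetric] norm_of_real by (rule abs_minus_commute)
    also have "\<dots> \<le> (u\<^sup>2 / 2)\<^sup>2" by (rule exp_neg_quadratic_bound) simp
    also have "\<dots> = \<bar>u\<bar> ^ 4 / 4" by (simp add: power2_eq_square power4_eq_xxxx)
    also have "\<dots> \<le> \<bar>u\<bar> ^ 3 / 4" using True by (intro divide_right_mono power_decreasing) auto
    finally have 2: "cmod (complex_of_real (1 - u\<^sup>2 / 2) - complex_of_real (exp (- (u\<^sup>2 / 2)))) \<le> \<bar>u\<bar> ^ 3 / 4" .
    have "cmod (?\<phi> - complex_of_real (exp (- (u\<^sup>2 / 2)))) \<le> cmod (?\<phi> - complex_of_real (1 - u\<^sup>2 / 2)) + cmod (complex_of_real (1 - u\<^sup>2 / 2) - complex_of_real (exp (- (u\<^sup>2 / 2))))"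
      using norm_triangle_ineq[of "?\<phi> - complex_of_real (1 - u\<^sup>2 / 2)" "complex_of_real (1 - u\<^sup>2 / 2) - complex_of_real (exp (- (u\<^sup>2 / 2)))"] by simp
    also have "\<dots> \<le> 5 / 6 * \<bar>u\<bar> ^ 3 + \<bar>u\<bar> ^ 3 / 4" using 1 2 by (rule add_mono)
    also have "\<dots> \<le> 2 * \<bar>u\<bar> ^ 3" by simp
    finally show ?thesis .
  qed
qed

text \<open>
  A central limit theorem with an explicit error: the characteristic function is a product over the summands, and replacing one
  factor after another by a Gaussian one costs the sum of the individual errors. Bounding one of three factors
  \<open>\<bar>a q\<bar>\<close> by \<open>b\<close> leaves the variance.
\<close>

lemma (in prob_space) char_exponential_linear_form:
  fixes a :: "'i \<Rightarrow> real"
  assumes I: "finite I" and ind: "indep_vars (\<lambda>_. borel) E I"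
    and E: "\<And>q. q \<in> I \<Longrightarrow> distributed M lborel (E q) (exponential_density 1)"
    and b: "\<And>q. q \<in> I \<Longrightarrow> \<bar>a q\<bar> \<le> b"
  shows "cmod (char (distr M borel (\<lambda>\<omega>. \<Sum>q\<in>I. a q * (E q \<omega> - 1))) t - complex_of_real (exp (- (t\<^sup>2 * (\<Sum>q\<in>I. (a q)\<^sup>2) / 2))))
       \<le> 2 * \<bar>t\<bar> ^ 3 * b * (\<Sum>q\<in>I. (a q)\<^sup>2)"
proof -
  let ?\<phi> = "\<lambda>q. char (distr M borel (\<lambda>\<omega>. E q \<omega> - 1)) (t * a q)"
  let ?g = "\<lambda>q. complex_of_real (exp (- ((t * a q)\<^sup>2 / 2)))"
  have rv[measurable]: "random_variable borel (E q)" if "q \<in> I" for q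
    using ind that by (auto simp: indep_vars_def)
  have "indep_vars (\<lambda>_. borel) (\<lambda>q \<omega>. a q * (E q \<omega> - 1)) I"
    by (rule indep_vars_compose2[OF ind]) measurable
  then have "char (distr M borel (\<lambda>\<omega>. \<Sum>q\<in>I. a q * (E q \<omega> - 1))) t
      = (\<Prod>q\<in>I. char (distr M borel (\<lambda>\<omega>. a q * (E q \<omega> - 1))) t)"
    by (rule char_distr_sum)
  also have "\<dots> = (\<Prod>q\<in>I. ?\<phi> q)"
    using rv by (intro prod.cong) (auto simp: char_def integral_distr mult.assoc)
  finally have 1: "char (distr M borel (\<lambda>\<omega>. \<Sum>q\<in>I. a q * (E q \<omega> - 1))) t = (\<Prod>q\<in>I. ?\<phi> q)" .
  have 2: "complex_of_real (exp (- (t\<^sup>2 * (\<Sum>q\<in>I. (a q)\<^sup>2) / 2))) = (\<Prod>q\<in>I. ?g q)"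
  proof -
    have "t\<^sup>2 * (\<Sum>q\<in>I. (a q)\<^sup>2) / 2 = (\<Sum>q\<in>I. (t * a q)\<^sup>2 / 2)"
      by (simp add: power_mult_distrib sum_distrib_left sum_divide_distrib)
    then have "exp (- (t\<^sup>2 * (\<Sum>q\<in>I. (a q)\<^sup>2) / 2)) = (\<Prod>q\<in>I. exp (- ((t * a q)\<^sup>2 / 2)))"
      using I by (simp add: exp_sum flip: sum_negf)
    then show ?thesis by simp
  qed
  have "cmod ((\<Prod>q\<in>I. ?\<phi> q) - (\<Prod>q\<in>I. ?g q)) \<le> (\<Sum>q\<in>I. cmod (?\<phi> q - ?g q))"
  proof (rule norm_prod_diff)
    fix q assume q: "q \<in> I"
    have "real_distribution (distr M borel (\<lambda>\<omega>. E q \<omega> - 1))" using rv[OF q] by (intro real_distribution_distr) simp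
    then show "cmod (?\<phi> q) \<le> 1" by (rule real_distribution.cmod_char_le_1)
    show "cmod (?g q) \<le> 1" unfolding norm_of_real by simp
  qed
  also have "\<dots> \<le> (\<Sum>q\<in>I. 2 * \<bar>t\<bar> ^ 3 * b * (a q)\<^sup>2)"
  proof (rule sum_mono)
    fix q assume q: "q \<in> I"
    have "cmod (?\<phi> q - ?g q) \<le> 2 * \<bar>t * a q\<bar> ^ 3"
      using char_centred_exponential[OF E[OF q], of "t * a q"] by simp
    also have "\<dots> = 2 * \<bar>t\<bar> ^ 3 * (\<bar>a q\<bar> * (a q)\<^sup>2)"
    proof -
      have "\<bar>a q\<bar> ^ 3 = \<bar>a q\<bar> * \<bar>a q\<bar>\<^sup>2" by (simp only: power3_eq_cube power2_eq_square mult.assoc)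
      then show ?thesis by (simp add: abs_mult power_mult_distrib)
    qed
    also have "\<dots> \<le> 2 * \<bar>t\<bar> ^ 3 * (b * (a q)\<^sup>2)"
      using b[OF q] by (intro mult_left_mono mult_right_mono) auto
    finally show "cmod (?\<phi> q - ?g q) \<le> 2 * \<bar>t\<bar> ^ 3 * b * (a q)\<^sup>2" by (simp add: mult.assoc)
  qed
  finally show ?thesis unfolding 1 2 by (simp add: sum_distrib_left)
qed

text \<open>
  The variable \<open>Q\<close> dominates the indicator of an exceptional event on which nothing is known about
  \<open>Y - Z\<close>; taking its expectation is Markov's inequality.
\<close>

lemma (in prob_space) char_diff_le:
  fixes Y Z B Q :: "'a \<Rightarrow> real"
  assumes [measurable]: "random_variable borel Y" "random_variable borel Z"
    and B: "integrable M B" "\<And>\<omega>. \<omega> \<in> space M \<Longrightarrow> 0 \<le> B \<omega>"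
    and Q: "integrable M Q" "\<And>\<omega>. \<omega> \<in> space M \<Longrightarrow> 0 \<le> Q \<omega>"
    and close: "\<And>\<omega>. \<omega> \<in> space M \<Longrightarrow> Q \<omega> < 1 \<Longrightarrow> \<bar>Y \<omega> - Z \<omega>\<bar> \<le> B \<omega>"
  shows "cmod (char (distr M borel Y) t - char (distr M borel Z) t) \<le> \<bar>t\<bar> * expectation B + 2 * expectation Q"
proof -
  have int: "integrable M (\<lambda>\<omega>. iexp (t * Y \<omega>))" "integrable M (\<lambda>\<omega>. iexp (t * Z \<omega>))"
    by (auto intro!: integrable_iexp)
  have "char (distr M borel Y) t - char (distr M borel Z) t = (CLINT \<omega>|M. iexp (t * Y \<omega>) - iexp (t * Z \<omega>))"
    using int by (simp add: char_def integral_distr)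
  also have "cmod \<dots> \<le> (LINT \<omega>|M. cmod (iexp (t * Y \<omega>) - iexp (t * Z \<omega>)))"
    by (rule integral_norm_bound)
  also have "\<dots> \<le> (LINT \<omega>|M. \<bar>t\<bar> * B \<omega> + 2 * Q \<omega>)"
  proof (rule integral_mono)
    show "integrable M (\<lambda>\<omega>. cmod (iexp (t * Y \<omega>) - iexp (t * Z \<omega>)))" using int by auto
    show "integrable M (\<lambda>\<omega>. \<bar>t\<bar> * B \<omega> + 2 * Q \<omega>)" using B Q by auto
    fix \<omega> assume w: "\<omega> \<in> space M"
    have two: "cmod (iexp (t * Y \<omega>) - iexp (t * Z \<omega>)) \<le> 2"
      using norm_triangle_ineq4[of "iexp (t * Y \<omega>)" "iexp (t * Z \<omega>)"] by (simp flip: of_real_mult)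
    show "cmod (iexp (t * Y \<omega>) - iexp (t * Z \<omega>)) \<le> \<bar>t\<bar> * B \<omega> + 2 * Q \<omega>"
    proof (cases "Q \<omega> < 1")
      case False
      have "0 \<le> \<bar>t\<bar> * B \<omega>" using B(2)[OF w] by simp
      then show ?thesis using two False by linarith
    next
      case True
      define d where "d = t * (Y \<omega> - Z \<omega>)"
      have "iexp (t * Y \<omega>) - iexp (t * Z \<omega>) = iexp (t * Z \<omega>) * (iexp d - 1)"
        by (simp add: d_def algebra_simps flip: exp_add)
      then have "cmod (iexp (t * Y \<omega>) - iexp (t * Z \<omega>)) = cmod (iexp d - 1)"
        by (simp add: norm_mult flip: of_real_mult)
      also have "\<dots> \<le> \<bar>d\<bar>" using iexp_approx1[of d 0] by simp
      also have "\<dots> = \<bar>t\<bar> * \<bar>Y \<omega> - Z \<omega>\<bar>" by (simp add: d_def abs_mult)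
      also have "\<dots> \<le> \<bar>t\<bar> * B \<omega>" using close[OF w True] by (intro mult_left_mono) auto
      finally show ?thesis using Q(2)[OF w] by linarith
    qed
  qed
  also have "\<dots> = \<bar>t\<bar> * expectation B + 2 * expectation Q" using B Q by simp
  finally show ?thesis .
qed

lemma char_real_normal:
  assumes v: "v > 0"
  shows "real_distribution (density lborel (\<lambda>x. ennreal (normal_density 0 (sqrt v) x)))"
    and "char (density lborel (\<lambda>x. ennreal (normal_density 0 (sqrt v) x))) t = complex_of_real (exp (- (t\<^sup>2 * v / 2)))"
proof -
  let ?N = "density lborel (\<lambda>x. ennreal (normal_density 0 (sqrt v) x))"
  interpret S: real_distribution std_normal_distribution by (rule real_dist_normal_dist)
  have "distributed std_normal_distribution lborel (\<lambda>x. x) std_normal_density"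
    by (auto simp: distributed_def distr_id2 cong: distr_cong)
  then have "distributed std_normal_distribution lborel (\<lambda>x. 0 + sqrt v * x) (normal_density (0 + sqrt v * 0) (\<bar>sqrt v\<bar> * 1))"
    using v by (intro S.normal_density_affine) auto
  then have "distr std_normal_distribution lborel (\<lambda>x. sqrt v * x) = ?N"
    using v by (simp add: distributed_def)
  then have eq: "?N = distr std_normal_distribution borel (\<lambda>x. sqrt v * x)"
    by (metis distr_cong sets_lborel)
  show "real_distribution ?N" unfolding eq by (rule S.real_distribution_distr) simp
  have "char ?N t = char std_normal_distribution (t * sqrt v)"
    unfolding eq char_def by (subst integral_distr) (auto simp: mult.assoc)
  then show "char ?N t = complex_of_real (exp (- (t\<^sup>2 * v / 2)))"
    using v by (simp add: char_std_normal_distribution power_mult_distrib flip: exp_of_real of_real_power)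
qed

section \<open>Logarithmic and exponential expansions\<close>

lemma abs_ln_one_plus_x_third_order:
  fixes x :: real
  assumes x: "\<bar>x\<bar> \<le> 1 / 2"
  shows "\<bar>ln (1 + x) - x + x\<^sup>2 / 2\<bar> \<le> 2 * \<bar>x\<bar> ^ 3"
proof -
  let ?f = "\<lambda>x::real. ln (1 + x) - x + x\<^sup>2 / 2" and ?S = "{- \<bar>x\<bar>..\<bar>x\<bar>}"
  have "norm (?f x - ?f 0) \<le> (2 * x\<^sup>2) * norm (x - 0)"
  proof (rule field_differentiable_bound[where S="?S" and f'="\<lambda>y. y\<^sup>2 / (1 + y)"])
    fix y assume y: "y \<in> ?S"
    then have y1: "1 + y \<ge> 1 / 2" using x by auto
    then show "(?f has_field_derivative y\<^sup>2 / (1 + y)) (at y within ?S)"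
      by (auto intro!: derivative_eq_intros simp: field_simps power2_eq_square)
    have "y\<^sup>2 \<le> x\<^sup>2" using y by (auto simp: abs_le_square_iff[symmetric])
    then have "y\<^sup>2 / (1 + y) \<le> x\<^sup>2 / (1 / 2)" using y1 by (intro frac_le) auto
    then show "norm (y\<^sup>2 / (1 + y)) \<le> 2 * x\<^sup>2" using y1 by simp
  qed (auto simp: convex_real_interval)
  also have "(2 * x\<^sup>2) * norm (x - 0) = 2 * \<bar>x\<bar> ^ 3"
  proof -
    have "\<bar>x\<bar> ^ 3 = \<bar>x\<bar> * \<bar>x\<bar>\<^sup>2" by (simp only: power3_eq_cube power2_eq_square mult.assoc)
    then show ?thesis by simp
  qed
  finally show ?thesis by simp
qed

lemma abs_exp_second_order:
  fixes y :: real
  assumes "\<bar>y\<bar> \<le> 1"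
  shows "\<bar>exp y - 1 - y\<bar> \<le> y\<^sup>2"
proof (cases "y \<ge> 0")
  case True
  then have "exp y \<le> 1 + y + y\<^sup>2" using assms by (intro exp_bound) auto
  moreover have "1 + y \<le> exp y" by (rule exp_ge_add_one_self)
  ultimately show ?thesis using zero_le_power2[of y] unfolding abs_le_iff by (intro conjI) linarith+
next
  case False
  have *: "exp y - 1 - y = exp (- (- y)) - (1 - (- y))" by simp
  have "0 \<le> - y" using False by simp
  from exp_neg_quadratic_bound[OF this] show ?thesis unfolding * by simp
qed

text \<open>
  Comparison with the logarithm, term by term:
  \<open>ln ((x + 1) / x) \<le> 1 / x \<le> ln (x / (x - 1))\<close> telescopes. The left comparison ends with
  arguments shifted by one, and undoing the shift costs \<open>1 / (m - n)\<close>.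
\<close>

lemma harmonic_block_bounds:
  assumes "n < m"
  shows "(\<Sum>i<n. 1 / real (m - i)) \<le> ln (real m / real (m - n))"
    and "ln (real m / real (m - n)) \<le> (\<Sum>i<n. 1 / real (m - i)) + 1 / real (m - n)"
proof -
  have up: "1 / x \<le> ln (x / (x - 1))" if "x > 1" for x :: real
  proof -
    have "ln (1 - 1 / x) \<le> - (1 / x)" using that by (intro ln_one_minus_pos_upper_bound) auto
    moreover have "ln (x / (x - 1)) = - ln (1 - 1 / x)"
      using that by (simp add: ln_div[symmetric] field_simps flip: ln_inverse)
    ultimately show ?thesis by simp
  qed
  have low: "ln ((x + 1) / x) \<le> 1 / x" if "x > 0" for x :: real
  proof -
    have "(x + 1) / x = 1 + 1 / x" using that by (simp add: field_simps)
    then show ?thesis using that ln_add_one_self_le_self[of "1 / x"] by simp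
  qed
  show "(\<Sum>i<n. 1 / real (m - i)) \<le> ln (real m / real (m - n))"
    using assms
  proof (induction n)
    case (Suc n)
    have r: "real (m - Suc n) = real (m - n) - 1" using Suc.prems by simp
    have "(\<Sum>i<Suc n. 1 / real (m - i)) \<le> ln (real m / real (m - n)) + ln (real (m - n) / (real (m - n) - 1))"
      using Suc.IH Suc.prems up[of "real (m - n)"] by simp
    also have "\<dots> = ln (real m / real (m - Suc n))"
      using Suc.prems unfolding r by (subst ln_mult_pos[symmetric]) auto
    finally show ?case .
  qed simp
  have *: "ln ((real m + 1) / (real (m - n) + 1)) \<le> (\<Sum>i<n. 1 / real (m - i))"
    using assms
  proof (induction n)
    case (Suc n)
    have r: "real (m - Suc n) + 1 = real (m - n)" using Suc.prems by simp
    have "ln ((real m + 1) / (real (m - Suc n) + 1)) = ln ((real m + 1) / (real (m - n) + 1)) + ln ((real (m - n) + 1) / real (m - n))"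
      using Suc.prems unfolding r by (subst ln_mult_pos[symmetric]) auto
    also have "\<dots> \<le> (\<Sum>i<Suc n. 1 / real (m - i))"
      using Suc.IH Suc.prems low[of "real (m - n)"] by simp
    finally show ?case .
  qed simp
  have pos: "real (m - n) > 0" "real m > 0" using assms by auto
  have "real m / real (m - n) \<le> (real m + 1) / (real (m - n) + 1) * ((real (m - n) + 1) / real (m - n))"
  proof -
    have "(real m + 1) / (real (m - n) + 1) * ((real (m - n) + 1) / real (m - n)) = (real m + 1) / real (m - n)"
      using pos by simp
    then show ?thesis by (simp add: divide_right_mono)
  qed
  then have "ln (real m / real (m - n)) \<le> ln ((real m + 1) / (real (m - n) + 1) * ((real (m - n) + 1) / real (m - n)))"
    using pos by (subst ln_le_cancel_iff) (auto intro!: mult_pos_pos divide_pos_pos)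
  also have "\<dots> = ln ((real m + 1) / (real (m - n) + 1)) + ln ((real (m - n) + 1) / real (m - n))"
    using pos by (intro ln_mult_pos) auto
  also have "\<dots> \<le> (\<Sum>i<n. 1 / real (m - i)) + 1 / real (m - n)"
    using * low[OF pos(1)] by simp
  finally show "ln (real m / real (m - n)) \<le> (\<Sum>i<n. 1 / real (m - i)) + 1 / real (m - n)" .
qed

text \<open>
  Stirling's approximation of \<open>ln (x!)\<close> without the constant \<open>ln (2 * pi) / 2\<close>, which cancels
  in differences.
\<close>

definition stirling_ln :: "real \<Rightarrow> real" where
  "stirling_ln x = x * ln x - x + ln x / 2"

text \<open>
  With \<open>y = 1 / x\<close>, the left-hand side is \<open>1 - (x + 1 / 2) * ln (1 + y)\<close>. The term
  \<open>ln x / 2\<close> in \<open>stirling_ln\<close> accounts for the \<open>1 / 2\<close>, which cancels the terms of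
  order \<open>y\<close>.
\<close>

lemma stirling_ln_step:
  assumes x: "x \<ge> 2"
  shows "\<bar>ln (x + 1) - (stirling_ln (x + 1) - stirling_ln x)\<bar> \<le> 3 / x\<^sup>2"
proof -
  define y where "y = 1 / x"
  have y: "0 < y" "y \<le> 1 / 2" "x * y = 1" using x by (auto simp: y_def field_simps)
  define e where "e = ln (1 + y) - y + y\<^sup>2 / 2"
  have e: "\<bar>e\<bar> \<le> 2 * y ^ 3" using abs_ln_one_plus_x_third_order[of y] y by (simp add: e_def)
  have "ln (x + 1) = ln x + ln (1 + y)"
    using x y by (subst ln_mult_pos[symmetric]) (auto simp: algebra_simps)
  then have "ln (x + 1) - (stirling_ln (x + 1) - stirling_ln x) = 1 - (x + 1 / 2) * ln (1 + y)"
    by (simp add: stirling_ln_def algebra_simps add_divide_distrib)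
  also have "\<dots> = 1 - (x + 1 / 2) * (y - y\<^sup>2 / 2 + e)" by (simp add: e_def)
  also have "\<dots> = 1 - x * y + (x * y) * y / 2 - y / 2 + y\<^sup>2 / 4 - (x + 1 / 2) * e"
    by (simp add: field_simps power2_eq_square)
  also have "\<dots> = y\<^sup>2 / 4 - (x + 1 / 2) * e" unfolding y(3) by simp
  finally have eq: "ln (x + 1) - (stirling_ln (x + 1) - stirling_ln x) = y\<^sup>2 / 4 - (x + 1 / 2) * e" .
  have "\<bar>(x + 1 / 2) * e\<bar> = (x + 1 / 2) * \<bar>e\<bar>" using x by (simp add: abs_mult)
  also have "\<dots> \<le> (x + 1 / 2) * (2 * y ^ 3)" using x e by (intro mult_left_mono) auto
  also have "\<dots> = 2 * (x * y) * y\<^sup>2 + y * y\<^sup>2" by (simp add: algebra_simps power2_eq_square power3_eq_cube)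
  also have "\<dots> \<le> 2 * y\<^sup>2 + 1 / 2 * y\<^sup>2"
  proof -
    have "y * y\<^sup>2 \<le> 1 / 2 * y\<^sup>2" using y(2) by (intro mult_right_mono) auto
    then show ?thesis using y(3) by simp
  qed
  finally have "\<bar>(x + 1 / 2) * e\<bar> \<le> 5 / 2 * y\<^sup>2" by simp
  moreover have "0 \<le> y\<^sup>2" by simp
  ultimately have "\<bar>y\<^sup>2 / 4 - (x + 1 / 2) * e\<bar> \<le> 3 * y\<^sup>2" by linarith
  then show ?thesis unfolding eq by (simp add: y_def power_divide)
qed

lemma sum_ln_block:
  assumes "n + 1 < m"
  shows "\<bar>(\<Sum>i<n. ln (real (m - i))) - (stirling_ln (real m) - stirling_ln (real (m - n)))\<bar> \<le> 3 * real n / (real (m - n))\<^sup>2"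
proof -
  have tele: "(\<Sum>i<l. stirling_ln (real (m - i)) - stirling_ln (real (m - Suc i))) = stirling_ln (real m) - stirling_ln (real (m - l))" for l
    by (induction l) auto
  have "(\<Sum>i<n. ln (real (m - i))) - (stirling_ln (real m) - stirling_ln (real (m - n)))
      = (\<Sum>i<n. ln (real (m - i)) - (stirling_ln (real (m - i)) - stirling_ln (real (m - Suc i))))"
    unfolding tele[symmetric] by (simp add: sum_subtractf)
  also have "\<bar>\<dots>\<bar> \<le> (\<Sum>i<n. \<bar>ln (real (m - i)) - (stirling_ln (real (m - i)) - stirling_ln (real (m - Suc i)))\<bar>)"
    by (rule sum_abs)
  also have "\<dots> \<le> (\<Sum>i<n. 3 / (real (m - n))\<^sup>2)"
  proof (rule sum_mono)
    fix i assume "i \<in> {..<n}"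
    then have i: "i < n" by simp
    have r: "real (m - i) = real (m - Suc i) + 1" using i assms by simp
    have "\<bar>ln (real (m - i)) - (stirling_ln (real (m - i)) - stirling_ln (real (m - Suc i)))\<bar> \<le> 3 / (real (m - Suc i))\<^sup>2"
      unfolding r by (rule stirling_ln_step) (use i assms in simp)
    also have "\<dots> \<le> 3 / (real (m - n))\<^sup>2" using i assms by (intro divide_left_mono power_mono) auto
    finally show "\<bar>ln (real (m - i)) - (stirling_ln (real (m - i)) - stirling_ln (real (m - Suc i)))\<bar> \<le> 3 / (real (m - n))\<^sup>2" .
  qed
  finally show ?thesis by (simp add: mult.commute)
qed

text \<open>
  The bias cancellation. By Stirling's formula \<open>d\<close> is close to minus one half of
  \<open>ln (m / (m - n))\<close>, and this logarithm is close to \<open>h\<close>.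
\<close>

lemma log_det_centring:
  assumes "0 < n" "n + 1 < m"
  defines "h \<equiv> (\<Sum>i<n. 1 / real (m - i))"
    and "d \<equiv> real n * ln (real m) - (\<Sum>i<n. ln (real (m - i))) - (real n + real (m - n) * ln (real (m - n) / real m))"
  shows "\<bar>h / 2 + d\<bar> \<le> 1 / (2 * real (m - n)) + 3 * real n / (real (m - n))\<^sup>2"
proof -
  define r where "r = real (m - n)"
  have pos: "r > 0" "real m > 0" using assms by (auto simp: r_def)
  have n: "real n = real m - r" using assms by (simp add: r_def)
  define L where "L = ln (real m / r)"
  have L: "ln (r / real m) = - L" "ln r = ln (real m) - L" using pos by (auto simp: L_def ln_div)
  have "d + L / 2 = (stirling_ln (real m) - stirling_ln r) - (\<Sum>i<n. ln (real (m - i)))"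
    unfolding d_def r_def[symmetric] stirling_ln_def L n by (simp add: algebra_simps diff_divide_distrib)
  then have "\<bar>d + L / 2\<bar> \<le> 3 * real n / r\<^sup>2"
    using sum_ln_block[OF assms(2)] unfolding r_def[symmetric] by (simp add: abs_minus_commute)
  moreover have "h \<le> L" "L \<le> h + 1 / r"
    using harmonic_block_bounds[of n m] assms(2) unfolding h_def L_def r_def by auto
  moreover have "1 / (2 * r) = (1 / r) / 2" by simp
  ultimately show ?thesis unfolding r_def[symmetric] by (simp add: abs_le_iff)
qed

text \<open>
  The arithmetic-geometric mean inequality trades an absolute third power for powers two and four, whose expectations are
  available in closed form. The weight will be \<open>s = sqrt m\<close>, which balances deviations of order
  \<open>1 / sqrt m\<close>.
\<close>

lemma cube_le_balanced:
  fixes d s :: real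
  assumes "s > 0"
  shows "2 * \<bar>d\<bar> ^ 3 \<le> d\<^sup>2 / s + s * d ^ 4"
proof -
  have "0 \<le> (\<bar>d\<bar> / s - \<bar>d\<bar>\<^sup>2)\<^sup>2 * s" using assms by simp
  also have "(\<bar>d\<bar> / s - \<bar>d\<bar>\<^sup>2)\<^sup>2 * s = \<bar>d\<bar>\<^sup>2 / s - 2 * \<bar>d\<bar> ^ 3 + s * \<bar>d\<bar> ^ 4"
    using assms by (simp add: field_simps power2_eq_square power3_eq_cube power4_eq_xxxx)
  finally show ?thesis by (simp add: power_even_abs)
qed

lemma abs_le_balanced:
  fixes x s :: real
  assumes "s > 0"
  shows "\<bar>x\<bar> \<le> s * x\<^sup>2 + 1 / s"
proof -
  have "0 \<le> (s * \<bar>x\<bar> - 1)\<^sup>2 / s" using assms by simp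
  also have "\<dots> = s * x\<^sup>2 - 2 * \<bar>x\<bar> + 1 / s"
    using assms by (simp add: field_simps power2_eq_square)
  finally show ?thesis by simp
qed

text \<open>
  Second-order expansion of the logarithms. The numbers \<open>v i\<close> stand for the expectations of
  \<open>(\<delta> i)\<^sup>2\<close>: the quadratic terms are split into fluctuations around them and half of their sum,
  which is combined with the deterministic term \<open>d\<close> since only the combination is small.
\<close>

lemma log_ratio_expansion:
  fixes \<delta> v :: "nat \<Rightarrow> real"
  assumes \<tau>: "\<bar>\<tau>\<bar> \<le> 1 / 2" and \<delta>: "\<And>i. i < n \<Longrightarrow> \<bar>\<delta> i\<bar> \<le> 1 / 2" and s: "s > 0"
  shows "\<bar>(real n * ln (1 + \<tau>) - (\<Sum>i<n. ln (1 + \<delta> i)) + d) - (real n * \<tau> - (\<Sum>i<n. \<delta> i))\<bar>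
    \<le> 2 * real n * \<tau>\<^sup>2 + (\<Sum>i<n. (\<delta> i)\<^sup>2 / s + s * (\<delta> i) ^ 4)
      + (s * (\<Sum>i<n. (\<delta> i)\<^sup>2 - v i)\<^sup>2 + 1 / s) + \<bar>(\<Sum>i<n. v i) / 2 + d\<bar>"
proof -
  let ?x = "\<Sum>i<n. (\<delta> i)\<^sup>2 - v i" and ?h = "\<Sum>i<n. v i"
  let ?c = "\<lambda>i. ln (1 + \<delta> i) - \<delta> i + (\<delta> i)\<^sup>2 / 2"
  \<comment> \<open>Half of the squares is moved out of the sum of logarithms, which leaves third-order errors in that sum.\<close>
  have eq: "(real n * ln (1 + \<tau>) - (\<Sum>i<n. ln (1 + \<delta> i)) + d) - (real n * \<tau> - (\<Sum>i<n. \<delta> i))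
    = real n * (ln (1 + \<tau>) - \<tau>) - (\<Sum>i<n. ?c i) + ?x / 2 + (?h / 2 + d)"
    by (simp add: sum.distrib sum_subtractf sum_divide_distrib[symmetric] algebra_simps diff_divide_distrib)
  have 1: "\<bar>real n * (ln (1 + \<tau>) - \<tau>)\<bar> \<le> 2 * real n * \<tau>\<^sup>2"
  proof -
    have "\<bar>real n * (ln (1 + \<tau>) - \<tau>)\<bar> = real n * \<bar>ln (1 + \<tau>) - \<tau>\<bar>" by (simp add: abs_mult)
    also have "\<dots> \<le> real n * (2 * \<tau>\<^sup>2)"
      by (intro mult_left_mono abs_ln_one_plus_x_minus_x_bound \<tau>) simp
    finally show ?thesis by simp
  qed
  have 2: "\<bar>\<Sum>i<n. ?c i\<bar> \<le> (\<Sum>i<n. (\<delta> i)\<^sup>2 / s + s * (\<delta> i) ^ 4)"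
  proof -
    have "\<bar>\<Sum>i<n. ?c i\<bar> \<le> (\<Sum>i<n. \<bar>?c i\<bar>)" by (rule sum_abs)
    also have "\<dots> \<le> (\<Sum>i<n. (\<delta> i)\<^sup>2 / s + s * (\<delta> i) ^ 4)"
      using abs_ln_one_plus_x_third_order[OF \<delta>] cube_le_balanced[OF s] by (intro sum_mono) (auto intro: order_trans)
    finally show ?thesis .
  qed
  have 3: "\<bar>?x / 2\<bar> \<le> s * ?x\<^sup>2 + 1 / s" using abs_le_balanced[OF s, of ?x] by simp
  show ?thesis unfolding eq using 1 2 3 by linarith
qed

text \<open>
  The delta method for \<open>exp\<close> at scale \<open>N\<close>, with the exponent \<open>V / N\<close> replaced by its
  approximation \<open>S / N\<close> and the factor \<open>\<mu>\<close> by its limit \<open>v0\<close>. The error is stated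
  in terms of \<open>S\<^sup>2\<close> and \<open>B\<close> because their expectations will be estimated.
\<close>

lemma exp_delta_bound:
  fixes V S B \<mu> v0 N :: real
  assumes N: "N \<ge> 4" and \<mu>: "\<mu> > 0" and VS: "\<bar>V - S\<bar> \<le> B" and B: "B \<le> 1" and S: "\<bar>S\<bar> \<le> N / 4"
  shows "\<bar>N * (\<mu> * exp (V / N) - \<mu>) - v0 * S\<bar> \<le> \<mu> * ((2 * S\<^sup>2 + 2) / N + B) + \<bar>\<mu> - v0\<bar> * (1 + S\<^sup>2)"
proof -
  have V: "\<bar>V\<bar> \<le> \<bar>S\<bar> + 1" using VS B by linarith
  then have y: "\<bar>V / N\<bar> \<le> 1" using S N by (simp add: abs_div divide_le_eq)
  have "V\<^sup>2 \<le> (\<bar>S\<bar> + 1)\<^sup>2" using V by (simp add: abs_le_square_iff[symmetric])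
  also have "\<dots> \<le> 2 * S\<^sup>2 + 2"
  proof -
    have "0 \<le> (\<bar>S\<bar> - 1)\<^sup>2" by simp
    then show ?thesis by (simp add: power2_eq_square algebra_simps)
  qed
  finally have V2: "V\<^sup>2 \<le> 2 * S\<^sup>2 + 2" .
  have "\<bar>N * (exp (V / N) - 1) - V\<bar> = N * \<bar>exp (V / N) - 1 - V / N\<bar>"
  proof -
    have "N * (exp (V / N) - 1) - V = N * (exp (V / N) - 1 - V / N)" using N by (simp add: right_diff_distrib)
    then show ?thesis using N by (simp add: abs_mult)
  qed
  also have "\<dots> \<le> N * (V / N)\<^sup>2" using N y by (intro mult_left_mono abs_exp_second_order) auto
  also have "\<dots> = V\<^sup>2 / N" using N by (simp add: power2_eq_square)
  also have "\<dots> \<le> (2 * S\<^sup>2 + 2) / N" using V2 N by (intro divide_right_mono) auto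
  finally have 1: "\<bar>N * (exp (V / N) - 1) - V\<bar> \<le> (2 * S\<^sup>2 + 2) / N" .
  have "N * (\<mu> * exp (V / N) - \<mu>) - v0 * S = \<mu> * ((N * (exp (V / N) - 1) - V) + (V - S)) + (\<mu> - v0) * S"
    by (simp add: algebra_simps)
  also have "\<bar>\<dots>\<bar> \<le> \<bar>\<mu> * ((N * (exp (V / N) - 1) - V) + (V - S))\<bar> + \<bar>(\<mu> - v0) * S\<bar>" by (rule abs_triangle_ineq)
  also have "\<bar>\<mu> * ((N * (exp (V / N) - 1) - V) + (V - S))\<bar> \<le> \<mu> * ((2 * S\<^sup>2 + 2) / N + B)"
    using \<mu> 1 VS by (simp add: abs_mult)
  also have "\<bar>(\<mu> - v0) * S\<bar> \<le> \<bar>\<mu> - v0\<bar> * (1 + S\<^sup>2)"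
    using abs_le_balanced[of 1 S] by (simp add: abs_mult mult_left_mono)
  finally show ?thesis by simp
qed

section \<open>The ratio for an array of exponential variables\<close>

definition block_harmonic :: "nat \<Rightarrow> nat \<Rightarrow> real" where
  "block_harmonic n m = (\<Sum>i<n. 1 / real (m - i))"

definition lin_variance :: "nat \<Rightarrow> nat \<Rightarrow> real" where
  "lin_variance n m = block_harmonic n m - real n / real m"

text \<open>
  For \<open>0 < n < m\<close> this is \<open>mu_bar (n / m)\<close>, in the form in which it arises from the logarithm
  of the determinant.
\<close>

definition ratio_centre :: "nat \<Rightarrow> nat \<Rightarrow> real" where
  "ratio_centre n m = exp (1 + real (m - n) / real n * ln (real (m - n) / real m))"

definition ln_det_shift :: "nat \<Rightarrow> nat \<Rightarrow> real" where
  "ln_det_shift n m = real n * ln (real m) - (\<Sum>i<n. ln (real (m - i)))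
     - (real n + real (m - n) * ln (real (m - n) / real m))"

text \<open>
  Bounds the expectation of the remainder in the second-order expansion of \<open>n\<close> times the logarithm of the ratio.
\<close>

definition remainder_bound :: "nat \<Rightarrow> nat \<Rightarrow> real" where
  "remainder_bound n m = 2 / real m + block_harmonic n m / sqrt m + 18 * sqrt m * real n / (real (m - n))\<^sup>2 + 1 / sqrt m
     + (1 / (2 * real (m - n)) + 3 * real n / (real (m - n))\<^sup>2)"

text \<open>
  The multiple of \<open>\<bar>t\<bar>\<close> comes from the delta method, the doubled sum from the exceptional event, and the
  last summand from the central limit theorem for the linear part; \<open>v\<close> is the limit of
  \<open>ratio_centre\<close>.
\<close>

definition char_error :: "nat \<Rightarrow> nat \<Rightarrow> real \<Rightarrow> real \<Rightarrow> real" where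
  "char_error n m v t = \<bar>t\<bar> * (ratio_centre n m * ((2 * lin_variance n m + 2) / real n + remainder_bound n m)
         + \<bar>ratio_centre n m - v\<bar> * (1 + lin_variance n m))
     + 2 * (4 / real (n * m) + 16 * (9 * real n / (real (m - n))\<^sup>2) + 16 / (real n)\<^sup>2 * lin_variance n m + remainder_bound n m)
     + 2 * \<bar>t * v\<bar> ^ 3 * (1 / real (m - n)) * lin_variance n m"

text \<open>
  The condition \<open>n + 1 < m\<close> keeps \<open>m - n\<close> at two or more, the range of the error bound for
  Stirling's formula.
\<close>

locale exponential_array = prob_space M for M :: "'a measure" +
  fixes E :: "nat \<times> nat \<Rightarrow> 'a \<Rightarrow> real" and n m :: nat
  assumes n_pos: "0 < n" and n_less: "n + 1 < m"
    and indep: "indep_vars (\<lambda>_. borel) E ({..<n} \<times> {..<m})"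
    and expo: "q \<in> {..<n} \<times> {..<m} \<Longrightarrow> distributed M lborel (E q) (exponential_density 1)"
begin

abbreviation harm :: real where "harm \<equiv> block_harmonic n m"
abbreviation var :: real where "var \<equiv> lin_variance n m"
abbreviation centre :: real where "centre \<equiv> ratio_centre n m"
abbreviation log_shift :: real where "log_shift \<equiv> ln_det_shift n m"
abbreviation rem_bound :: real where "rem_bound \<equiv> remainder_bound n m"

definition row_dev :: "nat \<Rightarrow> 'a \<Rightarrow> real" where
  "row_dev i \<omega> = (\<Sum>j\<in>{i..<m}. E (i, j) \<omega>) / real (m - i) - 1"

definition tot_dev :: "'a \<Rightarrow> real" where
  "tot_dev \<omega> = (\<Sum>i<n. \<Sum>j<m. E (i, j) \<omega>) / real (n * m) - 1"

definition lin :: "'a \<Rightarrow> real" where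
  "lin \<omega> = real n * tot_dev \<omega> - (\<Sum>i<n. row_dev i \<omega>)"

text \<open>
  The coefficients of \<open>lin\<close> in the centred entries: every entry contributes to the total, and the entries on or
  right of the diagonal contribute to their row sum.
\<close>

definition coeff :: "nat \<times> nat \<Rightarrow> real" where
  "coeff q = 1 / real m - (if fst q \<le> snd q then 1 / real (m - fst q) else 0)"

definition sq_dev :: "'a \<Rightarrow> real" where
  "sq_dev \<omega> = (\<Sum>i<n. (row_dev i \<omega>)\<^sup>2 - 1 / real (m - i))"

lemma E_measurable [measurable]: "q \<in> {..<n} \<times> {..<m} \<Longrightarrow> E q \<in> borel_measurable M"
  using indep by (auto simp: indep_vars_def)

lemma row_erlang:
  assumes "i < n"
  shows "distributed M lborel (\<lambda>\<omega>. \<Sum>j\<in>{i..<m}. E (i, j) \<omega>) (erlang_density (m - i - 1) 1)"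
proof -
  let ?I = "{i} \<times> {i..<m}"
  have sub: "?I \<subseteq> {..<n} \<times> {..<m}" using assms by auto
  have "distributed M lborel (\<lambda>\<omega>. \<Sum>q\<in>?I. E q \<omega>) (erlang_density (card ?I - 1) 1)"
    using sub assms n_less by (intro exponential_distributed_sum indep_vars_subset[OF indep] expo) auto
  moreover have "(\<Sum>q\<in>?I. E q \<omega>) = (\<Sum>j\<in>{i..<m}. E (i, j) \<omega>)" for \<omega>
    by (rule sum.reindex_bij_witness[where i="\<lambda>j. (i, j)" and j=snd]) auto
  ultimately show ?thesis by simp
qed

lemma row_dev_moments:
  assumes i: "i < n"
  shows "integrable M (row_dev i)" "integrable M (\<lambda>\<omega>. (row_dev i \<omega>)\<^sup>2)" "integrable M (\<lambda>\<omega>. (row_dev i \<omega>) ^ 4)"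
    and "expectation (row_dev i) = 0" "expectation (\<lambda>\<omega>. (row_dev i \<omega>)\<^sup>2) = 1 / real (m - i)"
    and "expectation (\<lambda>\<omega>. (row_dev i \<omega>) ^ 4) \<le> 9 / (real (m - i))\<^sup>2"
  using erlang_relative_deviation[OF row_erlang[OF i]] i n_less unfolding row_dev_def[abs_def] by auto

lemma tot_dev_moments:
  shows "integrable M (\<lambda>\<omega>. (tot_dev \<omega>)\<^sup>2)" "expectation (\<lambda>\<omega>. (tot_dev \<omega>)\<^sup>2) = 1 / real (n * m)"
proof -
  let ?I = "{..<n} \<times> {..<m}"
  have "distributed M lborel (\<lambda>\<omega>. \<Sum>q\<in>?I. E q \<omega>) (erlang_density (card ?I - 1) 1)"
    using n_pos n_less by (intro exponential_distributed_sum indep expo) auto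
  moreover have "(\<Sum>q\<in>?I. E q \<omega>) = (\<Sum>i<n. \<Sum>j<m. E (i, j) \<omega>)" for \<omega>
    by (simp add: sum.cartesian_product)
  ultimately have "distributed M lborel (\<lambda>\<omega>. \<Sum>i<n. \<Sum>j<m. E (i, j) \<omega>) (erlang_density (n * m - 1) 1)"
    by simp
  from erlang_relative_deviation(2,5)[OF this] n_pos n_less
  show "integrable M (\<lambda>\<omega>. (tot_dev \<omega>)\<^sup>2)" "expectation (\<lambda>\<omega>. (tot_dev \<omega>)\<^sup>2) = 1 / real (n * m)"
    unfolding tot_dev_def[abs_def] by auto
qed

lemma row_dev_indep: "indep_vars (\<lambda>_. borel) row_dev {..<n}"
proof -
  let ?K = "\<lambda>i. {i} \<times> {i..<m}"
  have "indep_vars (\<lambda>i. PiM (?K i) (\<lambda>_. borel)) (\<lambda>i \<omega>. restrict (\<lambda>q. E q \<omega>) (?K i)) {..<n}"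
    by (rule indep_vars_restrict[OF indep]) (auto simp: disjoint_family_on_def)
  then have "indep_vars (\<lambda>_. borel) (\<lambda>i \<omega>. (\<lambda>x. (\<Sum>j\<in>{i..<m}. x (i, j)) / real (m - i) - 1) (restrict (\<lambda>q. E q \<omega>) (?K i))) {..<n}"
    by (rule indep_vars_compose2) measurable
  then show ?thesis by (simp add: row_dev_def[abs_def])
qed

lemma sq_dev_moments:
  shows "integrable M (\<lambda>\<omega>. (sq_dev \<omega>)\<^sup>2)" "expectation (\<lambda>\<omega>. (sq_dev \<omega>)\<^sup>2) \<le> (\<Sum>i<n. expectation (\<lambda>\<omega>. (row_dev i \<omega>) ^ 4))"
proof -
  let ?X = "\<lambda>i \<omega>. (row_dev i \<omega>)\<^sup>2 - 1 / real (m - i)"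
  have ind: "indep_vars (\<lambda>_. borel) ?X {..<n}"
    by (rule indep_vars_compose2[OF row_dev_indep]) measurable
  have sq: "(?X i \<omega>)\<^sup>2 = (row_dev i \<omega>) ^ 4 - 2 / real (m - i) * (row_dev i \<omega>)\<^sup>2 + (1 / real (m - i))\<^sup>2" for i \<omega>
    by (simp add: power2_diff power_mult[symmetric] mult.commute mult.left_commute)
  have X0: "expectation (?X i) = 0" if "i < n" for i
    using row_dev_moments[OF that] by (simp add: prob_space)
  have X2: "integrable M (\<lambda>\<omega>. (?X i \<omega>)\<^sup>2)" if "i < n" for i
    unfolding sq using row_dev_moments[OF that] by auto
  have le: "expectation (\<lambda>\<omega>. (?X i \<omega>)\<^sup>2) \<le> expectation (\<lambda>\<omega>. (row_dev i \<omega>) ^ 4)" if "i < n" for i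
    unfolding sq using row_dev_moments[OF that] by (simp add: prob_space power2_eq_square)
  show "integrable M (\<lambda>\<omega>. (sq_dev \<omega>)\<^sup>2)"
    unfolding sq_dev_def by (rule indep_sum_second_moment[OF _ ind]) (use X0 X2 in auto)
  have "expectation (\<lambda>\<omega>. (sq_dev \<omega>)\<^sup>2) = (\<Sum>i<n. expectation (\<lambda>\<omega>. (?X i \<omega>)\<^sup>2))"
    unfolding sq_dev_def by (rule indep_sum_second_moment[OF _ ind]) (use X0 X2 in auto)
  also have "\<dots> \<le> (\<Sum>i<n. expectation (\<lambda>\<omega>. (row_dev i \<omega>) ^ 4))" using le by (intro sum_mono) auto
  finally show "expectation (\<lambda>\<omega>. (sq_dev \<omega>)\<^sup>2) \<le> \<dots>" .
qed

lemma lin_eq: "lin \<omega> = (\<Sum>q\<in>{..<n} \<times> {..<m}. coeff q * (E q \<omega> - 1))"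
proof -
  have "(\<Sum>q\<in>{..<n} \<times> {..<m}. coeff q * (E q \<omega> - 1)) = (\<Sum>i<n. \<Sum>j<m. coeff (i, j) * (E (i, j) \<omega> - 1))"
    by (simp add: sum.cartesian_product)
  also have "\<dots> = (\<Sum>i<n. (\<Sum>j<m. (E (i, j) \<omega> - 1)) / real m - row_dev i \<omega>)"
  proof (rule sum.cong[OF refl])
    fix i assume "i \<in> {..<n}"
    then have i: "i < m" using n_less by auto
    have "(\<Sum>j<m. coeff (i, j) * (E (i, j) \<omega> - 1))
       = (\<Sum>j<m. (E (i, j) \<omega> - 1) / real m) - (\<Sum>j<m. if i \<le> j then (E (i, j) \<omega> - 1) / real (m - i) else 0)"
      by (simp add: coeff_def sum_subtractf[symmetric]) (intro sum.cong, auto simp: algebra_simps diff_divide_distrib)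
    also have "(\<Sum>j<m. if i \<le> j then (E (i, j) \<omega> - 1) / real (m - i) else 0) = (\<Sum>j\<in>{i..<m}. (E (i, j) \<omega> - 1) / real (m - i))"
      by (subst sum.inter_filter[symmetric]) (auto intro!: sum.cong)
    also have "\<dots> = row_dev i \<omega>"
      using i by (simp add: row_dev_def sum_subtractf sum_divide_distrib[symmetric] diff_divide_distrib)
    finally show "(\<Sum>j<m. coeff (i, j) * (E (i, j) \<omega> - 1)) = (\<Sum>j<m. (E (i, j) \<omega> - 1)) / real m - row_dev i \<omega>"
      by (simp add: sum_divide_distrib)
  qed
  also have "\<dots> = (\<Sum>i<n. \<Sum>j<m. (E (i, j) \<omega> - 1)) / real m - (\<Sum>i<n. row_dev i \<omega>)"
    by (simp only: sum_subtractf[of _ "\<lambda>i. row_dev i \<omega>"] sum_divide_distrib)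
  also have "(\<Sum>i<n. \<Sum>j<m. (E (i, j) \<omega> - 1)) / real m = real n * tot_dev \<omega>"
    using n_pos n_less by (simp add: tot_dev_def sum_subtractf field_simps)
  finally show ?thesis by (simp add: lin_def)
qed

text \<open>
  Row \<open>i\<close> contributes \<open>i / m\<^sup>2 + (m - i) * (1 / m - 1 / (m - i))\<^sup>2\<close>,
  which simplifies to \<open>1 / (m - i) - 1 / m\<close>.
\<close>

lemma sum_coeff_sq: "(\<Sum>q\<in>{..<n} \<times> {..<m}. (coeff q)\<^sup>2) = var"
proof -
  have "(\<Sum>q\<in>{..<n} \<times> {..<m}. (coeff q)\<^sup>2) = (\<Sum>i<n. \<Sum>j<m. (coeff (i, j))\<^sup>2)"
    by (simp add: sum.cartesian_product)
  also have "\<dots> = (\<Sum>i<n. 1 / real (m - i) - 1 / real m)"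
  proof (rule sum.cong[OF refl])
    fix i assume "i \<in> {..<n}"
    then have i: "i < m" using n_less by auto
    define r where "r = real (m - i)"
    have r: "r > 0" "real m > 0" "real i = real m - r" using i by (auto simp: r_def)
    have "(\<Sum>j<m. (coeff (i, j))\<^sup>2) = (\<Sum>j\<in>{..<i}. (coeff (i, j))\<^sup>2) + (\<Sum>j\<in>{i..<m}. (coeff (i, j))\<^sup>2)"
      using i by (subst sum.union_disjoint[symmetric]) (auto intro!: sum.cong)
    also have "(\<Sum>j\<in>{..<i}. (coeff (i, j))\<^sup>2) = (\<Sum>j\<in>{..<i}. (1 / real m)\<^sup>2)"
      by (intro sum.cong) (auto simp: coeff_def)
    also have "(\<Sum>j\<in>{i..<m}. (coeff (i, j))\<^sup>2) = (\<Sum>j\<in>{i..<m}. (1 / real m - 1 / r)\<^sup>2)"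
      by (intro sum.cong) (auto simp: coeff_def r_def)
    also have "(\<Sum>j\<in>{..<i}. (1 / real m)\<^sup>2) + (\<Sum>j\<in>{i..<m}. (1 / real m - 1 / r)\<^sup>2)
        = real i * (1 / real m)\<^sup>2 + r * (1 / real m - 1 / r)\<^sup>2"
      by (simp only: sum_constant card_atLeastLessThan card_lessThan r_def)
    also have "\<dots> = 1 / r - 1 / real m"
      unfolding r(3) using r(1,2) by (simp add: field_simps power2_eq_square)
    finally show "(\<Sum>j<m. (coeff (i, j))\<^sup>2) = 1 / real (m - i) - 1 / real m" by (simp add: r_def)
  qed
  also have "\<dots> = var" by (simp add: sum_subtractf lin_variance_def block_harmonic_def)
  finally show ?thesis .
qed

lemma abs_coeff_le:
  assumes "q \<in> {..<n} \<times> {..<m}"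
  shows "\<bar>coeff q\<bar> \<le> 1 / real (m - n)"
proof -
  have i: "fst q < n" using assms by auto
  have le: "1 / real m \<le> 1 / real (m - n)" "1 / real m \<le> 1 / real (m - fst q)" "1 / real (m - fst q) \<le> 1 / real (m - n)"
    using i n_less by (auto intro!: divide_left_mono)
  have nn: "0 \<le> 1 / real m" by simp
  have tri: "\<bar>a - b\<bar> \<le> z" if "a \<le> z" "a \<le> b" "b \<le> z" "0 \<le> a" for a b z :: real
    using that by linarith
  show ?thesis
  proof (cases "fst q \<le> snd q")
    case True
    then have "coeff q = 1 / real m - 1 / real (m - fst q)" by (simp add: coeff_def)
    then show ?thesis using tri[OF le nn] by simp
  next
    case False
    then have "coeff q = 1 / real m" by (simp add: coeff_def)
    then show ?thesis using le(1) by simp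
  qed
qed

lemma lin_second_moment:
  shows "integrable M (\<lambda>\<omega>. (lin \<omega>)\<^sup>2)" "expectation (\<lambda>\<omega>. (lin \<omega>)\<^sup>2) = var"
proof -
  let ?I = "{..<n} \<times> {..<m}"
  let ?X = "\<lambda>q \<omega>. coeff q * (E q \<omega> - 1)"
  have ind: "indep_vars (\<lambda>_. borel) ?X ?I"
    by (rule indep_vars_compose2[OF indep]) measurable
  have mom: "integrable M (E q)" "expectation (?X q) = 0" "integrable M (\<lambda>\<omega>. (?X q \<omega>)\<^sup>2)" "expectation (\<lambda>\<omega>. (?X q \<omega>)\<^sup>2) = (coeff q)\<^sup>2"
    if "q \<in> ?I" for q
  proof -
    have "distributed M lborel (E q) (erlang_density (1 - 1) 1)" using expo[OF that] by simp
    note e = erlang_relative_deviation[OF this, simplified]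
    have "integrable M (\<lambda>\<omega>. (E q \<omega> - 1) + 1)" using e by (intro Bochner_Integration.integrable_add) auto
    then show "integrable M (E q)" by simp
    show "expectation (?X q) = 0" "integrable M (\<lambda>\<omega>. (?X q \<omega>)\<^sup>2)" "expectation (\<lambda>\<omega>. (?X q \<omega>)\<^sup>2) = (coeff q)\<^sup>2"
      using e by (simp_all add: power_mult_distrib)
  qed
  have "integrable M (\<lambda>\<omega>. (\<Sum>q\<in>?I. ?X q \<omega>)\<^sup>2)"
    "expectation (\<lambda>\<omega>. (\<Sum>q\<in>?I. ?X q \<omega>)\<^sup>2) = (\<Sum>q\<in>?I. expectation (\<lambda>\<omega>. (?X q \<omega>)\<^sup>2))"
    by (rule indep_sum_second_moment[OF _ ind]; use mom in auto)+
  moreover have "(\<Sum>q\<in>?I. expectation (\<lambda>\<omega>. (?X q \<omega>)\<^sup>2)) = var"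
    unfolding sum_coeff_sq[symmetric] using mom by (intro sum.cong) auto
  ultimately show "integrable M (\<lambda>\<omega>. (lin \<omega>)\<^sup>2)" "expectation (\<lambda>\<omega>. (lin \<omega>)\<^sup>2) = var"
    unfolding lin_eq by simp_all
qed

lemma lin_measurable [measurable]: "lin \<in> borel_measurable M"
  unfolding lin_eq[abs_def] by measurable

lemma char_lin:
  "cmod (char (distr M borel lin) t - complex_of_real (exp (- (t\<^sup>2 * var / 2)))) \<le> 2 * \<bar>t\<bar> ^ 3 * (1 / real (m - n)) * var"
  using char_exponential_linear_form[where E=E and a=coeff and t=t, OF _ indep expo abs_coeff_le]
  unfolding lin_eq[abs_def] sum_coeff_sq by simp

definition ratio :: "'a \<Rightarrow> real" where
  "ratio \<omega> = mean_ratio n (\<Sum>i<n. \<Sum>j<m. E (i, j) \<omega>) (\<Prod>i<n. \<Sum>j\<in>{i..<m}. E (i, j) \<omega>)"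

lemma ratio_measurable [measurable]: "ratio \<in> borel_measurable M"
proof -
  have "E (i, j) \<in> borel_measurable M" if "i < n" "j < m" for i j using that by auto
  then have "(\<lambda>\<omega>. \<Sum>i<n. \<Sum>j<m. E (i, j) \<omega>) \<in> borel_measurable M" "(\<lambda>\<omega>. \<Prod>i<n. \<Sum>j\<in>{i..<m}. E (i, j) \<omega>) \<in> borel_measurable M"
    by (auto intro!: borel_measurable_sum borel_measurable_prod)
  then show ?thesis unfolding ratio_def[abs_def] mean_ratio_def by measurable
qed

lemma ratio_eq_exp:
  assumes tau: "\<bar>tot_dev \<omega>\<bar> \<le> 1 / 2" and rows: "\<And>i. i < n \<Longrightarrow> \<bar>row_dev i \<omega>\<bar> \<le> 1 / 2"
  shows "ratio \<omega> = centre * exp ((real n * ln (1 + tot_dev \<omega>) - (\<Sum>i<n. ln (1 + row_dev i \<omega>)) + log_shift) / real n)"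
proof -
  let ?T = "\<Sum>i<n. \<Sum>j<m. E (i, j) \<omega>" and ?Y = "\<lambda>i. \<Sum>j\<in>{i..<m}. E (i, j) \<omega>"
  have T: "?T / real n = real m * (1 + tot_dev \<omega>)" using n_pos n_less by (simp add: tot_dev_def)
  have tp: "1 + tot_dev \<omega> > 0" using tau by linarith
  have Y: "?Y i = real (m - i) * (1 + row_dev i \<omega>)" "0 < real (m - i)" "0 < 1 + row_dev i \<omega>" if "i < n" for i
  proof -
    show "?Y i = real (m - i) * (1 + row_dev i \<omega>)" "0 < real (m - i)"
      using that n_less by (auto simp: row_dev_def)
    show "0 < 1 + row_dev i \<omega>" using rows[OF that] by linarith
  qed
  have Ypos: "?Y i > 0" if "i < n" for i unfolding Y(1)[OF that] using Y(2,3)[OF that] by (rule mult_pos_pos)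
  define D where "D = (\<Prod>i<n. ?Y i)"
  have D: "D > 0" unfolding D_def using Ypos by (intro prod_pos) auto
  have lnprod: "ln D = (\<Sum>i<n. ln (real (m - i))) + (\<Sum>i<n. ln (1 + row_dev i \<omega>))"
  proof -
    have "ln D = (\<Sum>i<n. ln (?Y i))" unfolding D_def using Ypos less_imp_neq by (intro ln_prod) fastforce+
    also have "\<dots> = (\<Sum>i<n. ln (real (m - i)) + ln (1 + row_dev i \<omega>))"
      using Y by (intro sum.cong) (auto simp: ln_mult_pos)
    finally show ?thesis by (simp add: sum.distrib)
  qed
  have "ratio \<omega> = exp (ln (real m) + ln (1 + tot_dev \<omega>)) / exp (1 / real n * ln D)"
    unfolding ratio_def mean_ratio_def T D_def[symmetric] using tp n_less D by (simp add: powr_def exp_add)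
  also have "\<dots> = exp (ln (real m) + ln (1 + tot_dev \<omega>) - 1 / real n * ln D)"
    by (simp add: exp_diff)
  also have "ln (real m) + ln (1 + tot_dev \<omega>) - 1 / real n * ln D
     = (1 + real (m - n) / real n * ln (real (m - n) / real m))
       + (real n * ln (1 + tot_dev \<omega>) - (\<Sum>i<n. ln (1 + row_dev i \<omega>)) + log_shift) / real n"
    unfolding lnprod ln_det_shift_def using n_pos by (simp add: field_simps)
  finally show ?thesis by (simp add: ratio_centre_def exp_add)
qed

text \<open>
  The right-hand side of \<open>log_ratio_expansion\<close> with weight \<open>sqrt m\<close>.
\<close>

definition rem :: "'a \<Rightarrow> real" where
  "rem \<omega> = 2 * real n * (tot_dev \<omega>)\<^sup>2 + (\<Sum>i<n. (row_dev i \<omega>)\<^sup>2 / sqrt m + sqrt m * (row_dev i \<omega>) ^ 4)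
     + (sqrt m * (sq_dev \<omega>)\<^sup>2 + 1 / sqrt m) + \<bar>harm / 2 + log_shift\<bar>"

lemma fourth_moment_sum: "(\<Sum>i<n. expectation (\<lambda>\<omega>. (row_dev i \<omega>) ^ 4)) \<le> 9 * real n / (real (m - n))\<^sup>2"
proof -
  have "(\<Sum>i<n. expectation (\<lambda>\<omega>. (row_dev i \<omega>) ^ 4)) \<le> (\<Sum>i<n. 9 / (real (m - n))\<^sup>2)"
  proof (rule sum_mono)
    fix i assume "i \<in> {..<n}"
    then have i: "i < n" by simp
    have "expectation (\<lambda>\<omega>. (row_dev i \<omega>) ^ 4) \<le> 9 / (real (m - i))\<^sup>2" by (rule row_dev_moments(6)[OF i])
    also have "\<dots> \<le> 9 / (real (m - n))\<^sup>2" using i n_less by (intro divide_left_mono power_mono) auto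
    finally show "expectation (\<lambda>\<omega>. (row_dev i \<omega>) ^ 4) \<le> 9 / (real (m - n))\<^sup>2" .
  qed
  then show ?thesis by (simp add: mult.commute)
qed

lemma rem_integral:
  shows "integrable M rem" "expectation rem \<le> rem_bound"
proof -
  note int [simp] = tot_dev_moments(1) sq_dev_moments(1)
  let ?F = "\<Sum>i<n. expectation (\<lambda>\<omega>. (row_dev i \<omega>) ^ 4)"
  define r where "r \<omega> = (\<Sum>i<n. (row_dev i \<omega>)\<^sup>2 / sqrt m + sqrt m * (row_dev i \<omega>) ^ 4)" for \<omega>
  have r: "integrable M r"
    unfolding r_def[abs_def] using row_dev_moments by (intro Bochner_Integration.integrable_sum) auto
  show "integrable M rem" unfolding rem_def[abs_def] r_def[symmetric] using r by auto
  have "expectation r = (\<Sum>i<n. 1 / real (m - i) / sqrt m + sqrt m * expectation (\<lambda>\<omega>. (row_dev i \<omega>) ^ 4))"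
    unfolding r_def[abs_def] using row_dev_moments
    by (subst Bochner_Integration.integral_sum) (auto intro!: sum.cong)
  also have "\<dots> = harm / sqrt m + sqrt m * ?F"
    by (simp add: sum.distrib block_harmonic_def sum_divide_distrib sum_distrib_left)
  finally have Er: "expectation r = \<dots>" .
  have "expectation rem = 2 * real n * (1 / real (n * m)) + (harm / sqrt m + sqrt m * ?F)
      + (sqrt m * expectation (\<lambda>\<omega>. (sq_dev \<omega>)\<^sup>2) + 1 / sqrt m) + \<bar>harm / 2 + log_shift\<bar>"
    unfolding rem_def[abs_def] r_def[symmetric] using r by (simp add: prob_space Er tot_dev_moments)
  also have "\<dots> \<le> 2 * real n * (1 / real (n * m)) + (harm / sqrt m + sqrt m * (9 * real n / (real (m - n))\<^sup>2))
      + (sqrt m * (9 * real n / (real (m - n))\<^sup>2) + 1 / sqrt m) + (1 / (2 * real (m - n)) + 3 * real n / (real (m - n))\<^sup>2)"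
    using fourth_moment_sum order_trans[OF sq_dev_moments(2) fourth_moment_sum] log_det_centring[OF n_pos n_less]
    unfolding block_harmonic_def ln_det_shift_def
    by (intro add_mono mult_left_mono) auto
  also have "\<dots> = rem_bound"
    using n_pos unfolding remainder_bound_def by simp
  finally show "expectation rem \<le> rem_bound" .
qed

text \<open>
  If this is below one, then each deviation is at most \<open>1 / 2\<close>, the linear part is at most
  \<open>n / 4\<close> and the remainder is at most one: each summand forces one of these conditions.
\<close>

definition bad :: "'a \<Rightarrow> real" where
  "bad \<omega> = 4 * (tot_dev \<omega>)\<^sup>2 + 16 * (\<Sum>i<n. (row_dev i \<omega>) ^ 4) + 16 / (real n)\<^sup>2 * (lin \<omega>)\<^sup>2 + rem \<omega>"

lemma rem_nonneg: "rem \<omega> \<ge> 0"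
  unfolding rem_def by (intro add_nonneg_nonneg sum_nonneg mult_nonneg_nonneg divide_nonneg_nonneg) auto

lemma close_of_not_bad:
  assumes n4: "n \<ge> 4" and bad: "bad \<omega> < 1"
  shows "\<bar>real n * (ratio \<omega> - centre) - v * lin \<omega>\<bar>
     \<le> centre * ((2 * (lin \<omega>)\<^sup>2 + 2) / real n + rem \<omega>) + \<bar>centre - v\<bar> * (1 + (lin \<omega>)\<^sup>2)"
proof -
  have nn: "0 \<le> 4 * (tot_dev \<omega>)\<^sup>2" "0 \<le> 16 * (\<Sum>i<n. (row_dev i \<omega>) ^ 4)" "0 \<le> 16 / (real n)\<^sup>2 * (lin \<omega>)\<^sup>2"
    by (auto intro!: sum_nonneg)
  have rem1: "rem \<omega> \<le> 1" using bad nn unfolding bad_def by linarith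
  have "4 * (tot_dev \<omega>)\<^sup>2 \<le> 1" using bad nn rem_nonneg[of \<omega>] unfolding bad_def by linarith
  then have "(tot_dev \<omega>)\<^sup>2 \<le> (1 / 2)\<^sup>2" by (simp add: power_divide)
  then have tau: "\<bar>tot_dev \<omega>\<bar> \<le> 1 / 2" unfolding abs_le_square_iff[symmetric] by simp
  have rows: "\<bar>row_dev i \<omega>\<bar> \<le> 1 / 2" if i: "i < n" for i
  proof (rule ccontr)
    assume "\<not> \<bar>row_dev i \<omega>\<bar> \<le> 1 / 2"
    then have "(1 / 2) ^ 4 < \<bar>row_dev i \<omega>\<bar> ^ 4" by (intro power_strict_mono) auto
    moreover have "(1 / 2 :: real) ^ 4 = 1 / 16" by (simp add: power_divide)
    ultimately have "1 < 16 * (row_dev i \<omega>) ^ 4" by (simp add: power_even_abs)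
    also have "\<dots> \<le> 16 * (\<Sum>i<n. (row_dev i \<omega>) ^ 4)"
      using i by (intro mult_left_mono member_le_sum) auto
    finally show False using bad nn rem_nonneg[of \<omega>] unfolding bad_def by linarith
  qed
  have "16 / (real n)\<^sup>2 * (lin \<omega>)\<^sup>2 \<le> 1" using bad nn rem_nonneg[of \<omega>] unfolding bad_def by linarith
  then have "(lin \<omega>)\<^sup>2 \<le> (real n / 4)\<^sup>2" using n_pos by (simp add: field_simps power2_eq_square)
  then have lin4: "\<bar>lin \<omega>\<bar> \<le> real n / 4" unfolding abs_le_square_iff[symmetric] by simp
  define V where "V = real n * ln (1 + tot_dev \<omega>) - (\<Sum>i<n. ln (1 + row_dev i \<omega>)) + log_shift"
  have VS: "\<bar>V - lin \<omega>\<bar> \<le> rem \<omega>"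
    using log_ratio_expansion[where n=n and s="sqrt m" and d=log_shift and v="\<lambda>i. 1 / real (m - i)"
        and \<tau>="tot_dev \<omega>" and \<delta>="\<lambda>i. row_dev i \<omega>", OF tau rows] n_less
    unfolding V_def lin_def rem_def block_harmonic_def sq_dev_def by simp
  have "\<bar>real n * (centre * exp (V / real n) - centre) - v * lin \<omega>\<bar>
     \<le> centre * ((2 * (lin \<omega>)\<^sup>2 + 2) / real n + rem \<omega>) + \<bar>centre - v\<bar> * (1 + (lin \<omega>)\<^sup>2)"
    by (rule exp_delta_bound[OF _ _ VS rem1 lin4]) (use n4 in \<open>auto simp: ratio_centre_def\<close>)
  then show ?thesis using ratio_eq_exp[OF tau rows] by (simp add: V_def)
qed

text \<open>
  The ratio is compared with \<open>v * lin\<close> through \<open>char_diff_le\<close>, and \<open>lin\<close> with a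
  Gaussian variable through \<open>char_lin\<close>.
\<close>

lemma char_ratio:
  assumes n4: "n \<ge> 4"
  shows "cmod (char (distr M borel (\<lambda>\<omega>. real n * (ratio \<omega> - centre))) t - complex_of_real (exp (- ((t * v)\<^sup>2 * var / 2)))) \<le> char_error n m v t"
proof -
  let ?Z = "\<lambda>\<omega>. real n * (ratio \<omega> - centre)" and ?S = "\<lambda>\<omega>. v * lin \<omega>"
  let ?B = "\<lambda>\<omega>. centre * ((2 * (lin \<omega>)\<^sup>2 + 2) / real n + rem \<omega>) + \<bar>centre - v\<bar> * (1 + (lin \<omega>)\<^sup>2)"
  have c: "centre > 0" by (simp add: ratio_centre_def)
  note [simp] = lin_second_moment rem_integral(1) tot_dev_moments
  have introw: "integrable M (\<lambda>\<omega>. \<Sum>i<n. (row_dev i \<omega>) ^ 4)"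
    using row_dev_moments by (intro Bochner_Integration.integrable_sum) auto
  have B: "integrable M ?B" by auto
  have Q: "integrable M bad" unfolding bad_def[abs_def] using introw by auto
  have "expectation ?B = centre * ((2 * var + 2) / real n + expectation rem) + \<bar>centre - v\<bar> * (1 + var)"
    by (simp add: prob_space)
  also have "\<dots> \<le> centre * ((2 * var + 2) / real n + rem_bound) + \<bar>centre - v\<bar> * (1 + var)"
    using c rem_integral(2) by (intro add_right_mono mult_left_mono add_left_mono) auto
  finally have EB: "expectation ?B \<le> centre * ((2 * var + 2) / real n + rem_bound) + \<bar>centre - v\<bar> * (1 + var)" .
  have "expectation bad = 4 / real (n * m) + 16 * (\<Sum>i<n. expectation (\<lambda>\<omega>. (row_dev i \<omega>) ^ 4)) + 16 / (real n)\<^sup>2 * var + expectation rem"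
    unfolding bad_def[abs_def] using introw row_dev_moments by (simp add: Bochner_Integration.integral_sum)
  also have "\<dots> \<le> 4 / real (n * m) + 16 * (9 * real n / (real (m - n))\<^sup>2) + 16 / (real n)\<^sup>2 * var + rem_bound"
    using rem_integral(2) fourth_moment_sum by (intro add_mono mult_left_mono) auto
  finally have EQ: "expectation bad \<le> 4 / real (n * m) + 16 * (9 * real n / (real (m - n))\<^sup>2) + 16 / (real n)\<^sup>2 * var + rem_bound" .
  have "cmod (char (distr M borel ?Z) t - char (distr M borel ?S) t) \<le> \<bar>t\<bar> * expectation ?B + 2 * expectation bad"
  proof (rule char_diff_le)
    show "0 \<le> ?B \<omega>" for \<omega> using c rem_nonneg[of \<omega>]
      by (intro add_nonneg_nonneg mult_nonneg_nonneg divide_nonneg_nonneg) auto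
    show "0 \<le> bad \<omega>" for \<omega> unfolding bad_def using rem_nonneg[of \<omega>]
      by (intro add_nonneg_nonneg mult_nonneg_nonneg sum_nonneg) auto
    show "bad \<omega> < 1 \<Longrightarrow> \<bar>?Z \<omega> - ?S \<omega>\<bar> \<le> ?B \<omega>" for \<omega> by (rule close_of_not_bad[OF n4])
  qed (use B Q in auto)
  also have "\<dots> \<le> \<bar>t\<bar> * (centre * ((2 * var + 2) / real n + rem_bound) + \<bar>centre - v\<bar> * (1 + var))
     + 2 * (4 / real (n * m) + 16 * (9 * real n / (real (m - n))\<^sup>2) + 16 / (real n)\<^sup>2 * var + rem_bound)"
    using EB EQ by (intro add_mono mult_left_mono) auto
  finally have 1: "cmod (char (distr M borel ?Z) t - char (distr M borel ?S) t) \<le> \<dots>" .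
  have "char (distr M borel ?S) t = char (distr M borel lin) (t * v)"
    by (simp add: char_def integral_distr mult.assoc)
  then have 2: "cmod (char (distr M borel ?S) t - complex_of_real (exp (- ((t * v)\<^sup>2 * var / 2)))) \<le> 2 * \<bar>t * v\<bar> ^ 3 * (1 / real (m - n)) * var"
    using char_lin[of "t * v"] by simp
  show ?thesis unfolding char_error_def
    using norm_triangle_le[OF add_mono[OF 1 2]] by simp
qed

end

section \<open>Asymptotics and convergence in distribution\<close>

lemma weak_conv_m_of_char:
  assumes M: "\<And>k. real_distribution (M k)" and v: "v > 0"
    and char: "\<And>t. (\<lambda>k. char (M k) t) \<longlonglongrightarrow> complex_of_real (exp (- (t\<^sup>2 * v / 2)))"
  shows "weak_conv_m M (real_gaussian 0 v)"
  unfolding real_gaussian_def using M char_real_normal[OF v] char by (intro levy_continuity) auto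

lemma gaussian_array_exponential:
  assumes s: "s > 0" and n: "0 < n" and nm: "n + 1 < m"
  shows "exponential_array (gaussian_array s n m) (energy s) n m"
proof -
  have m: "m > 0" using nm by simp
  interpret prob_space "gaussian_array s n m" by (rule gaussian_array_energies(1)[OF s n m])
  show ?thesis using gaussian_array_energies[OF s n m] n nm by unfold_locales auto
qed

lemma W0_char_bound:
  assumes M: "prob_space M" and s: "s > 0" and n: "n \<ge> 4" and nm: "n + 1 < m"
    and X: "gaussian_column_matrix M n m s X"
  shows "cmod (char (distr M borel (\<lambda>\<omega>. real n * (W0 (X \<omega>) - ratio_centre n m))) t
     - complex_of_real (exp (- ((t * v)\<^sup>2 * lin_variance n m / 2)))) \<le> char_error n m v t"
proof -
  have n0: "0 < n" and le: "n \<le> m" using n nm by auto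
  interpret A: exponential_array "gaussian_array s n m" "energy s" n m
    by (rule gaussian_array_exponential[OF s n0 nm])
  have "distr M borel (\<lambda>\<omega>. real n * (W0 (X \<omega>) - ratio_centre n m))
     = distr (gaussian_array s n m) borel (\<lambda>x. real n * (A.ratio x - ratio_centre n m))"
    unfolding W0_law[OF M s n0 le X] mean_ratio_energy[OF s n0] A.ratio_def ..
  then show ?thesis using A.char_ratio[OF n, of t v] by simp
qed

lemma ratio_centre_eq_mu_bar:
  assumes "0 < n" "n < m"
  shows "ratio_centre n m = mu_bar (real n / real m)"
proof -
  let ?c = "real n / real m"
  have m: "real m > 0" "real n > 0" using assms by auto
  define x y where "x = real (m - n) / real m" and "y = real (m - n) / real n"
  have 1: "1 - ?c = x" using assms by (simp add: x_def field_simps)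
  have 2: "(1 - ?c) / ?c = y" unfolding 1 x_def y_def using m by simp
  have x: "x > 0" using assms by (simp add: x_def)
  have "mu_bar ?c = exp 1 * x powr y" by (simp only: mu_bar_def 1[symmetric] 2[symmetric])
  also have "\<dots> = exp (1 + y * ln x)" using x by (simp add: powr_def exp_add)
  also have "\<dots> = ratio_centre n m" by (simp only: ratio_centre_def x_def y_def)
  finally show ?thesis by simp
qed

lemma mu_bar_differentiable:
  assumes "0 < c" "c < 1"
  shows "\<exists>D. (mu_bar has_field_derivative D) (at c)"
proof -
  let ?f = "\<lambda>x::real. exp 1 * exp ((1 - x) / x * ln (1 - x))"
  have "\<exists>D. (?f has_field_derivative D) (at c)"
    by (rule exI) (use assms in \<open>auto intro!: derivative_eq_intros\<close>)
  then obtain D where "(?f has_field_derivative D) (at c)" by blast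
  then have "(mu_bar has_field_derivative D) (at c)"
    by (rule has_field_derivative_transform_within_open[where S="{..<1}"])
       (use assms in \<open>auto simp: mu_bar_def powr_def\<close>)
  then show ?thesis by blast
qed

text \<open>
  Strict concavity of the logarithm; the limit law is therefore non-degenerate.
\<close>

lemma lin_variance_limit_pos:
  assumes "0 < c" "c < (1::real)"
  shows "0 < ln (1 / (1 - c)) - c"
proof -
  have "ln (1 - c) \<le> (1 - c) - 1" using assms by (intro ln_le_minus_one) auto
  moreover have "ln (1 - c) \<noteq> (1 - c) - 1" using ln_eq_minus_one[of "1 - c"] assms by auto
  ultimately show ?thesis using assms by (simp add: ln_div)
qed

lemma sigma2_bar_eq: "sigma2_bar c = (mu_bar c)\<^sup>2 * (ln (1 / (1 - c)) - c)"
proof -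
  have "((1 - c) powr ((1 - c) / c))\<^sup>2 = (1 - c) powr (2 * (1 - c) / c)"
    by (simp add: power2_eq_square powr_add[symmetric] flip: add_divide_distrib)
  then show ?thesis by (simp add: sigma2_bar_def mu_bar_def power_mult_distrib)
qed

context
  fixes n m :: "nat \<Rightarrow> nat" and c :: real
  assumes n_top: "filterlim n at_top sequentially"
    and n_pos: "\<And>k. 0 < n k" and m_pos: "\<And>k. 0 < m k"
    and ratio: "(\<lambda>k. real (n k) / real (m k)) \<longlonglongrightarrow> c"
    and c: "0 < c" "c < 1"
begin

lemma real_n_at_top: "filterlim (\<lambda>k. real (n k)) at_top sequentially"
  by (rule filterlim_compose[OF filterlim_real_sequentially n_top])

lemma eventually_n_less: "\<forall>\<^sub>F k in sequentially. n k < m k"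
proof -
  have "\<forall>\<^sub>F k in sequentially. real (n k) / real (m k) < 1" using ratio c by (intro order_tendstoD(2)) auto
  then show ?thesis by eventually_elim (use m_pos in \<open>simp add: divide_less_eq\<close>)
qed

lemma real_m_at_top: "filterlim (\<lambda>k. real (m k)) at_top sequentially"
  by (rule filterlim_at_top_mono[OF real_n_at_top])
     (use eventually_n_less in eventually_elim, simp)

lemma m_minus_n_at_top: "filterlim (\<lambda>k. real (m k - n k)) at_top sequentially"
proof -
  have "filterlim (\<lambda>k. (1 - real (n k) / real (m k)) * real (m k)) at_top sequentially"
    by (rule filterlim_tendsto_pos_mult_at_top[OF _ _ real_m_at_top, of _ "1 - c"])
       (use ratio c in \<open>auto intro!: tendsto_intros\<close>)
  then show ?thesis
    by (rule filterlim_cong[THEN iffD1, OF refl refl, rotated])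
       (use eventually_n_less in eventually_elim, use m_pos in \<open>simp add: field_simps\<close>)
qed

lemma eventually_large: "\<forall>\<^sub>F k in sequentially. 4 \<le> n k \<and> n k + 1 < m k"
proof -
  have "\<forall>\<^sub>F k in sequentially. 4 \<le> n k" using n_top by (simp add: filterlim_at_top)
  moreover have "\<forall>\<^sub>F k in sequentially. 2 \<le> real (m k - n k)"
    using m_minus_n_at_top unfolding filterlim_at_top by blast
  ultimately show ?thesis by eventually_elim auto
qed

lemma inverse_limits:
  "(\<lambda>k. 1 / real (n k)) \<longlonglongrightarrow> 0" "(\<lambda>k. 1 / real (m k)) \<longlonglongrightarrow> 0" "(\<lambda>k. 1 / real (m k - n k)) \<longlonglongrightarrow> 0"
  "(\<lambda>k. 1 / sqrt (real (m k))) \<longlonglongrightarrow> 0"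
  using real_n_at_top real_m_at_top m_minus_n_at_top filterlim_compose[OF sqrt_at_top real_m_at_top]
  by (auto intro!: tendsto_divide_0[OF tendsto_const] filterlim_at_top_imp_at_infinity)

lemma block_harmonic_limit: "(\<lambda>k. block_harmonic (n k) (m k)) \<longlonglongrightarrow> ln (1 / (1 - c))"
proof (rule tendsto_sandwich)
  let ?L = "\<lambda>k. ln (1 / (1 - real (n k) / real (m k)))"
  have L: "?L \<longlonglongrightarrow> ln (1 / (1 - c))" using ratio c by (intro tendsto_intros) auto
  have eq: "ln (real (m k) / real (m k - n k)) = ?L k" if "n k < m k" for k
    using that m_pos[of k] by (simp add: field_simps)
  show "(\<lambda>k. ?L k - 1 / real (m k - n k)) \<longlonglongrightarrow> ln (1 / (1 - c))"
    using tendsto_diff[OF L inverse_limits(3)] by simp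
  show "?L \<longlonglongrightarrow> ln (1 / (1 - c))" by (rule L)
  show "\<forall>\<^sub>F k in sequentially. ?L k - 1 / real (m k - n k) \<le> block_harmonic (n k) (m k)"
    using eventually_n_less
  proof eventually_elim
    case (elim k)
    then show ?case using harmonic_block_bounds(2)[OF elim] unfolding eq[OF elim] block_harmonic_def by simp
  qed
  show "\<forall>\<^sub>F k in sequentially. block_harmonic (n k) (m k) \<le> ?L k"
    using eventually_n_less
  proof eventually_elim
    case (elim k)
    then show ?case using harmonic_block_bounds(1)[OF elim] unfolding eq[OF elim] block_harmonic_def by simp
  qed
qed

lemma lin_variance_limit: "(\<lambda>k. lin_variance (n k) (m k)) \<longlonglongrightarrow> ln (1 / (1 - c)) - c"
  unfolding lin_variance_def by (intro tendsto_diff block_harmonic_limit ratio)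

lemma mu_bar_limit: "(\<lambda>k. mu_bar (real (n k) / real (m k))) \<longlonglongrightarrow> mu_bar c"
proof -
  obtain D where "(mu_bar has_field_derivative D) (at c)" using mu_bar_differentiable[OF c] by blast
  then have "isCont mu_bar c" by (rule DERIV_isCont)
  then show ?thesis using ratio by (rule isCont_tendsto_compose)
qed

lemma ratio_centre_limit: "(\<lambda>k. ratio_centre (n k) (m k)) \<longlonglongrightarrow> mu_bar c"
  by (rule Lim_transform_eventually[OF mu_bar_limit])
     (use eventually_n_less in eventually_elim, use ratio_centre_eq_mu_bar n_pos in auto)

text \<open>
  Both quotients are functions of \<open>n / m\<close>, times \<open>1 / m\<close> and \<open>1 / sqrt m\<close>.
\<close>

lemma quotient_limit: "(\<lambda>k. real (n k) / (real (m k - n k))\<^sup>2) \<longlonglongrightarrow> 0"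
  and sqrt_quotient_limit: "(\<lambda>k. sqrt (real (m k)) * real (n k) / (real (m k - n k))\<^sup>2) \<longlonglongrightarrow> 0"
proof -
  let ?r = "\<lambda>k. real (n k) / real (m k)"
  let ?q = "\<lambda>k. ?r k / (1 - ?r k)\<^sup>2"
  have q: "?q \<longlonglongrightarrow> c / (1 - c)\<^sup>2" using ratio c by (intro tendsto_intros) auto
  have eq: "real (n k) / (real (m k - n k))\<^sup>2 = ?q k * (1 / real (m k))" if "n k < m k" for k
  proof -
    have "real (m k - n k) = real (m k) * (1 - ?r k)" using that m_pos[of k] by (simp add: field_simps)
    then show ?thesis by (simp add: power_mult_distrib power2_eq_square)
  qed
  have sq: "sqrt (real (m k)) * (1 / real (m k)) = 1 / sqrt (real (m k))" for k
    using m_pos[of k] by (simp add: field_simps)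
  have "(\<lambda>k. ?q k * (1 / real (m k))) \<longlonglongrightarrow> 0" using tendsto_mult[OF q inverse_limits(2)] by simp
  then show "(\<lambda>k. real (n k) / (real (m k - n k))\<^sup>2) \<longlonglongrightarrow> 0"
    by (rule Lim_transform_eventually) (use eventually_n_less in eventually_elim, simp only: eq)
  have "(\<lambda>k. ?q k * (1 / sqrt (real (m k)))) \<longlonglongrightarrow> 0" using tendsto_mult[OF q inverse_limits(4)] by simp
  then show "(\<lambda>k. sqrt (real (m k)) * real (n k) / (real (m k - n k))\<^sup>2) \<longlonglongrightarrow> 0"
  proof (rule Lim_transform_eventually)
    show "\<forall>\<^sub>F k in sequentially. ?q k * (1 / sqrt (real (m k))) = sqrt (real (m k)) * real (n k) / (real (m k - n k))\<^sup>2"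
      using eventually_n_less
    proof eventually_elim
      case (elim k)
      have "sqrt (real (m k)) * real (n k) / (real (m k - n k))\<^sup>2 = sqrt (real (m k)) * (real (n k) / (real (m k - n k))\<^sup>2)"
        by simp
      also have "\<dots> = ?q k * (sqrt (real (m k)) * (1 / real (m k)))" unfolding eq[OF elim] by (simp only: mult.left_commute)
      finally show ?case unfolding sq by simp
    qed
  qed
qed

lemma remainder_bound_limit: "(\<lambda>k. remainder_bound (n k) (m k)) \<longlonglongrightarrow> 0"
proof -
  have "(\<lambda>k. 2 * (1 / real (m k)) + block_harmonic (n k) (m k) * (1 / sqrt (real (m k)))
      + 18 * (sqrt (real (m k)) * real (n k) / (real (m k - n k))\<^sup>2) + 1 / sqrt (real (m k))
      + (1 / 2 * (1 / real (m k - n k)) + 3 * (real (n k) / (real (m k - n k))\<^sup>2)))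
    \<longlonglongrightarrow> 2 * 0 + ln (1 / (1 - c)) * 0 + 18 * 0 + 0 + (1 / 2 * 0 + 3 * 0)"
    by (intro tendsto_intros inverse_limits block_harmonic_limit quotient_limit sqrt_quotient_limit)
  then show ?thesis by (simp add: remainder_bound_def mult.assoc)
qed

lemma char_error_limit: "(\<lambda>k. char_error (n k) (m k) (mu_bar c) t) \<longlonglongrightarrow> 0"
proof -
  let ?v = "ln (1 / (1 - c)) - c"
  have "(\<lambda>k. \<bar>t\<bar> * (ratio_centre (n k) (m k) * ((2 * lin_variance (n k) (m k) + 2) * (1 / real (n k)) + remainder_bound (n k) (m k))
         + \<bar>ratio_centre (n k) (m k) - mu_bar c\<bar> * (1 + lin_variance (n k) (m k)))
     + 2 * (4 * (1 / real (n k) * (1 / real (m k))) + 16 * (9 * (real (n k) / (real (m k - n k))\<^sup>2))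
         + 16 * (1 / real (n k))\<^sup>2 * lin_variance (n k) (m k) + remainder_bound (n k) (m k))
     + 2 * \<bar>t * mu_bar c\<bar> ^ 3 * (1 / real (m k - n k)) * lin_variance (n k) (m k))
   \<longlonglongrightarrow> \<bar>t\<bar> * (mu_bar c * ((2 * ?v + 2) * 0 + 0) + \<bar>mu_bar c - mu_bar c\<bar> * (1 + ?v))
     + 2 * (4 * (0 * 0) + 16 * (9 * 0) + 16 * 0\<^sup>2 * ?v + 0) + 2 * \<bar>t * mu_bar c\<bar> ^ 3 * 0 * ?v"
    by (intro tendsto_intros inverse_limits lin_variance_limit ratio_centre_limit remainder_bound_limit quotient_limit)
  then show ?thesis by (simp add: char_error_def power_divide)
qed

text \<open>
  The centring \<open>b\<close> is arbitrary up to \<open>o(1 / n)\<close>, which covers both choices in the theorem: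
  changing it multiplies the characteristic function by a phase that tends to one.
\<close>

lemma W0_converges_in_distribution:
  fixes P :: "nat \<Rightarrow> 'a measure" and X :: "nat \<Rightarrow> 'a \<Rightarrow> complex mat"
  assumes P: "\<And>k. prob_space (P k)" and s: "s > 0"
    and X: "\<And>k. gaussian_column_matrix (P k) (n k) (m k) s (X k)"
    and b: "(\<lambda>k. real (n k) * (mu_bar (real (n k) / real (m k)) - b k)) \<longlonglongrightarrow> 0"
  shows "converges_in_distribution P (\<lambda>k \<omega>. real (n k) * (W0 (X k \<omega>) - b k)) (real_gaussian 0 (sigma2_bar c))"
  unfolding converges_in_distribution_def
proof (rule weak_conv_m_of_char)
  let ?v = "ln (1 / (1 - c)) - c"
  have v: "?v > 0" by (rule lin_variance_limit_pos[OF c])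
  have mu: "mu_bar c > 0" using c by (simp add: mu_bar_def)
  show "sigma2_bar c > 0" unfolding sigma2_bar_eq using mu v by simp
  have meas: "(\<lambda>\<omega>. W0 (X k \<omega>)) \<in> borel_measurable (P k)" for k
    by (rule W0_measurable[OF P s n_pos m_pos X])
  show "real_distribution (distr (P k) borel (\<lambda>\<omega>. real (n k) * (W0 (X k \<omega>) - b k)))" for k
    using meas[of k]
    by (intro prob_space.real_distribution_distr P borel_measurable_times borel_measurable_diff borel_measurable_const)
  fix t :: real
  let ?\<phi> = "\<lambda>k. char (distr (P k) borel (\<lambda>\<omega>. real (n k) * (W0 (X k \<omega>) - ratio_centre (n k) (m k)))) t"
  let ?e = "\<lambda>k. real (n k) * (ratio_centre (n k) (m k) - b k)"
  have "(\<lambda>k. ?\<phi> k - complex_of_real (exp (- ((t * mu_bar c)\<^sup>2 * lin_variance (n k) (m k) / 2)))) \<longlonglongrightarrow> 0"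
  proof (rule Lim_null_comparison[OF _ char_error_limit])
    show "\<forall>\<^sub>F k in sequentially. cmod (?\<phi> k - complex_of_real (exp (- ((t * mu_bar c)\<^sup>2 * lin_variance (n k) (m k) / 2))))
        \<le> char_error (n k) (m k) (mu_bar c) t"
      using eventually_large by eventually_elim (use W0_char_bound[OF P s _ _ X] in auto)
  qed
  moreover have "(\<lambda>k. complex_of_real (exp (- ((t * mu_bar c)\<^sup>2 * lin_variance (n k) (m k) / 2))))
      \<longlonglongrightarrow> complex_of_real (exp (- ((t * mu_bar c)\<^sup>2 * ?v / 2)))"
    by (intro tendsto_intros lin_variance_limit) auto
  ultimately have phi: "?\<phi> \<longlonglongrightarrow> complex_of_real (exp (- ((t * mu_bar c)\<^sup>2 * ?v / 2)))"
    by (rule Lim_transform[rotated])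
  have "?e \<longlonglongrightarrow> 0"
    by (rule Lim_transform_eventually[OF b])
       (use eventually_n_less in eventually_elim, use ratio_centre_eq_mu_bar n_pos in auto)
  then have "(\<lambda>k. iexp (t * ?e k)) \<longlonglongrightarrow> iexp (t * 0)" by (intro tendsto_intros)
  then have lim: "(\<lambda>k. iexp (t * ?e k) * ?\<phi> k) \<longlonglongrightarrow> complex_of_real (exp (- ((t * mu_bar c)\<^sup>2 * ?v / 2)))"
    using tendsto_mult[OF _ phi] by fastforce
  have "char (distr (P k) borel (\<lambda>\<omega>. real (n k) * (W0 (X k \<omega>) - b k))) t = iexp (t * ?e k) * ?\<phi> k" for k
  proof -
    note [measurable] = meas[of k]
    have "iexp (t * (real (n k) * (W0 (X k \<omega>) - b k)))
        = iexp (t * ?e k) * iexp (t * (real (n k) * (W0 (X k \<omega>) - ratio_centre (n k) (m k))))" for \<omega>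
      by (simp add: exp_add[symmetric] algebra_simps)
    then show ?thesis by (simp add: char_def integral_distr)
  qed
  moreover have "(t * mu_bar c)\<^sup>2 * ?v / 2 = t\<^sup>2 * sigma2_bar c / 2"
    by (simp add: sigma2_bar_eq power_mult_distrib)
  ultimately show "(\<lambda>k. char (distr (P k) borel (\<lambda>\<omega>. real (n k) * (W0 (X k \<omega>) - b k))) t)
      \<longlonglongrightarrow> complex_of_real (exp (- (t\<^sup>2 * sigma2_bar c / 2)))"
    using lim by simp
qed

text \<open>
  Differentiability gives \<open>mu_bar z - mu_bar c = g z * (z - c)\<close> with \<open>g\<close> continuous at
  \<open>c\<close>.
\<close>

lemma mu_bar_recentring:
  assumes "(\<lambda>k. real (n k) * (real (n k) / real (m k) - c)) \<longlonglongrightarrow> 0"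
  shows "(\<lambda>k. real (n k) * (mu_bar (real (n k) / real (m k)) - mu_bar c)) \<longlonglongrightarrow> 0"
proof -
  obtain D where "(mu_bar has_field_derivative D) (at c)" using mu_bar_differentiable[OF c] by blast
  then obtain g where g: "\<And>z. mu_bar z - mu_bar c = g z * (z - c)" "isCont g c"
    unfolding CARAT_DERIV by blast
  have "(\<lambda>k. g (real (n k) / real (m k)) * (real (n k) * (real (n k) / real (m k) - c))) \<longlonglongrightarrow> g c * 0"
    by (intro tendsto_mult assms isCont_tendsto_compose[OF g(2) ratio])
  then show ?thesis unfolding g(1) by (simp add: mult.left_commute)
qed

end

theorem theorem2:
  fixes P :: "nat \<Rightarrow> 'a measure"
    and X :: "nat \<Rightarrow> 'a \<Rightarrow> complex mat"
    and n m :: "nat \<Rightarrow> nat"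
    and N0 c :: real
  assumes "\<And>k. prob_space (P k)"
    and "N0 > 0"
    and "\<And>k. n k > 0" and "\<And>k. m k > 0"
    and "\<And>k. gaussian_column_matrix (P k) (n k) (m k) N0 (X k)"
    and "filterlim n at_top sequentially"
    and "(\<lambda>k. real (n k) / real (m k)) \<longlonglongrightarrow> c"
    and "0 < c" and "c < 1"
  shows "converges_in_distribution P
           (\<lambda>k \<omega>. real (n k) * (W0 (X k \<omega>) - mu_bar (real (n k) / real (m k))))
           (real_gaussian 0 (sigma2_bar c)) \<and>
         ((\<lambda>k. real (n k) * (real (n k) / real (m k) - c)) \<longlonglongrightarrow> 0 \<longrightarrow>
          converges_in_distribution P
            (\<lambda>k \<omega>. real (n k) * (W0 (X k \<omega>) - mu_bar c))
            (real_gaussian 0 (sigma2_bar c)))"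
proof (intro conjI impI)
  note conv = W0_converges_in_distribution[OF assms(6,3,4,7,8,9) assms(1,2,5)]
  show "converges_in_distribution P
           (\<lambda>k \<omega>. real (n k) * (W0 (X k \<omega>) - mu_bar (real (n k) / real (m k))))
           (real_gaussian 0 (sigma2_bar c))"
    by (rule conv) simp
  assume "(\<lambda>k. real (n k) * (real (n k) / real (m k) - c)) \<longlonglongrightarrow> 0"
  then show "converges_in_distribution P
            (\<lambda>k \<omega>. real (n k) * (W0 (X k \<omega>) - mu_bar c))
            (real_gaussian 0 (sigma2_bar c))"
    by (intro conv mu_bar_recentring[OF assms(6,3,4,7,8,9)])
qed

end
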